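(* Let $G$ be an undirected graph without self-loops and without isolated vertices, with $n$ vertices and $m$ edges. Then the core-connectivity tree of $G$ has $O(n)$ nodes, and it (together with the minimum and maximum coreness labels of its nodes) can be computed in $O(n+m\,\alpha(n))$ time, where $\alpha(n)$ is the inverse of the Ackermann function.
   Context: For an integer $k\ge 1$, consider the maximal induced subgraph of $G$ in which every vertex has degree at least $k$ (equivalently, what remains after repeatedly deleting all vertices of degree less than $k$). Each connected component of this subgraph is called a $k$-core of $G$. By convention, the $0$-core of $G$ is the single set consisting of all vertices of $G$. The coreness $c(u)$ of a vertex $u$ is the largest $k$ such that $u$ belongs to some $k$-core, and $c(G)$ is the largest $k$ such that $G$ has a non-empty $k$-core. For any $k$-core $G_k$ and $(k+1)$-core $G_{k+1}$, either they are vertex-disjoint or $V(G_{k+1})\subseteq V(G_k)$. The (uncontracted) core-connectivity tree of $G$ is the rooted tree whose leaves are the vertices of $G$ and whose non-leaf nodes are all the $k$-cores of $G$ for $k=0,\dots,c(G)$; its root is the $0$-core; the parent of a leaf $u$ is the $k$-core with maximum $k$ containing $u$; and a $k$-core $G_k$ is the parent of a $(k+1)$-core $G_{k+1}$ whenever $V(G_{k+1})\subseteq V(G_k)$. The core-connectivity tree $T$ of $G$ is obtained from this tree by contracting every maximal chain of nodes $\mu_k,\dots,\mu_{k+h}$ (corresponding to a $k$-, $(k+1)$-, \dots, $(k+h)$-core) in which each $\mu_i$ ($i<k+h$) has $\mu_{i+1}$ as its only child into a single node $\mu$, labeled with $\min_c(\mu)=k$ and $\max_c(\mu)=k+h$;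 every node of $T$ is labeled with its minimum and maximum coreness. *)

theory Defs
  imports Main
begin

section \<open>Graphs and \<open>k\<close>-cores\<close>

record 'a ugraph =
  verts :: "'a set"
  edges :: "'a set set"

definition simple_graph :: "'a ugraph \<Rightarrow> bool" where
  "simple_graph G \<longleftrightarrow> finite (verts G) \<and> (\<forall>e\<in>edges G. e \<subseteq> verts G \<and> card e = 2)"

definition neighbours :: "'a ugraph \<Rightarrow> 'a \<Rightarrow> 'a set" where
  "neighbours G v = {w. {v, w} \<in> edges G}"

definition no_isolated :: "'a ugraph \<Rightarrow> bool" where
  "no_isolated G \<longleftrightarrow> (\<forall>v\<in>verts G. neighbours G v \<noteq> {})"

definition min_degree_ge :: "'a ugraph \<Rightarrow> nat \<Rightarrow> 'a set \<Rightarrow> bool" where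
  "min_degree_ge G k S \<longleftrightarrow> S \<subseteq> verts G \<and> (\<forall>v\<in>S. k \<le> card (neighbours G v \<inter> S))"

text \<open>The vertex set of the maximal induced subgraph of minimum degree at least \<open>k\<close>.
  The sets satisfying \<^const>\<open>min_degree_ge\<close> are closed under union, so their union is the
  greatest one; see \<open>core_verts_min_degree\<close> and \<open>core_verts_greatest\<close>.\<close>

definition core_verts :: "'a ugraph \<Rightarrow> nat \<Rightarrow> 'a set" where
  "core_verts G k = \<Union>{S. min_degree_ge G k S}"

lemma core_verts_greatest: "min_degree_ge G k S \<Longrightarrow> S \<subseteq> core_verts G k"
  by (auto simp: core_verts_def)

lemma core_verts_min_degree:
  assumes "simple_graph G"
  shows "min_degree_ge G k (core_verts G k)"
  unfolding min_degree_ge_def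
proof (intro conjI ballI)
  show sub: "core_verts G k \<subseteq> verts G"
    by (auto simp: core_verts_def min_degree_ge_def)
  fix v assume "v \<in> core_verts G k"
  then obtain S where S: "min_degree_ge G k S" "v \<in> S"
    by (auto simp: core_verts_def)
  have "finite (core_verts G k)"
    using sub assms by (auto simp: simple_graph_def intro: finite_subset)
  then have "card (neighbours G v \<inter> S) \<le> card (neighbours G v \<inter> core_verts G k)"
    using core_verts_greatest[OF S(1)] by (intro card_mono) auto
  then show "k \<le> card (neighbours G v \<inter> core_verts G k)"
    using S by (auto simp: min_degree_ge_def)
qed

definition reach_in :: "'a ugraph \<Rightarrow> 'a set \<Rightarrow> 'a \<Rightarrow> 'a \<Rightarrow> bool" where
  "reach_in G S = (\<lambda>x y. x \<in> S \<and> y \<in> S \<and> {x, y} \<in> edges G)\<^sup>*\<^sup>*"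

definition components :: "'a ugraph \<Rightarrow> 'a set \<Rightarrow> 'a set set" where
  "components G S = {{w\<in>S. reach_in G S u w} | u. u \<in> S}"

definition cores :: "'a ugraph \<Rightarrow> nat \<Rightarrow> 'a set set" where
  "cores G k = (if k = 0 then {verts G} else components G (core_verts G k))"

definition coreness :: "'a ugraph \<Rightarrow> 'a \<Rightarrow> nat" where
  "coreness G u = (GREATEST k. \<exists>K\<in>cores G k. u \<in> K)"

definition max_coreness :: "'a ugraph \<Rightarrow> nat" where
  "max_coreness G = (GREATEST k. \<exists>K\<in>cores G k. K \<noteq> {})"


section \<open>The core-connectivity tree\<close>

text \<open>The same vertex set may be a \<open>k\<close>-core for several \<open>k\<close>; these are different nodes of the
  uncontracted tree, hence the level in \<open>Core\<close>.\<close>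

datatype 'a node = Leaf 'a | Core nat "'a set"

definition leaf_nodes :: "'a ugraph \<Rightarrow> 'a node set" where
  "leaf_nodes G = Leaf ` verts G"

definition core_nodes :: "'a ugraph \<Rightarrow> 'a node set" where
  "core_nodes G = {Core k K | k K. k \<le> max_coreness G \<and> K \<in> cores G k}"

text \<open>Pairs (child, parent) of the uncontracted tree.\<close>

definition unc_parent :: "'a ugraph \<Rightarrow> ('a node \<times> 'a node) set" where
  "unc_parent G =
     {(Leaf u, Core (coreness G u) K) | u K.
        u \<in> verts G \<and> K \<in> cores G (coreness G u) \<and> u \<in> K} \<union>
     {(Core (Suc k) L, Core k K) | k K L.
        Core (Suc k) L \<in> core_nodes G \<and> Core k K \<in> core_nodes G \<and> L \<subseteq> K}"

definition unc_children :: "'a ugraph \<Rightarrow> 'a node \<Rightarrow> 'a node set" where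
  "unc_children G x = {y. (y, x) \<in> unc_parent G}"

definition chain :: "'a ugraph \<Rightarrow> 'a node list \<Rightarrow> bool" where
  "chain G xs \<longleftrightarrow> xs \<noteq> [] \<and> set xs \<subseteq> core_nodes G \<and>
     (\<forall>i. Suc i < length xs \<longrightarrow> unc_children G (xs ! i) = {xs ! Suc i})"

definition maximal_chain :: "'a ugraph \<Rightarrow> 'a node list \<Rightarrow> bool" where
  "maximal_chain G xs \<longleftrightarrow> chain G xs \<and> \<not> (\<exists>ys. chain G ys \<and> set xs \<subset> set ys)"

text \<open>A node of the contracted tree is represented by the set of uncontracted nodes that are
  merged into it: the nodes of a maximal chain, or a single leaf.\<close>

definition cct_nodes :: "'a ugraph \<Rightarrow> 'a node set set" where
  "cct_nodes G = (\<lambda>x. {x}) ` leaf_nodes G \<union> {set xs | xs. maximal_chain G xs}"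

definition cct_parent :: "'a ugraph \<Rightarrow> ('a node set \<times> 'a node set) set" where
  "cct_parent G = {(X, Y). X \<in> cct_nodes G \<and> Y \<in> cct_nodes G \<and> X \<noteq> Y \<and>
     (\<exists>x\<in>X. \<exists>y\<in>Y. (x, y) \<in> unc_parent G)}"

definition cct_is_root :: "'a ugraph \<Rightarrow> 'a node set \<Rightarrow> bool" where
  "cct_is_root G X \<longleftrightarrow> X \<in> cct_nodes G \<and> Core 0 (verts G) \<in> X"

text \<open>A leaf carries the coreness of its vertex as both labels.\<close>

fun level :: "'a ugraph \<Rightarrow> 'a node \<Rightarrow> nat" where
  "level G (Leaf u) = coreness G u"
| "level G (Core k K) = k"

definition min_c :: "'a ugraph \<Rightarrow> 'a node set \<Rightarrow> nat" where
  "min_c G X = Min (level G ` X)"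

definition max_c :: "'a ugraph \<Rightarrow> 'a node set \<Rightarrow> nat" where
  "max_c G X = Max (level G ` X)"


section \<open>The inverse Ackermann function\<close>

fun ack :: "nat \<Rightarrow> nat \<Rightarrow> nat" where
  "ack 0 n = Suc n"
| "ack (Suc m) 0 = ack m 1"
| "ack (Suc m) (Suc n) = ack m (ack (Suc m) n)"

definition alpha :: "nat \<Rightarrow> nat" where
  "alpha n = (LEAST k. n \<le> ack k k)"


section \<open>Machine model\<close>

text \<open>Programs for a unit-cost random access machine, in structured form. The memory consists of
  natural-number registers and arrays; a program can only mention finitely many of them.
  Successor is the only operation that can produce a value larger than its operands
  and the program's constants. So a program started on values at most \<open>M\<close> only creates values
  at most \<open>M + O(t)\<close> in time \<open>t\<close>, that is, its words have logarithmic length,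
  and unit costs are not abused by computing with huge numbers.\<close>

record state =
  regs :: "nat \<Rightarrow> nat"
  arrs :: "nat \<Rightarrow> nat \<Rightarrow> nat"

datatype aexp =
    Const nat
  | Reg nat
  | Read nat aexp
  | Succ aexp
  | Minus aexp aexp

datatype bexp =
    Less aexp aexp
  | Not bexp
  | And bexp bexp

datatype com =
    Skip
  | Assign nat aexp
  | Write nat aexp aexp
  | Seq com com
  | If bexp com com
  | While bexp com

text \<open>\<open>Minus\<close> is truncated subtraction.\<close>

fun aval :: "aexp \<Rightarrow> state \<Rightarrow> nat" where
  "aval (Const c) s = c"
| "aval (Reg r) s = regs s r"
| "aval (Read a e) s = arrs s a (aval e s)"
| "aval (Succ e) s = Suc (aval e s)"
| "aval (Minus e f) s = aval e s - aval f s"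

fun bval :: "bexp \<Rightarrow> state \<Rightarrow> bool" where
  "bval (Less e f) s \<longleftrightarrow> aval e s < aval f s"
| "bval (Not b) s \<longleftrightarrow> \<not> bval b s"
| "bval (And b d) s \<longleftrightarrow> bval b s \<and> bval d s"

fun acost :: "aexp \<Rightarrow> nat" where
  "acost (Const c) = 1"
| "acost (Reg r) = 1"
| "acost (Read a e) = 1 + acost e"
| "acost (Succ e) = 1 + acost e"
| "acost (Minus e f) = 1 + acost e + acost f"

fun bcost :: "bexp \<Rightarrow> nat" where
  "bcost (Less e f) = 1 + acost e + acost f"
| "bcost (Not b) = 1 + bcost b"
| "bcost (And b d) = 1 + bcost b + bcost d"

text \<open>\<open>exec c s t s'\<close>: started in \<open>s\<close>, the program \<open>c\<close> halts in \<open>s'\<close> after time \<open>t\<close>.\<close>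

inductive exec :: "com \<Rightarrow> state \<Rightarrow> nat \<Rightarrow> state \<Rightarrow> bool" where
  "exec Skip s 1 s"
| "exec (Assign r e) s (1 + acost e) (s\<lparr>regs := (regs s)(r := aval e s)\<rparr>)"
| "exec (Write a e f) s (1 + acost e + acost f)
     (s\<lparr>arrs := (arrs s)(a := (arrs s a)(aval e s := aval f s))\<rparr>)"
| "exec c s t s' \<Longrightarrow> exec d s' u s'' \<Longrightarrow> exec (Seq c d) s (t + u) s''"
| "bval b s \<Longrightarrow> exec c s t s' \<Longrightarrow> exec (If b c d) s (1 + bcost b + t) s'"
| "\<not> bval b s \<Longrightarrow> exec d s t s' \<Longrightarrow> exec (If b c d) s (1 + bcost b + t) s'"
| "\<not> bval b s \<Longrightarrow> exec (While b c) s (1 + bcost b) s"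
| "bval b s \<Longrightarrow> exec c s t s' \<Longrightarrow> exec (While b c) s' u s'' \<Longrightarrow>
     exec (While b c) s (1 + bcost b + t + u) s''"

inductive_cases exec_SkipE: "exec Skip s t s'"
inductive_cases exec_AssignE: "exec (Assign r e) s t s'"
inductive_cases exec_WriteE: "exec (Write a e f) s t s'"
inductive_cases exec_SeqE: "exec (Seq c d) s t s'"
inductive_cases exec_IfE: "exec (If b c d) s t s'"
inductive_cases exec_WhileE: "exec (While b c) s t s'"

lemma exec_deterministic:
  "exec c s t s' \<Longrightarrow> exec c s u s'' \<Longrightarrow> u = t \<and> s'' = s'"
proof (induction arbitrary: u s'' rule: exec.induct)
  case (1 s)
  then show ?case by (elim exec_SkipE) simp
next
  case (2 r e s)
  then show ?case by (elim exec_AssignE) simp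
next
  case (3 a e f s)
  then show ?case by (elim exec_WriteE) simp
next
  case (4 c s t s' d v s1)
  from 4(5) obtain t2 r u2 where
    *: "u = t2 + u2" "exec c s t2 r" "exec d r u2 s''"
    by (rule exec_SeqE)
  show ?case using 4(3)[OF *(2)] 4(4)[of u2 s''] * by simp
next
  case (5 b s c t s' d)
  from 5(4) show ?case by (rule exec_IfE) (use 5(1) in \<open>auto dest: 5(3)\<close>)
next
  case (6 b s d t s' c)
  from 6(4) show ?case by (rule exec_IfE) (use 6(1) in \<open>auto dest: 6(3)\<close>)
next
  case (7 b s c)
  from 7(2) show ?case by (rule exec_WhileE) (use 7(1) in auto)
next
  case (8 b s c t s' v s1)
  from 8(6) obtain t2 r u2 where
    *: "u = 1 + bcost b + t2 + u2" "exec c s t2 r" "exec (While b c) r u2 s''"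
    by (rule exec_WhileE) (use 8(1) in auto)
  show ?case using 8(4)[OF *(2)] 8(5)[of u2 s''] * by simp
qed


section \<open>Input and output\<close>

text \<open>A graph on the vertices \<open>0, \<dots>, n - 1\<close> is given by its adjacency lists, with the
  neighbours of each vertex in arbitrary order.\<close>

definition adjacency_lists :: "nat ugraph \<Rightarrow> nat list list \<Rightarrow> bool" where
  "adjacency_lists G xss \<longleftrightarrow> verts G = {..<length xss} \<and>
     (\<forall>v<length xss. distinct (xss ! v) \<and> set (xss ! v) = neighbours G v)"

text \<open>Register 0 holds \<open>n\<close>, array 1 the concatenation of the adjacency lists, and array 0 the
  positions where they begin: the neighbours of \<open>v\<close> are stored in array 1 between the indices
  \<open>arrs s 0 v\<close> (inclusive) and \<open>arrs s 0 (Suc v)\<close> (exclusive). The rest of the memory is 0.\<close>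

definition input_state :: "nat list list \<Rightarrow> state" where
  "input_state xss = \<lparr>
     regs = (\<lambda>_. 0)(0 := length xss),
     arrs = (\<lambda>_ _. 0)(
       0 := (\<lambda>i. if i \<le> length xss then length (concat (take i xss)) else 0),
       1 := (\<lambda>j. if j < length (concat xss) then concat xss ! j else 0))\<rparr>"

text \<open>The tree is returned as an array of parents. Register 1 holds the number \<open>N\<close> of its nodes,
  which are numbered \<open>0, \<dots>, N - 1\<close> in such a way that the number of the leaf of vertex \<open>v\<close> is
  \<open>v\<close>. Array 2 holds the parents (the root being its own parent), arrays 3 and 4 the labels.\<close>

definition represents_cct :: "state \<Rightarrow> nat ugraph \<Rightarrow> bool" where
  "represents_cct s G \<longleftrightarrow>
     (\<exists>\<phi>. bij_betw \<phi> {..<regs s 1} (cct_nodes G) \<and>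
        (\<forall>v\<in>verts G. v < regs s 1 \<and> \<phi> v = {Leaf v}) \<and>
        (\<forall>i<regs s 1.
           (if cct_is_root G (\<phi> i) then arrs s 2 i = i
            else arrs s 2 i < regs s 1 \<and>
                 {Y. (\<phi> i, Y) \<in> cct_parent G} = {\<phi> (arrs s 2 i)}) \<and>
           arrs s 3 i = min_c G (\<phi> i) \<and>
           arrs s 4 i = max_c G (\<phi> i)))"

end

theory Submission
  imports Defs
begin

text \<open>The coreness of a vertex is at most its degree, so the corenesses sum up to at most
  \<open>2m\<close>. Hence the uncontracted tree has only \<open>O(n + m)\<close> nodes, and it can be built explicitly
  in linear time without a union-find structure; the factor \<open>\<alpha>(n)\<close> is not needed.

  The corenesses are computed by peeling: the vertices that survive a level are queued again for the
  next one, which happens to each vertex at most as often as its degree. The tree is built by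
  flooding the graph with the coreness as altitude: a vertex of the highest level reached so far is
  explored first, and an undiscovered neighbour of higher coreness is entered at once, opening a new
  core for each level in between. A core is closed when no unfinished vertex of its level is left; as
  all neighbours of a finished vertex are discovered, so is then the whole core. Climbing to a new
  vertex \<open>v\<close> and descending again costs \<open>O(c(v))\<close>. Finally a core is merged with its
  parent if it is the only child.

  The number of contracted nodes is linear, since a chain ends in a core that is the parent of a leaf
  or has two children.\<close>

section \<open>Cores and their parents\<close>

text \<open>Every loop body is itself loop-free and thus has constant cost, so a time bound amounts
  to counting iterations, and each iteration lowers a natural-number potential whose initial value
  is O(n + m). This shapes both traversals: nested loops are flattened into one, with stacks, lists
  and a pending vertex kept in memory, and a climb of several levels is spread over several
  iterations. The factors in the potentials are chosen so that every branch of the body releases at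
  least one unit. On the side of the tree, a core is named by its level and any one of its vertices.
  Maximal chains turn out to be exactly the classes of cores connected by only-child links, so
  comparing the number of children of the parent with 2 decides every merge locally; as parents are
  numbered before their child cores, a single pass suffices. The stated bound follows from O(n + m)
  because \<alpha>(n) is positive as soon as there is an edge.\<close>

lemma finite_neighbours:
  assumes "simple_graph G" shows "finite (neighbours G v)" "neighbours G v \<subseteq> verts G"
proof -
  show "neighbours G v \<subseteq> verts G"
    using assms unfolding simple_graph_def neighbours_def by blast
  then show "finite (neighbours G v)"
    using assms finite_subset unfolding simple_graph_def by blast
qed

lemma neighbours_sym: "w \<in> neighbours G v \<longleftrightarrow> v \<in> neighbours G w"
  by (simp add: neighbours_def insert_commute)

lemma core_verts_subset: "core_verts G k \<subseteq> verts G"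
  by (auto simp: core_verts_def min_degree_ge_def)

lemma core_verts_antimono: "j \<le> k \<Longrightarrow> core_verts G k \<subseteq> core_verts G j"
  unfolding core_verts_def min_degree_ge_def by (intro Union_mono Collect_mono) auto

lemma core_verts_0: "core_verts G 0 = verts G"
  using core_verts_subset[of G 0] core_verts_greatest[of G 0 "verts G"]
  by (auto simp: min_degree_ge_def)

lemma core_verts_degree:
  assumes "simple_graph G" "v \<in> core_verts G k"
  shows "k \<le> card (neighbours G v \<inter> core_verts G k)"
  using core_verts_min_degree[OF assms(1), of k] assms(2) by (auto simp: min_degree_ge_def)

lemma core_verts_le_degree:
  assumes "simple_graph G" "v \<in> core_verts G k"
  shows "k \<le> card (neighbours G v)"
  using core_verts_degree[OF assms] card_mono[OF finite_neighbours(1)[OF assms(1)], of "neighbours G v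
    \<inter> core_verts G k" v]
  by auto

text \<open>Names the \<open>k\<close>-core by one of its vertices \<open>v\<close>. Level 0 is
  separate because the 0-core is the whole vertex set even if \<open>G\<close> is disconnected. If
  \<open>k > 0\<close> and \<open>v\<close> lies in no \<open>k\<close>-core, the value is the empty
  set.\<close>

definition core_of :: "'a ugraph \<Rightarrow> nat \<Rightarrow> 'a \<Rightarrow> 'a set" where
  "core_of G k v =
     (if k = 0 then verts G else {w \<in> core_verts G k. reach_in G (core_verts G k) v w})"

lemma reach_in_sym: "reach_in G S x y \<Longrightarrow> reach_in G S y x"
  unfolding reach_in_def
proof (induction rule: rtranclp_induct)
  case (step y z)
  show ?case
    by (rule converse_rtranclp_into_rtranclp[OF _ step.IH])
      (use step.hyps in \<open>simp add: insert_commute\<close>)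
qed simp

lemma reach_in_trans: "reach_in G S x y \<Longrightarrow> reach_in G S y z \<Longrightarrow> reach_in G S x z"
  unfolding reach_in_def by (rule rtranclp_trans)

lemma reach_in_mono: "S \<subseteq> T \<Longrightarrow> reach_in G S x y \<Longrightarrow> reach_in G T x y"
  unfolding reach_in_def by (erule rtranclp_mono[THEN predicate2D, rotated]) auto

lemma reach_in_refl: "reach_in G S x x"
  by (simp add: reach_in_def)

lemma core_of_self: "v \<in> core_verts G k \<Longrightarrow> v \<in> core_of G k v"
  using core_verts_subset[of G k] by (auto simp: core_of_def reach_in_refl)

lemma core_of_subset: "core_of G k v \<subseteq> core_verts G k"
  by (auto simp: core_of_def core_verts_0)

lemma core_of_eq: "w \<in> core_of G k v \<Longrightarrow> core_of G k w = core_of G k v"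
  by (auto simp: core_of_def split: if_splits intro: reach_in_trans reach_in_sym)

lemma core_of_antimono: "j \<le> k \<Longrightarrow> core_of G k v \<subseteq> core_of G j v"
  using core_verts_antimono[of j k G] core_verts_subset[of G k]
  by (auto simp: core_of_def intro: reach_in_mono)

lemma core_of_edge:
  assumes "w \<in> neighbours G v" "v \<in> core_verts G k" "w \<in> core_verts G k"
  shows "core_of G k w = core_of G k v"
proof (cases "k = 0")
  case False
  then have "w \<in> core_of G k v"
    using assms by (auto simp: core_of_def reach_in_def neighbours_def)
  then show ?thesis by (rule core_of_eq)
qed (simp add: core_of_def)

text \<open>Follow a path inside the core from \<open>x\<close>. This is how flooding certifies that
  a core has been discovered completely; \<open>k > 0\<close> guarantees that the core is
  connected.\<close>

lemma core_of_closed: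
  assumes "k > 0" "x \<in> core_of G k v" "x \<in> S"
    and closed: "\<And>y z. y \<in> S \<Longrightarrow> y \<in> core_of G k v \<Longrightarrow> z \<in>
      neighbours G y \<Longrightarrow> z \<in> S"
  shows "core_of G k v \<subseteq> S"
proof
  fix w assume "w \<in> core_of G k v"
  then have "w \<in> core_of G k x"
    using core_of_eq[OF assms(2)] by simp
  then have "reach_in G (core_verts G k) x w"
    using assms(1) by (simp add: core_of_def)
  then have "w \<in> S \<and> w \<in> core_of G k v"
    unfolding reach_in_def
  proof (induction rule: rtranclp_induct)
    case (step y z)
    then have "z \<in> neighbours G y" by (simp add: neighbours_def)
    moreover have "z \<in> core_of G k v"
      using step core_of_edge[OF \<open>z \<in> neighbours G y\<close>, of k] core_of_self core_of_eq
      by metis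
    ultimately show ?case using closed step by auto
  qed (use assms in auto)
  then show "w \<in> S" ..
qed

lemma cores_eq: "verts G \<noteq> {} \<Longrightarrow> cores G k = core_of G k ` core_verts G k"
  by (auto simp: cores_def core_of_def components_def core_verts_0)

lemma cores_member_eq:
  assumes "verts G \<noteq> {}" "K \<in> cores G k" "u \<in> K"
  shows "K = core_of G k u"
proof -
  obtain v where "K = core_of G k v" using assms by (auto simp: cores_eq)
  then show ?thesis using core_of_eq[of u G k v] assms(3) by simp
qed

lemma in_cores_iff: "verts G \<noteq> {} \<Longrightarrow> (\<exists>K\<in>cores G k. u \<in> K)
  \<longleftrightarrow> u \<in> core_verts G k"
  using core_of_self[of u G k] core_of_subset[of G k] by (auto simp: cores_eq)

text \<open>The degree of \<open>u\<close> bounds the levels of its cores, so the maximum defining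
  the coreness exists, and the sets \<open>core_verts G k\<close> are nested. Later arguments speak
  of coreness only through this equivalence.\<close>

lemma le_coreness_iff:
  assumes "simple_graph G" "u \<in> verts G"
  shows "k \<le> coreness G u \<longleftrightarrow> u \<in> core_verts G k"
proof -
  have V: "verts G \<noteq> {}" using assms by auto
  have c: "coreness G u = (GREATEST k. u \<in> core_verts G k)"
    by (simp add: coreness_def in_cores_iff[OF V])
  have b: "\<forall>k. u \<in> core_verts G k \<longrightarrow> k \<le> card (neighbours G u)"
    using core_verts_le_degree[OF assms(1), of u] by blast
  have z: "u \<in> core_verts G 0" using assms by (simp add: core_verts_0)
  have "u \<in> core_verts G (coreness G u)"
    unfolding c by (rule GreatestI_nat[of "\<lambda>k. u \<in> core_verts G k" 0, OF z b[rule_format]])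
  moreover have "k \<le> coreness G u" if "u \<in> core_verts G k"
    unfolding c by (rule Greatest_le_nat[of "\<lambda>k. u \<in> core_verts G k" k, OF that b[rule_format]])
  ultimately show ?thesis using core_verts_antimono[of k "coreness G u" G] by blast
qed

text \<open>A degree is at most the number of vertices, so the maximum exists. Hence the level bound
  in \<open>core_nodes\<close> holds for every nonempty core.\<close>

lemma le_max_coreness_iff:
  assumes "simple_graph G" "verts G \<noteq> {}"
  shows "k \<le> max_coreness G \<longleftrightarrow> core_verts G k \<noteq> {}"
proof -
  have fin: "finite (verts G)" using assms by (simp add: simple_graph_def)
  have c: "max_coreness G = (GREATEST k. core_verts G k \<noteq> {})"
  proof -
    have "(\<exists>K\<in>cores G k. K \<noteq> {}) \<longleftrightarrow> core_verts G k \<noteq> {}" for k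
      using in_cores_iff[OF assms(2), of k] by (metis all_not_in_conv)
    then show ?thesis by (simp add: max_coreness_def)
  qed
  have b: "\<forall>k. core_verts G k \<noteq> {} \<longrightarrow> k \<le> card (verts G)"
  proof (intro allI impI)
    fix k assume "core_verts G k \<noteq> {}"
    then obtain v where "v \<in> core_verts G k" by auto
    then show "k \<le> card (verts G)"
      using core_verts_le_degree[OF assms(1), of v k] card_mono[OF fin finite_neighbours(2)[OF assms(1)],
        of v]
      by linarith
  qed
  have "core_verts G (max_coreness G) \<noteq> {}"
    unfolding c by (rule GreatestI_nat[of "\<lambda>k. core_verts G k \<noteq> {}" 0, OF _ b[rule_format]])
      (use assms in \<open>simp add: core_verts_0\<close>)
  moreover have "k \<le> max_coreness G" if "core_verts G k \<noteq> {}"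
    unfolding c by (rule Greatest_le_nat[of "\<lambda>k. core_verts G k \<noteq> {}" k, OF that
      b[rule_format]])
  ultimately show ?thesis using core_verts_antimono[of k "max_coreness G" G] by blast
qed

lemma core_nodes_eq:
  assumes "simple_graph G" "verts G \<noteq> {}"
  shows "core_nodes G = {Core k (core_of G k v) | k v. v \<in> core_verts G k}"
  using le_max_coreness_iff[OF assms] by (auto simp: core_nodes_def cores_eq[OF assms(2)])

lemma Core_in_core_nodes:
  assumes "simple_graph G" "v \<in> core_verts G k"
  shows "Core k (core_of G k v) \<in> core_nodes G"
proof -
  have "verts G \<noteq> {}" using assms(2) core_verts_subset by fastforce
  then show ?thesis using assms by (auto simp: core_nodes_eq)
qed

lemma root_in_core_nodes:
  assumes "simple_graph G" "verts G \<noteq> {}"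
  shows "Core 0 (verts G) \<in> core_nodes G"
  using Core_in_core_nodes[OF assms(1), of _ 0] assms(2) by (auto simp: core_verts_0 core_of_def)

lemma finite_core_nodes:
  assumes "simple_graph G" "verts G \<noteq> {}"
  shows "finite (core_nodes G)"
proof -
  have fin: "finite (verts G)" using assms by (simp add: simple_graph_def)
  have "core_nodes G \<subseteq> (\<lambda>(k, v). Core k (core_of G k v)) ` ({..max_coreness G} \<times>
    verts G)"
  proof
    fix x assume "x \<in> core_nodes G"
    then obtain k v where v: "x = Core k (core_of G k v)" "v \<in> core_verts G k"
      by (auto simp: core_nodes_eq[OF assms])
    then have "(k, v) \<in> {..max_coreness G} \<times> verts G"
      using le_max_coreness_iff[OF assms, of k] core_verts_subset[of G k] by auto
    then show "x \<in> (\<lambda>(k, v). Core k (core_of G k v)) ` ({..max_coreness G} \<times> verts G)"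
      using v(1) by (intro image_eqI[of _ _ "(k, v)"]) simp
  qed
  then show ?thesis by (rule finite_subset) (use fin in simp)
qed

lemma parent_Leaf:
  assumes "simple_graph G" "u \<in> verts G"
  shows "(Leaf u, y) \<in> unc_parent G \<longleftrightarrow> y = Core (coreness G u) (core_of G (coreness
    G u) u)"
proof -
  have "verts G \<noteq> {}" using assms by auto
  moreover have "u \<in> core_verts G (coreness G u)"
    using le_coreness_iff[OF assms, of "coreness G u"] by simp
  ultimately have "(K \<in> cores G (coreness G u) \<and> u \<in> K) \<longleftrightarrow> K = core_of G
    (coreness G u) u" for K
    using cores_member_eq[of G K "coreness G u" u] core_of_self[of u G "coreness G u"]
    by (auto simp: cores_eq)
  then show ?thesis
    using assms(2) by (auto simp: unc_parent_def)
qed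

text \<open>A \<open>k\<close>-core above the given one contains \<open>v\<close>, and the
  \<open>k\<close>-core containing \<open>v\<close> is unique.\<close>

lemma parent_Core:
  assumes "simple_graph G" "v \<in> core_verts G (Suc k)"
  shows "(Core (Suc k) (core_of G (Suc k) v), y) \<in> unc_parent G \<longleftrightarrow> y = Core k
    (core_of G k v)"
    (is "?L \<longleftrightarrow> _")
proof -
  have V: "verts G \<noteq> {}" using assms(2) core_verts_subset by fastforce
  have v: "v \<in> core_verts G k" using assms(2) core_verts_antimono[of k "Suc k" G] by auto
  have "?L \<longleftrightarrow> (\<exists>K. y = Core k K \<and> Core k K \<in> core_nodes G \<and>
    core_of G (Suc k) v \<subseteq> K)"
    using Core_in_core_nodes[OF assms] unfolding unc_parent_def by auto
  also have "\<dots> \<longleftrightarrow> y = Core k (core_of G k v)"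
  proof
    assume "\<exists>K. y = Core k K \<and> Core k K \<in> core_nodes G \<and> core_of G (Suc k) v
      \<subseteq> K"
    then obtain K where *: "y = Core k K" "K \<in> cores G k" "core_of G (Suc k) v \<subseteq> K"
      by (auto simp: core_nodes_def)
    then have "v \<in> K" using core_of_self[OF assms(2)] by auto
    then show "y = Core k (core_of G k v)" using cores_member_eq[OF V *(2)] *(1) by simp
  next
    assume "y = Core k (core_of G k v)"
    then show "\<exists>K. y = Core k K \<and> Core k K \<in> core_nodes G \<and> core_of G (Suc k) v
      \<subseteq> K"
      using Core_in_core_nodes[OF assms(1) v] core_of_antimono[of k "Suc k" G v] by auto
  qed
  finally show ?thesis .
qed

text \<open>Describes both ends of a tree edge by a single vertex, which reduces statements about
  parents to statements about \<open>core_of\<close>.\<close>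

lemma unc_parent_cases:
  assumes "simple_graph G" "(x, y) \<in> unc_parent G"
  obtains (Leaf) u where "u \<in> verts G" "x = Leaf u" "y = Core (coreness G u) (core_of G (coreness G u) u)"
    "u \<in> core_verts G (coreness G u)"
  | (Core) k v where "v \<in> core_verts G (Suc k)" "v \<in> core_verts G k"
      "x = Core (Suc k) (core_of G (Suc k) v)" "y = Core k (core_of G k v)"
proof (cases x)
  case (Leaf u)
  then have u: "u \<in> verts G" using assms(2) by (auto simp: unc_parent_def)
  then show ?thesis using that(1) assms Leaf parent_Leaf[OF assms(1) u] le_coreness_iff[OF assms(1) u, of
    "coreness G u"]
    by auto
next
  case (Core l K)
  then obtain k where k: "l = Suc k" "x \<in> core_nodes G" using assms(2) by (auto simp: unc_parent_def)
  then have "\<exists>v. v \<in> core_verts G (Suc k) \<and> x = Core (Suc k) (core_of G (Suc k) v)"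
    using Core by (auto simp: core_nodes_def cores_def components_def core_of_def)
  then obtain v where v: "v \<in> core_verts G (Suc k)" "x = Core (Suc k) (core_of G (Suc k) v)" by auto
  moreover have "y = Core k (core_of G k v)"
    using parent_Core[OF assms(1) v(1)] v assms(2) by simp
  moreover have "v \<in> core_verts G k" using v(1) core_verts_antimono[of k "Suc k" G] by auto
  ultimately show ?thesis using that(2) by blast
qed

lemma unc_parent_unique:
  assumes "simple_graph G" "(x, y) \<in> unc_parent G" "(x, z) \<in> unc_parent G"
  shows "y = z"
  using assms(1,2)
proof (cases rule: unc_parent_cases)
  case (Leaf u)
  then show ?thesis using assms parent_Leaf by fastforce
next
  case (Core k v)
  then show ?thesis using assms parent_Core by fastforce
qed

lemma unc_parent_in_core_nodes:
  assumes "simple_graph G" "(x, y) \<in> unc_parent G"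
  shows "y \<in> core_nodes G"
  using assms by (cases rule: unc_parent_cases) (auto intro!: Core_in_core_nodes[OF assms(1)])

lemma root_no_parent: "(Core 0 K, y) \<notin> unc_parent G"
  by (auto simp: unc_parent_def)

section \<open>Maximal chains\<close>

lemma chain_subset: "chain G xs \<Longrightarrow> set xs \<subseteq> core_nodes G"
  and chain_nonempty: "chain G xs \<Longrightarrow> xs \<noteq> []"
  and chain_step: "chain G xs \<Longrightarrow> Suc i < length xs \<Longrightarrow> unc_children G (xs ! i)
    = {xs ! Suc i}"
  by (simp_all add: chain_def)

lemma maximal_chain_is_chain: "maximal_chain G xs \<Longrightarrow> chain G xs"
  by (simp add: maximal_chain_def)

lemma maximal_chainD: "maximal_chain G xs \<Longrightarrow> chain G ys \<Longrightarrow> \<not> set xs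
  \<subset> set ys"
  by (auto simp: maximal_chain_def)

text \<open>If \<open>y\<close> were missing, \<open>x\<close> could only be the last entry of
  \<open>xs\<close>, as any successor would be the only child \<open>y\<close>; appending
  \<open>y\<close> would then give a larger chain.\<close>

lemma maximal_chain_down:
  assumes "maximal_chain G xs" "x \<in> set xs" "unc_children G x = {y}" "y \<in> core_nodes G"
  shows "y \<in> set xs"
proof (rule ccontr)
  assume y: "y \<notin> set xs"
  have ch: "chain G xs" using assms by (simp add: maximal_chain_def)
  obtain i where i: "i < length xs" "x = xs ! i" using assms(2) by (auto simp: in_set_conv_nth)
  have "Suc i = length xs"
  proof (rule ccontr)
    assume "Suc i \<noteq> length xs"
    then have "Suc i < length xs" using i by simp
    moreover from this have "{y} = {xs ! Suc i}"
      using ch assms(3) i(2) unfolding chain_def by metis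
    ultimately show False using y nth_mem[of "Suc i" xs] by simp
  qed
  have "unc_children G ((xs @ [y]) ! j) = {(xs @ [y]) ! Suc j}" if "Suc j < length (xs @ [y])" for j
  proof (cases "Suc j = length xs")
    case True
    then have "j = i" using \<open>Suc i = length xs\<close> by simp
    then show ?thesis using True i assms(3) by (simp add: nth_append)
  next
    case False
    then show ?thesis using that ch by (simp add: nth_append chain_def)
  qed
  then have "chain G (xs @ [y])"
    using ch assms(4) by (simp add: chain_def)
  moreover have "set xs \<subset> set (xs @ [y])" using y by auto
  ultimately show False using maximal_chainD[OF assms(1)] by blast
qed

text \<open>The mirror image: an entry before \<open>y\<close> would be the parent of
  \<open>y\<close>, which is unique, so a missing \<open>p\<close> could be put in front of the
  chain.\<close>

lemma maximal_chain_up: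
  assumes "simple_graph G" "maximal_chain G xs" "y \<in> set xs" "unc_children G p = {y}" "p \<in>
    core_nodes G"
  shows "p \<in> set xs"
proof (rule ccontr)
  assume p: "p \<notin> set xs"
  have ch: "chain G xs" using assms by (simp add: maximal_chain_def)
  obtain i where i: "i < length xs" "y = xs ! i" using assms(3) by (auto simp: in_set_conv_nth)
  have py: "(y, p) \<in> unc_parent G" using assms(4) by (auto simp: unc_children_def)
  have "i = 0"
  proof (rule ccontr)
    assume "i \<noteq> 0"
    then have "Suc (i - 1) < length xs" using i by simp
    then have "unc_children G (xs ! (i - 1)) = {y}" using ch i \<open>i \<noteq> 0\<close>
      by (auto simp: chain_def)
    then have "xs ! (i - 1) = p"
      using unc_parent_unique[OF assms(1) py] by (auto simp: unc_children_def)
    moreover have "i - 1 < length xs" using i by simp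
    ultimately show False using p nth_mem by metis
  qed
  have "unc_children G ((p # xs) ! j) = {(p # xs) ! Suc j}" if "Suc j < length (p # xs)" for j
  proof (cases j)
    case 0
    then show ?thesis using i \<open>i = 0\<close> assms(4) by simp
  next
    case (Suc j')
    then show ?thesis using that ch by (simp add: chain_def)
  qed
  then have "chain G (p # xs)"
    using ch assms(5) by (simp add: chain_def)
  moreover have "set xs \<subset> set (p # xs)" using p by auto
  ultimately show False using maximal_chainD[OF assms(2)] by blast
qed

text \<open>Walks along the chain from \<open>x\<close> in both directions. It is applied to the
  node set of a maximal chain and to the classes computed by the contraction, both closed under
  only-child links.\<close>

lemma chain_within:
  assumes "chain G xs" "x \<in> set xs" "x \<in> X"
    and down: "\<And>x y. x \<in> X \<Longrightarrow> x \<in> core_nodes G \<Longrightarrow> unc_children G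
      x = {y} \<Longrightarrow> y \<in> core_nodes G \<Longrightarrow> y \<in> X"
    and up: "\<And>x y. y \<in> X \<Longrightarrow> x \<in> core_nodes G \<Longrightarrow> unc_children G x
      = {y} \<Longrightarrow> y \<in> core_nodes G \<Longrightarrow> x \<in> X"
  shows "set xs \<subseteq> X"
proof -
  obtain i where i: "i < length xs" "x = xs ! i" using assms(2) by (auto simp: in_set_conv_nth)
  have core: "xs ! j \<in> core_nodes G" if "j < length xs" for j
    using that assms(1) by (auto simp: chain_def)
  have link: "unc_children G (xs ! j) = {xs ! Suc j}" if "Suc j < length xs" for j
    using that assms(1) by (auto simp: chain_def)
  have A: "xs ! j \<in> X" if "i \<le> j" "j < length xs" for j
    using that
  proof (induction j rule: dec_induct)
    case (step j)
    then have *: "Suc j < length xs" "j < length xs" "xs ! j \<in> X" by simp_all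
    show ?case by (rule down[OF *(3) core[OF *(2)] link[OF *(1)] core[OF *(1)]])
  qed (use i assms(3) in simp)
  have B: "xs ! j \<in> X" if "j \<le> i" for j
    using that
  proof (induction j rule: inc_induct)
    case (step j)
    then have *: "Suc j < length xs" "j < length xs" "xs ! Suc j \<in> X" using i by simp_all
    show ?case by (rule up[OF *(3) core[OF *(2)] link[OF *(1)] core[OF *(1)]])
  qed (use i assms(3) in simp)
  show ?thesis using A B by (metis in_set_conv_nth nle_le subsetI)
qed

text \<open>Consequently maximal chains that share a node have the same node set, that is, they
  partition the cores.\<close>

lemma maximal_chain_absorb:
  assumes "simple_graph G" "maximal_chain G xs" "chain G ys" "x \<in> set xs" "x \<in> set ys"
  shows "set ys \<subseteq> set xs"
  using assms(3,5,4)
  by (rule chain_within) (use assms maximal_chain_down maximal_chain_up in blast)+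

text \<open>Chains are compared by their node sets, as in the definition of maximality; the finite
  set of cores bounds the cardinality, so a largest chain through \<open>x\<close> exists.\<close>

lemma maximal_chain_exists:
  assumes "simple_graph G" "verts G \<noteq> {}" "x \<in> core_nodes G"
  obtains xs where "maximal_chain G xs" "x \<in> set xs"
proof -
  let ?P = "\<lambda>xs. chain G xs \<and> x \<in> set xs"
  have fin: "finite (core_nodes G)" by (rule finite_core_nodes[OF assms(1,2)])
  have "?P [x]" using assms(3) by (simp add: chain_def)
  moreover have "\<forall>xs. ?P xs \<longrightarrow> card (set xs) \<le> card (core_nodes G)"
    using card_mono[OF fin] chain_subset by blast
  ultimately have "\<exists>xs. ?P xs \<and> (\<forall>ys. ?P ys \<longrightarrow> card (set ys) \<le> card
    (set xs))"
    using ex_has_greatest_nat[of ?P "[x]" "\<lambda>xs. card (set xs)" "Suc (card (core_nodes G))"]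
    by (simp add: less_Suc_eq_le)
  then obtain xs where xs: "chain G xs" "x \<in> set xs"
    and max: "\<And>ys. chain G ys \<Longrightarrow> x \<in> set ys \<Longrightarrow> card (set ys) \<le>
      card (set xs)" by blast
  have "\<not> set xs \<subset> set ys" if "chain G ys" for ys
  proof
    assume *: "set xs \<subset> set ys"
    then have "card (set ys) \<le> card (set xs)" using max[OF that] xs by blast
    then show False using psubset_card_mono[OF _ *] by simp
  qed
  then have "maximal_chain G xs" using xs unfolding maximal_chain_def by blast
  then show thesis using that xs by blast
qed

text \<open>An only child \<open>y\<close> of the last entry would belong to the chain. But levels
  grow by one along a chain, so the level of \<open>y\<close> exceeds the levels of all
  entries.\<close>

lemma maximal_chain_last_unbranched:
  assumes "simple_graph G" "maximal_chain G xs" "y \<in> core_nodes G"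
  shows "unc_children G (last xs) \<noteq> {y}"
proof
  assume y: "unc_children G (last xs) = {y}"
  have ch: "chain G xs" using assms by (simp add: maximal_chain_def)
  then have ne: "xs \<noteq> []" by (simp add: chain_def)
  have lev: "level G z = Suc (level G p)" if "unc_children G p = {z}" "z \<in> core_nodes G" for p z
  proof -
    have "(z, p) \<in> unc_parent G" using that(1) by (auto simp: unc_children_def)
    then show ?thesis using that(2) by (auto simp: unc_parent_def core_nodes_def)
  qed
  have "level G (xs ! i) = level G (xs ! 0) + i" if "i < length xs" for i
    using that
  proof (induction i)
    case (Suc i)
    have "level G (xs ! Suc i) = Suc (level G (xs ! i))"
      using lev[OF chain_step[OF ch Suc.prems]] chain_subset[OF ch] nth_mem[OF Suc.prems] by blast
    then show ?case using Suc by simp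
  qed simp
  note level_nth = this
  have "y \<in> set xs"
    using maximal_chain_down[OF assms(2) last_in_set[OF ne] y assms(3)] .
  then obtain j where j: "j < length xs" "y = xs ! j" by (auto simp: in_set_conv_nth)
  have "level G y = Suc (level G (xs ! (length xs - 1)))"
    using lev[OF y assms(3)] ne by (simp add: last_conv_nth)
  moreover have "length xs - 1 < length xs" using ne by simp
  ultimately show False using level_nth[OF j(1)] level_nth[of "length xs - 1"] j by simp
qed

section \<open>Counting the nodes of the contracted tree\<close>

lemma card_leaf_parents:
  assumes "simple_graph G"
  shows "finite {y. \<exists>u. (Leaf u, y) \<in> unc_parent G}"
    "card {y. \<exists>u. (Leaf u, y) \<in> unc_parent G} \<le> card (verts G)"
proof -
  have fin: "finite (verts G)" using assms by (simp add: simple_graph_def)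
  have *: "{y. \<exists>u. (Leaf u, y) \<in> unc_parent G}
    \<subseteq> (\<lambda>u. Core (coreness G u) (core_of G (coreness G u) u)) ` verts G"
  proof safe
    fix y u assume "(Leaf u, y) \<in> unc_parent G"
    with assms show "y \<in> (\<lambda>u. Core (coreness G u) (core_of G (coreness G u) u)) ` verts G"
      by (cases rule: unc_parent_cases) auto
  qed
  show "finite {y. \<exists>u. (Leaf u, y) \<in> unc_parent G}"
    using finite_surj[OF fin *] .
  show "card {y. \<exists>u. (Leaf u, y) \<in> unc_parent G} \<le> card (verts G)"
    using surj_card_le[OF fin *] .
qed

text \<open>A branching core is charged to the least vertex of a child that does not contain the least
  vertex of the core itself; the cores with that least vertex form a chain whose topmost member is
  this child.\<close>

lemma card_branching_cores:
  assumes "simple_graph G"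
  defines "B \<equiv> {x. \<exists>y z. (y, x) \<in> unc_parent G \<and> (z, x) \<in> unc_parent G \<and> y
    \<noteq> z
    \<and> y \<in> core_nodes G \<and> z \<in> core_nodes G}"
  shows "card B \<le> card (verts G)"
proof -
  have fin: "finite (verts G)" using assms by (simp add: simple_graph_def)
  \<comment> \<open>Vertices carry no order; an injection into the naturals decides which vertex of
    a core is least.\<close>
  obtain f :: "'a \<Rightarrow> nat" where f: "inj_on f (verts G)"
    using finite_imp_inj_to_nat_seg[OF fin] by auto
  define P where "P x v \<longleftrightarrow> (\<exists>k u. x = Core k (core_of G k u) \<and> u \<in>
    core_of G k u \<and>
      v \<in> core_verts G (Suc k) \<and> v \<in> core_of G k u \<and>
      (\<forall>w \<in> core_of G (Suc k) v. f v \<le> f w) \<and> (\<exists>w \<in> core_of G k u. f w < f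
        v))" for x v
  have ex: "\<exists>v. P x v" if x: "x \<in> B" for x
  proof -
    obtain y z where yz: "(y, x) \<in> unc_parent G" "(z, x) \<in> unc_parent G" "y \<noteq> z"
        "y \<in> core_nodes G" "z \<in> core_nodes G" using x unfolding B_def by auto
    from assms(1) yz(1) obtain k a where a: "a \<in> core_verts G (Suc k)" "a \<in> core_verts G k"
      "y = Core (Suc k) (core_of G (Suc k) a)" "x = Core k (core_of G k a)"
    proof (cases rule: unc_parent_cases)
      case (Leaf u)
      then show ?thesis using yz(4) by (simp add: core_nodes_def)
    qed
    from assms(1) yz(2) obtain b where b: "b \<in> core_verts G (Suc k)"
      "z = Core (Suc k) (core_of G (Suc k) b)" "core_of G k b = core_of G k a"
    proof (cases rule: unc_parent_cases)
      case (Leaf u)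
      then show ?thesis using yz(5) by (simp add: core_nodes_def)
    next
      case (Core l b)
      then have l: "l = k" using a(4) by simp
      then have "core_of G k b = core_of G k a" using a(4) Core(4) by simp
      then show ?thesis using that Core(1,3) l by blast
    qed
    let ?K = "core_of G k a"
    have K: "?K \<subseteq> verts G" "?K \<noteq> {}"
      using core_of_subset[of G k a] core_verts_subset[of G k] core_of_self[OF a(2)] by auto
    obtain r where r: "r \<in> ?K" "\<forall>w\<in>?K. f r \<le> f w"
      using ex_has_least_nat[of "\<lambda>w. w \<in> ?K" _ f] K(2) by blast
    \<comment> \<open>Distinct cores of the same level are disjoint, so at least one of the two
      children misses the least vertex \<open>r\<close> of the parent.\<close>
    have "r \<notin> core_of G (Suc k) a \<or> r \<notin> core_of G (Suc k) b"
      using core_of_eq[of r G "Suc k" a] core_of_eq[of r G "Suc k" b] yz(3) a(3) b(2) by blast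
    then obtain c where c: "c \<in> core_verts G (Suc k)" "core_of G k c = ?K" "r \<notin> core_of G (Suc
      k) c"
      using a(1) b(1,3) by blast
    obtain v where v: "v \<in> core_of G (Suc k) c" "\<forall>w\<in>core_of G (Suc k) c. f v \<le> f w"
      using ex_has_least_nat[of "\<lambda>w. w \<in> core_of G (Suc k) c" c f] core_of_self[OF c(1)] by blast
    have vK: "v \<in> ?K" using v(1) core_of_antimono[of k "Suc k" G c] c(2) by auto
    have "f r < f v"
    proof -
      have "r \<noteq> v" using v(1) c(3) by blast
      then have "f r \<noteq> f v" using inj_onD[OF f, of r v] K(1) vK r(1) by blast
      then show ?thesis using r(2) vK by (simp add: nat_less_le)
    qed
    then have "\<exists>w\<in>?K. f w < f v" using r(1) by blast
    moreover have "core_of G (Suc k) v = core_of G (Suc k) c" by (rule core_of_eq[OF v(1)])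
    moreover have "v \<in> core_verts G (Suc k)" using v(1) core_of_subset[of G "Suc k" c] by blast
    ultimately have "P x v"
      unfolding P_def using a(4) core_of_self[OF a(2)] vK v(2)
      by (intro exI[of _ k] exI[of _ a]) simp
    then show ?thesis ..
  qed
  have PD: "x = Core k (core_of G k v)" "\<exists>w \<in> core_of G k v. f w < f v"
      "\<forall>w \<in> core_of G (Suc k) v. f v \<le> f w" "v \<in> verts G"
    if "P x v" "level G x = k" for x v k
  proof -
    from that(1) obtain k' u where "x = Core k' (core_of G k' u)" "v \<in> core_verts G (Suc k')"
      "v \<in> core_of G k' u" "\<forall>w \<in> core_of G (Suc k') v. f v \<le> f w" "\<exists>w \<in>
        core_of G k' u. f w < f v"
      unfolding P_def by blast
    moreover from this have "k' = k" using that(2) by simp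
    ultimately have u: "x = Core k (core_of G k u)" "v \<in> core_verts G (Suc k)"
      "v \<in> core_of G k u" "\<forall>w \<in> core_of G (Suc k) v. f v \<le> f w" "\<exists>w \<in>
        core_of G k u. f w < f v"
      by simp_all
    moreover have "core_of G k v = core_of G k u" by (rule core_of_eq[OF u(3)])
    ultimately show "x = Core k (core_of G k v)" "\<exists>w \<in> core_of G k v. f w < f v"
      "\<forall>w \<in> core_of G (Suc k) v. f v \<le> f w" by simp_all
    show "v \<in> verts G" using u(2) core_verts_subset[of G "Suc k"] by blast
  qed
  \<comment> \<open>If \<open>x\<close> had the higher level, it would be contained in the core of
    \<open>v\<close> one level above \<open>y\<close>. There \<open>v\<close> is least, whereas
    \<open>x\<close> contains a smaller vertex.\<close>
  have mono: "level G x \<le> level G y" if "P x v" "P y v" for x y v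
  proof (rule ccontr)
    assume "\<not> level G x \<le> level G y"
    then have "Suc (level G y) \<le> level G x" by simp
    from core_of_antimono[OF this, of G v] PD(2)[OF that(1) refl] PD(3)[OF that(2) refl]
    show False by (meson leD subsetD)
  qed
  have uniq: "x = y" if "P x v" "P y v" for x y v
  proof -
    have "level G x = level G y" using mono that by (meson le_antisym)
    then show ?thesis using PD(1)[OF that(1)] PD(1)[OF that(2)] by simp
  qed
  define g where "g x = (SOME v. P x v)" for x
  have g: "P x (g x)" if "x \<in> B" for x using someI_ex[OF ex[OF that]] unfolding g_def .
  have "inj_on g B" using g uniq by (metis inj_onI)
  moreover have "g ` B \<subseteq> verts G"
    using PD(4)[OF g refl] by blast
  ultimately show ?thesis using fin by (rule card_inj_on_le)
qed

lemma core_node_has_child: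
  assumes "simple_graph G" "verts G \<noteq> {}" "x \<in> core_nodes G"
  shows "unc_children G x \<noteq> {}"
proof -
  obtain k v where v: "x = Core k (core_of G k v)" "v \<in> core_verts G k"
    using assms by (auto simp: core_nodes_eq)
  then have V: "v \<in> verts G" using core_verts_subset[of G k] by blast
  show ?thesis
  proof (cases "v \<in> core_verts G (Suc k)")
    case True
    then show ?thesis using parent_Core[OF assms(1) True, of x] v by (auto simp: unc_children_def)
  next
    case False
    then have "coreness G v = k"
      using v le_coreness_iff[OF assms(1) V, of k] le_coreness_iff[OF assms(1) V, of "Suc k"] by simp
    then show ?thesis using parent_Leaf[OF assms(1) V, of x] v by (auto simp: unc_children_def)
  qed
qed

text \<open>A node chosen from a maximal chain lies in no other one, so choosing in each chain a
  parent of a leaf or a branching core is injective. There are at most \<open>n\<close> nodes of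
  either kind, hence the factor 2.\<close>

lemma card_maximal_chains:
  assumes "simple_graph G" "verts G \<noteq> {}"
  shows "finite {set xs | xs. maximal_chain G xs}"
    "card {set xs | xs. maximal_chain G xs} \<le> 2 * card (verts G)"
proof -
  let ?M = "{set xs | xs. maximal_chain G xs}"
  have "?M \<subseteq> Pow (core_nodes G)" using chain_subset maximal_chain_is_chain by blast
  then show "finite ?M"
    by (rule finite_subset) (simp add: finite_core_nodes[OF assms])
  let ?A = "{y. \<exists>u. (Leaf u, y) \<in> unc_parent G}"
  let ?B = "{x. \<exists>y z. (y, x) \<in> unc_parent G \<and> (z, x) \<in> unc_parent G \<and> y \<noteq> z
    \<and> y \<in> core_nodes G \<and> z \<in> core_nodes G}"
  have "\<forall>X\<in>?M. \<exists>b. b \<in> X \<and> b \<in> ?A \<union> ?B"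
  proof
    fix X assume "X \<in> ?M"
    then obtain xs where xs: "maximal_chain G xs" "X = set xs" by auto
    then have ne: "xs \<noteq> []" "set xs \<subseteq> core_nodes G"
      using chain_subset chain_nonempty maximal_chain_is_chain by blast+
    let ?b = "last xs"
    have b: "?b \<in> X" "?b \<in> core_nodes G" using ne xs by auto
    obtain y where y: "(y, ?b) \<in> unc_parent G"
      using core_node_has_child[OF assms b(2)] by (auto simp: unc_children_def)
    \<comment> \<open>Every core has a child. If no child is a leaf and no two children are distinct
      cores, the last node has an only child that is a core, which maximality excludes.\<close>
    have "?b \<in> ?A \<union> ?B"
    proof (rule ccontr)
      assume no: "?b \<notin> ?A \<union> ?B"
      have core: "z \<in> core_nodes G" if "(z, ?b) \<in> unc_parent G" for z
      proof (rule ccontr)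
        assume "z \<notin> core_nodes G"
        then have "\<exists>u. z = Leaf u" using that unfolding unc_parent_def by blast
        then show False using that no by blast
      qed
      have "z = y" if "(z, ?b) \<in> unc_parent G" for z
        using no core[OF that] core[OF y] that y by blast
      then have "unc_children G ?b = {y}"
        using y unfolding unc_children_def by blast
      then show False using maximal_chain_last_unbranched[OF assms(1) xs(1) core[OF y]] by simp
    qed
    then show "\<exists>b. b \<in> X \<and> b \<in> ?A \<union> ?B" using b by blast
  qed
  from bchoice[OF this] obtain g where g: "\<forall>X\<in>?M. g X \<in> X \<and> g X \<in> ?A \<union> ?B" ..
  have "inj_on g ?M"
  proof (rule inj_onI)
    fix X Y assume XY: "X \<in> ?M" "Y \<in> ?M" "g X = g Y"
    then obtain xs ys where c: "maximal_chain G xs" "X = set xs" "maximal_chain G ys" "Y = set ys"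
      by auto
    have "g X \<in> X" "g Y \<in> Y" using bspec[OF g XY(1)] bspec[OF g XY(2)] by simp_all
    then have "g X \<in> set xs" "g X \<in> set ys" using XY(3) c by simp_all
    then show "X = Y"
      using maximal_chain_absorb[OF assms(1)] maximal_chain_is_chain c by (metis subset_antisym)
  qed
  moreover have "g ` ?M \<subseteq> ?A \<union> ?B" using g by blast
  moreover have "?B \<subseteq> core_nodes G" using unc_parent_in_core_nodes[OF assms(1)] by blast
  then have "finite ?B" using finite_core_nodes[OF assms] by (rule finite_subset)
  ultimately have "card ?M \<le> card (?A \<union> ?B)"
    using card_leaf_parents(1)[OF assms(1)] by (intro card_inj_on_le) auto
  also have "\<dots> \<le> card ?A + card ?B" by (rule card_Un_le)
  also have "\<dots> \<le> 2 * card (verts G)"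
    using card_leaf_parents(2)[OF assms(1)] card_branching_cores[OF assms(1)] by simp
  finally show "card ?M \<le> 2 * card (verts G)" .
qed

lemma card_cct_nodes:
  assumes "simple_graph G" "verts G \<noteq> {}"
  shows "finite (cct_nodes G)" "card (cct_nodes G) \<le> 3 * card (verts G)"
proof -
  have fin: "finite (verts G)" using assms by (simp add: simple_graph_def)
  have L: "finite ((\<lambda>x. {x}) ` leaf_nodes G)" "card ((\<lambda>x. {x}) ` leaf_nodes G) \<le> card
    (verts G)"
    using fin card_image_le[OF fin, of "\<lambda>u. {Leaf u}"] by (simp_all add: leaf_nodes_def image_image)
  show "finite (cct_nodes G)"
    unfolding cct_nodes_def using L card_maximal_chains[OF assms] by simp
  show "card (cct_nodes G) \<le> 3 * card (verts G)"
    unfolding cct_nodes_def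
    using card_Un_le[of "(\<lambda>x. {x}) ` leaf_nodes G" "{set xs | xs. maximal_chain G xs}"]
      L(2) card_maximal_chains(2)[OF assms] by linarith
qed

section \<open>Running programs\<close>

text \<open>The time is only bounded from above, so that costs can be rounded up. Execution is
  deterministic, so exhibiting one terminating run says everything about the program.\<close>

definition runs :: "com \<Rightarrow> state \<Rightarrow> nat \<Rightarrow> (state \<Rightarrow> bool)
  \<Rightarrow> bool" where
  "runs c s T Q \<longleftrightarrow> (\<exists>t s'. exec c s t s' \<and> t \<le> T \<and> Q s')"

fun loop_free :: "com \<Rightarrow> bool" where
  "loop_free (Seq c d) \<longleftrightarrow> loop_free c \<and> loop_free d"
| "loop_free (If b c d) \<longleftrightarrow> loop_free c \<and> loop_free d"
| "loop_free (While b c) \<longleftrightarrow> False"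
| "loop_free _ \<longleftrightarrow> True"

text \<open>The last equation also covers loops, where it is a meaningless default;
  \<open>run\<close> is used under \<open>loop_free\<close> only.\<close>

fun run :: "com \<Rightarrow> state \<Rightarrow> state" where
  "run (Assign r e) s = s\<lparr>regs := (regs s)(r := aval e s)\<rparr>"
| "run (Write a e f) s = s\<lparr>arrs := (arrs s)(a := (arrs s a)(aval e s := aval f s))\<rparr>"
| "run (Seq c d) s = run d (run c s)"
| "run (If b c d) s = (if bval b s then run c s else run d s)"
| "run _ s = s"

text \<open>A conditional pays for both branches, which makes the bound independent of the
  state.\<close>

fun cost :: "com \<Rightarrow> nat" where
  "cost (Assign r e) = 1 + acost e"
| "cost (Write a e f) = 1 + acost e + acost f"
| "cost (Seq c d) = cost c + cost d"
| "cost (If b c d) = 1 + bcost b + cost c + cost d"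
| "cost _ = 1"

lemma exec_loop_free: "loop_free c \<Longrightarrow> \<exists>t \<le> cost c. exec c s t (run c s)"
proof (induction c arbitrary: s)
  case (Seq c d)
  then obtain t u where "t \<le> cost c" "exec c s t (run c s)"
    "u \<le> cost d" "exec d (run c s) u (run d (run c s))" by (metis loop_free.simps(1))
  then show ?case by (intro exI[of _ "t + u"]) (auto intro: exec.intros)
next
  case (If b c d)
  from If obtain t where t: "t \<le> cost c" "exec c s t (run c s)" by (metis loop_free.simps(2))
  from If obtain u where u: "u \<le> cost d" "exec d s u (run d s)" by (metis loop_free.simps(2))
  show ?case
  proof (cases "bval b s")
    case True
    then have "exec (If b c d) s (1 + bcost b + t) (run c s)" using t(2) by (rule exec.intros)
    then show ?thesis using t(1) True by (intro exI[of _ "1 + bcost b + t"]) simp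
  next
    case False
    then have "exec (If b c d) s (1 + bcost b + u) (run d s)" using u(2) by (rule exec.intros)
    then show ?thesis using u(1) False by (intro exI[of _ "1 + bcost b + u"]) simp
  qed
next
  case Skip
  show ?case using exec.intros(1)[of s] by auto
next
  case (Assign r e)
  show ?case using exec.intros(2)[of r e s] by auto
next
  case (Write a e f)
  show ?case using exec.intros(3)[of a e f s] by auto
qed simp

lemma runs_loop_free: "loop_free c \<Longrightarrow> Q (run c s) \<Longrightarrow> runs c s (cost c) Q"
  using exec_loop_free unfolding runs_def by blast

lemma runs_Seq:
  assumes "runs c s T Q" "\<And>s'. Q s' \<Longrightarrow> runs d s' U R"
  shows "runs (Seq c d) s (T + U) R"
proof -
  obtain t s' where c: "exec c s t s'" "t \<le> T" "Q s'" using assms(1) unfolding runs_def by blast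
  obtain u s'' where d: "exec d s' u s''" "u \<le> U" "R s''"
    using assms(2)[OF c(3)] unfolding runs_def by blast
  have "exec (Seq c d) s (t + u) s''" using c d by (blast intro: exec.intros)
  then show ?thesis using c d unfolding runs_def by (meson add_mono)
qed

lemma runs_weaken: "runs c s T Q \<Longrightarrow> T \<le> U \<Longrightarrow> (\<And>s'. Q s'
  \<Longrightarrow> R s') \<Longrightarrow> runs c s U R"
  unfolding runs_def by (meson order_trans)

text \<open>Here \<open>p\<close> is a potential that every iteration lowers, so there are at most
  \<open>p\<close> iterations; the factor \<open>Suc p\<close> also pays for the final failing
  test.\<close>

lemma runs_While:
  assumes "loop_free c" "I p s"
    and step: "\<And>p s. I p s \<Longrightarrow> bval b s \<Longrightarrow> \<exists>q<p. I q (run c s)"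
  shows "runs (While b c) s (Suc p * (1 + bcost b + cost c)) (\<lambda>s'. (\<exists>q. I q s') \<and>
    \<not> bval b s')"
  using assms(2)
proof (induction p arbitrary: s rule: less_induct)
  case (less p)
  let ?K = "1 + bcost b + cost c"
  show ?case
  proof (cases "bval b s")
    case True
    obtain q where q: "q < p" "I q (run c s)" using step less True by blast
    obtain u s'' where u: "exec (While b c) (run c s) u s''" "u \<le> Suc q * ?K"
      "\<exists>q. I q s''" "\<not> bval b s''"
      using less.IH[OF q] unfolding runs_def by blast
    obtain t where t: "t \<le> cost c" "exec c s t (run c s)" using exec_loop_free assms(1) by blast
    have "exec (While b c) s (1 + bcost b + t + u) s''"
      using True t u by (blast intro: exec.intros)
    moreover have "1 + bcost b + t + u \<le> Suc p * ?K"
    proof -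
      have "Suc q * ?K \<le> p * ?K" using q by (intro mult_le_mono1) simp
      then show ?thesis using t u by simp
    qed
    ultimately show ?thesis using u unfolding runs_def by blast
  next
    case False
    then have "exec (While b c) s (1 + bcost b) s" by (rule exec.intros)
    then show ?thesis using False less.prems unfolding runs_def by fastforce
  qed
qed

text \<open>A pointer is the successor of the element it points to; 0 is the null pointer.\<close>

fun linked :: "(nat \<Rightarrow> nat) \<Rightarrow> nat \<Rightarrow> nat list \<Rightarrow> bool" where
  "linked nxt p [] \<longleftrightarrow> p = 0"
| "linked nxt p (x # xs) \<longleftrightarrow> p = Suc x \<and> linked nxt (nxt x) xs"

lemma linked_update: "x \<notin> set xs \<Longrightarrow> linked (nxt(x := y)) p xs = linked nxt p xs"
  by (induction xs arbitrary: p) auto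

lemma linked_Suc: "linked nxt (Suc x) xs \<Longrightarrow> \<exists>ys. xs = x # ys \<and> linked nxt (nxt
  x) ys"
  by (cases xs) auto

lemma linked_0: "linked nxt 0 xs \<Longrightarrow> xs = []"
  by (cases xs) auto

section \<open>The input\<close>

locale input_graph =
  fixes G :: "nat ugraph" and xss :: "nat list list"
  assumes simple: "simple_graph G" and nonempty: "verts G \<noteq> {}"
    and adjacency: "adjacency_lists G xss"
begin

definition n :: nat where "n = length xss"

definition off :: "nat \<Rightarrow> nat" where "off v = length (concat (take v xss))"

definition nb :: "nat \<Rightarrow> nat" where "nb j = concat xss ! j"

abbreviation deg :: "nat \<Rightarrow> nat" where "deg v \<equiv> card (neighbours G v)"

lemma verts_eq: "verts G = {..<n}"
  using adjacency by (simp add: adjacency_lists_def n_def)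

lemma in_verts_iff: "v \<in> verts G \<longleftrightarrow> v < n"
  by (simp add: verts_eq)

lemma n_pos: "0 < n"
  using nonempty by (auto simp: verts_eq)

lemma neighbour_less: "w \<in> neighbours G v \<Longrightarrow> w < n"
  using finite_neighbours(2)[OF simple, of v] by (auto simp: verts_eq)

lemma neighbour_less': "w \<in> neighbours G v \<Longrightarrow> v < n"
  using neighbour_less neighbours_sym by metis

lemma off_Suc: "v < n \<Longrightarrow> off (Suc v) = off v + length (xss ! v)"
  by (simp add: off_def n_def take_Suc_conv_app_nth)

lemma off_mono: "u \<le> v \<Longrightarrow> off u \<le> off v"
proof -
  assume "u \<le> v"
  then have "take v xss = take u xss @ take (v - u) (drop u xss)"
    by (metis add_diff_inverse_nat not_less take_add)
  then show ?thesis by (simp add: off_def)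
qed

lemma nb_off:
  assumes "v < n" "i < length (xss ! v)"
  shows "nb (off v + i) = xss ! v ! i"
proof -
  have "concat xss = concat (take v xss) @ (xss ! v) @ concat (drop (Suc v) xss)"
    using assms(1) id_take_nth_drop[of v xss] by (metis concat.simps(2) concat_append n_def)
  then show ?thesis using assms(2) by (simp add: nb_def off_def nth_append)
qed

lemma adjacent: "v < n \<Longrightarrow> distinct (xss ! v)" "v < n \<Longrightarrow> set (xss ! v) =
  neighbours G v"
  using adjacency by (simp_all add: adjacency_lists_def n_def)

lemma length_adjacent: "v < n \<Longrightarrow> length (xss ! v) = deg v"
  using adjacent[of v] distinct_card by metis

lemma off_Suc_deg: "v < n \<Longrightarrow> off (Suc v) = off v + deg v"
  by (simp add: off_Suc length_adjacent)

lemma nb_image: "v < n \<Longrightarrow> nb ` {off v..<off (Suc v)} = neighbours G v"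
proof -
  assume v: "v < n"
  have "{off v..<off (Suc v)} = (\<lambda>i. off v + i) ` {..<length (xss ! v)}"
    using off_Suc[OF v] by (simp add: image_add_atLeastLessThan lessThan_atLeast0 add.commute)
  then have "nb ` {off v..<off (Suc v)} = (\<lambda>i. xss ! v ! i) ` {..<length (xss ! v)}"
    using nb_off[OF v] by (simp add: image_image)
  also have "\<dots> = set (xss ! v)" by (auto simp: set_conv_nth)
  finally show ?thesis using adjacent(2)[OF v] by simp
qed

text \<open>The segment of \<open>v\<close> has as many positions as \<open>v\<close> has
  neighbours, and \<open>nb\<close> maps it onto them. Hence a scan meets each neighbour exactly
  once.\<close>

lemma nb_inj: "v < n \<Longrightarrow> inj_on nb {off v..<off (Suc v)}"
  using nb_image[of v] off_Suc_deg[of v] by (intro eq_card_imp_inj_on) simp_all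

lemma off_Suc_le: "v < n \<Longrightarrow> off (Suc v) \<le> off n"
  by (rule off_mono) simp

text \<open>Double counting: an ordered pair of adjacent vertices lies over the edge it forms, and
  at most two pairs lie over one edge.\<close>

lemma sum_deg_le: "(\<Sum>v<n. deg v) \<le> 2 * card (edges G)"
proof -
  have fV: "finite (verts G)" using simple by (simp add: simple_graph_def)
  have "edges G \<subseteq> Pow (verts G)" using simple by (auto simp: simple_graph_def)
  then have fE: "finite (edges G)" using fV by (meson finite_Pow_iff finite_subset)
  let ?A = "\<lambda>e. {(v, w). {v, w} = e}"
  have A: "finite (?A e) \<and> card (?A e) \<le> 2" if "e \<in> edges G" for e
  proof -
    have "card e = 2" using that simple by (auto simp: simple_graph_def)
    then obtain a b where "e = {a, b}" by (auto simp: card_2_iff)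
    then have "?A e \<subseteq> {(a, b), (b, a)}" by (auto simp: doubleton_eq_iff)
    moreover have "card {(a, b), (b, a)} \<le> 2" using card_insert_le_m1[of 2 "{(b,a)}" "(a,b)"] by simp
    ultimately show ?thesis by (meson card_mono finite.emptyI finite.insertI finite_subset order_trans)
  qed
  have "(\<Sum>v<n. deg v) = card (SIGMA v:{..<n}. neighbours G v)"
    using finite_neighbours(1)[OF simple] by simp
  also have "(SIGMA v:{..<n}. neighbours G v) \<subseteq> (\<Union>e\<in>edges G. ?A e)"
    by (auto simp: neighbours_def)
  then have "card (SIGMA v:{..<n}. neighbours G v) \<le> card (\<Union>e\<in>edges G. ?A e)"
    using fE A by (intro card_mono) auto
  also have "\<dots> \<le> (\<Sum>e\<in>edges G. card (?A e))" by (rule card_UN_le[OF fE])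
  also have "\<dots> \<le> (\<Sum>e\<in>edges G. 2)" using A by (intro sum_mono) blast
  finally show ?thesis by simp
qed

lemma le_coreness: "v < n \<Longrightarrow> k \<le> coreness G v \<longleftrightarrow> v \<in> core_verts G k"
  using le_coreness_iff[OF simple] by (simp add: verts_eq)

lemma coreness_le_deg: "v < n \<Longrightarrow> coreness G v \<le> deg v"
  using le_coreness[of v "coreness G v"] core_verts_le_degree[OF simple] by simp

lemma core_verts_less: "v \<in> core_verts G k \<Longrightarrow> v < n"
  using core_verts_subset[of G k] by (auto simp: verts_eq)

text \<open>The adjacency entries that remain to be read; this is the part of both potentials that
  pays for scanning.\<close>

definition unscanned :: "(nat \<Rightarrow> nat) \<Rightarrow> nat" where
  "unscanned ptr = (\<Sum>v<n. off (Suc v) - ptr v)"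

lemma unscanned_step:
  assumes "v < n" "ptr v < off (Suc v)"
  shows "unscanned ptr = Suc (unscanned (ptr(v := Suc (ptr v))))"
proof -
  have "unscanned (ptr(v := Suc (ptr v))) = (off (Suc v) - Suc (ptr v)) + (\<Sum>u\<in>{..<n}-{v}. off (Suc
    u) - ptr u)"
    unfolding unscanned_def using assms(1) by (subst sum.remove[of _ v]) auto
  moreover have "unscanned ptr = (off (Suc v) - ptr v) + (\<Sum>u\<in>{..<n}-{v}. off (Suc u) - ptr u)"
    unfolding unscanned_def using assms(1) by (subst sum.remove[of _ v]) auto
  ultimately show ?thesis using assms(2) by simp
qed

lemma unscanned_init: "(\<And>v. v < n \<Longrightarrow> ptr v = off v) \<Longrightarrow> unscanned ptr
  \<le> 2 * card (edges G)"
  using sum_deg_le by (simp add: unscanned_def off_Suc_deg)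

definition input_intact :: "state \<Rightarrow> bool" where
  "input_intact s \<longleftrightarrow> regs s 0 = n \<and> (\<forall>i\<le>n. arrs s 0 i = off i) \<and>
    (\<forall>j<off n. arrs s 1 j = nb j)"

text \<open>Memory reserved for later phases is still zero, which spares them the initialisation of
  counters, marks and list heads.\<close>

definition zero_from :: "nat \<Rightarrow> nat \<Rightarrow> state \<Rightarrow> bool" where
  "zero_from r a s \<longleftrightarrow> (\<forall>i\<ge>r. regs s i = 0) \<and> (\<forall>i\<ge>a.
    \<forall>j. arrs s i j = 0)"

end

section \<open>Computing the coreness by peeling\<close>

text \<open>Array 5: position of the next neighbour to scan; array 7: current degree; array 8: queue;
  array 9: marks; array 10: coreness; array 11: links of the stack whose top is in register 3.
  The queue entries from register 4 to register 5 are still to be examined at the level in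
  register 7, those from register 5 to register 6 at the next level. Array 6 is prepared for the
  second traversal of the graph.\<close>

definition init_body :: com where
  "init_body =
     Seq (Write 5 (Reg 2) (Read 0 (Reg 2)))
    (Seq (Write 6 (Reg 2) (Read 0 (Reg 2)))
    (Seq (Write 7 (Reg 2) (Minus (Read 0 (Succ (Reg 2))) (Read 0 (Reg 2))))
    (Seq (Write 8 (Reg 2) (Reg 2))
         (Assign 2 (Succ (Reg 2))))))"

text \<open>The current part of the queue and the whole queue both end at \<open>n\<close>: all
  vertices are to be examined at level 0.\<close>

definition init_prog :: com where
  "init_prog =
     Seq (While (Less (Reg 2) (Reg 0)) init_body)
    (Seq (Assign 5 (Reg 0)) (Assign 6 (Reg 0)))"

definition mark_com :: "nat \<Rightarrow> com" where
  "mark_com r =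
     Seq (Write 9 (Reg r) (Const 1))
    (Seq (Write 10 (Reg r) (Reg 7))
    (Seq (Write 11 (Reg r) (Reg 3))
         (Assign 3 (Succ (Reg r)))))"

text \<open>De Morgan form of a disjunction: the stack or the queue is nonempty.\<close>

definition peel_cond :: bexp where
  "peel_cond = Not (And (Not (Less (Const 0) (Reg 3))) (Not (Less (Reg 4) (Reg 6))))"

text \<open>The stack has priority, so all consequences of earlier removals are settled before
  another queue entry is examined. Advancing the level is combined with taking an entry in the same
  iteration, since on its own it would not lower the potential.\<close>

definition peel_body :: com where
  "peel_body =
     If (Less (Const 0) (Reg 3))
       (Seq (Assign 8 (Minus (Reg 3) (Const 1)))
         (If (Less (Read 5 (Reg 8)) (Read 0 (Succ (Reg 8))))
           (Seq (Assign 9 (Read 1 (Read 5 (Reg 8))))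
           (Seq (Write 5 (Reg 8) (Succ (Read 5 (Reg 8))))
           (Seq (Write 7 (Reg 9) (Minus (Read 7 (Reg 9)) (Const 1)))
             (If (And (Less (Read 9 (Reg 9)) (Const 1)) (Not (Less (Reg 7) (Read 7 (Reg 9)))))
               (mark_com 9) Skip))))
           (Assign 3 (Read 11 (Reg 8)))))
       (Seq (If (Less (Reg 4) (Reg 5)) Skip
              (Seq (Assign 5 (Reg 6)) (Assign 7 (Succ (Reg 7)))))
       (Seq (Assign 8 (Read 8 (Reg 4)))
       (Seq (Assign 4 (Succ (Reg 4)))
         (If (Less (Read 9 (Reg 8)) (Const 1))
           (If (Less (Reg 7) (Read 7 (Reg 8)))
             (Seq (Write 8 (Reg 6) (Reg 8)) (Assign 6 (Succ (Reg 6))))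
             (mark_com 8))
           Skip))))"

definition peel_prog :: com where
  "peel_prog = Seq init_prog (While peel_cond peel_body)"

text \<open>Per unit of \<open>n + m\<close>: the factor 2 covers the \<open>n + 1\<close> tests of
  the first loop, 4 is the cost of its two closing assignments, and 5 covers the initial potential
  \<open>4 m + 3 n\<close> plus one. The definition lies outside the locale, as the constant must
  not depend on the graph.\<close>

definition peel_time :: nat where
  "peel_time = 2 * (1 + bcost (Less (Reg 2) (Reg 0)) + cost init_body) + 4 +
     5 * (1 + bcost peel_cond + cost peel_body)"

section \<open>Invariant and potential of the peeling\<close>

context input_graph
begin

definition seen :: "(nat \<Rightarrow> nat) \<Rightarrow> nat \<Rightarrow> nat set" where
  "seen ptr v = nb ` {off v..<ptr v}"

text \<open>The exception set \<open>X\<close> allows for a vertex that has just been taken from the queue or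
  whose degree has just dropped.\<close>

definition peel_inv :: "nat set \<Rightarrow> nat list \<Rightarrow> (nat \<Rightarrow> nat) \<Rightarrow>
  (nat \<Rightarrow> nat) \<Rightarrow> (nat \<Rightarrow> nat) \<Rightarrow> (nat \<Rightarrow> nat)
    \<Rightarrow>
    (nat \<Rightarrow> nat) \<Rightarrow> (nat \<Rightarrow> nat) \<Rightarrow> nat \<Rightarrow> nat
      \<Rightarrow> nat \<Rightarrow> nat \<Rightarrow> nat \<Rightarrow> bool" where
  "peel_inv X ws ptr d A mk c nxt W qh bnd qt k \<longleftrightarrow>
     (\<forall>v<n. off v \<le> ptr v \<and> ptr v \<le> off (Suc v)) \<and>
     linked nxt W ws \<and> distinct ws \<and> (\<forall>v\<in>set ws. v < n \<and> mk v \<noteq> 0) \<and>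
     (\<forall>v<n. mk v \<noteq> 0 \<longrightarrow> v \<notin> set ws \<longrightarrow> ptr v = off (Suc
       v)) \<and>
     (\<forall>v<n. mk v = 0 \<longrightarrow> ptr v = off v) \<and>
     (\<forall>v<n. d v = card {y \<in> neighbours G v. v \<notin> seen ptr y}) \<and>
     qh \<le> bnd \<and> bnd \<le> qt \<and> (\<forall>i\<in>{qh..<qt}. A i < n) \<and>
     (\<forall>v<n. mk v = 0 \<longrightarrow> v \<notin> X \<longrightarrow> k < d v \<longrightarrow> v
       \<in> A ` {qh..<qt}) \<and>
     (\<forall>v<n. mk v = 0 \<longrightarrow> v \<notin> X \<longrightarrow> d v \<le> k \<longrightarrow>
       v \<in> A ` {qh..<bnd}) \<and>
     (\<forall>v<n. mk v = 0 \<longrightarrow> k \<le> coreness G v) \<and>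
     (\<forall>v<n. mk v \<noteq> 0 \<longrightarrow> c v = coreness G v \<and> coreness G v \<le> k)"

lemma peel_invI:
  assumes "\<And>v. v < n \<Longrightarrow> off v \<le> ptr v" "\<And>v. v < n \<Longrightarrow> ptr v
    \<le> off (Suc v)"
    "linked nxt W ws" "distinct ws" "\<And>v. v \<in> set ws \<Longrightarrow> v < n" "\<And>v. v \<in> set
      ws \<Longrightarrow> mk v \<noteq> 0"
    "\<And>v. v < n \<Longrightarrow> mk v \<noteq> 0 \<Longrightarrow> v \<notin> set ws \<Longrightarrow>
      ptr v = off (Suc v)"
    "\<And>v. v < n \<Longrightarrow> mk v = 0 \<Longrightarrow> ptr v = off v"
    "\<And>v. v < n \<Longrightarrow> d v = card {y \<in> neighbours G v. v \<notin> seen ptr y}"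
    "qh \<le> bnd" "bnd \<le> qt" "\<And>i. qh \<le> i \<Longrightarrow> i < qt \<Longrightarrow> A i < n"
    "\<And>v. v < n \<Longrightarrow> mk v = 0 \<Longrightarrow> v \<notin> X \<Longrightarrow> k < d v
      \<Longrightarrow> v \<in> A ` {qh..<qt}"
    "\<And>v. v < n \<Longrightarrow> mk v = 0 \<Longrightarrow> v \<notin> X \<Longrightarrow> d v \<le> k
      \<Longrightarrow> v \<in> A ` {qh..<bnd}"
    "\<And>v. v < n \<Longrightarrow> mk v = 0 \<Longrightarrow> k \<le> coreness G v"
    "\<And>v. v < n \<Longrightarrow> mk v \<noteq> 0 \<Longrightarrow> c v = coreness G v"
    "\<And>v. v < n \<Longrightarrow> mk v \<noteq> 0 \<Longrightarrow> coreness G v \<le> k"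
  shows "peel_inv X ws ptr d A mk c nxt W qh bnd qt k"
  unfolding peel_inv_def using assms by (intro conjI allI impI ballI) auto

lemma peel_invD:
  assumes "peel_inv X ws ptr d A mk c nxt W qh bnd qt k"
  shows "\<And>v. v < n \<Longrightarrow> off v \<le> ptr v" "\<And>v. v < n \<Longrightarrow> ptr v \<le>
    off (Suc v)"
    "linked nxt W ws" "distinct ws" "\<And>v. v \<in> set ws \<Longrightarrow> v < n" "\<And>v. v \<in> set
      ws \<Longrightarrow> mk v \<noteq> 0"
    "\<And>v. v < n \<Longrightarrow> mk v \<noteq> 0 \<Longrightarrow> v \<notin> set ws \<Longrightarrow>
      ptr v = off (Suc v)"
    "\<And>v. v < n \<Longrightarrow> mk v = 0 \<Longrightarrow> ptr v = off v"
    "\<And>v. v < n \<Longrightarrow> d v = card {y \<in> neighbours G v. v \<notin> seen ptr y}"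
    "qh \<le> bnd" "bnd \<le> qt" "\<And>i. qh \<le> i \<Longrightarrow> i < qt \<Longrightarrow> A i < n"
    "\<And>v. v < n \<Longrightarrow> mk v = 0 \<Longrightarrow> v \<notin> X \<Longrightarrow> k < d v
      \<Longrightarrow> v \<in> A ` {qh..<qt}"
    "\<And>v. v < n \<Longrightarrow> mk v = 0 \<Longrightarrow> v \<notin> X \<Longrightarrow> d v \<le> k
      \<Longrightarrow> v \<in> A ` {qh..<bnd}"
    "\<And>v. v < n \<Longrightarrow> mk v = 0 \<Longrightarrow> k \<le> coreness G v"
    "\<And>v. v < n \<Longrightarrow> mk v \<noteq> 0 \<Longrightarrow> c v = coreness G v"
    "\<And>v. v < n \<Longrightarrow> mk v \<noteq> 0 \<Longrightarrow> coreness G v \<le> k"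
  using assms unfolding peel_inv_def by simp_all

text \<open>An unmarked vertex holds 2 units: one is released when it is marked, the other when it
  leaves the stack. A queue entry of the current level \<open>k\<close> weighs
  \<open>Suc (deg - k)\<close> and one of the next level \<open>Suc (deg - Suc k)\<close>. So
  deferring a vertex of degree above \<open>k\<close> releases a unit, and advancing the level turns
  the second sum into the first.\<close>

definition peel_pot :: "nat list \<Rightarrow> (nat \<Rightarrow> nat) \<Rightarrow> (nat \<Rightarrow>
  nat) \<Rightarrow> (nat \<Rightarrow> nat) \<Rightarrow> nat \<Rightarrow> nat \<Rightarrow> nat
    \<Rightarrow> nat \<Rightarrow> nat" where
  "peel_pot ws ptr A mk qh bnd qt k = unscanned ptr + length ws + 2 * card {v. v < n \<and> mk v = 0} +
     (\<Sum>i=qh..<bnd. Suc (deg (A i) - k)) + (\<Sum>i=bnd..<qt. Suc (deg (A i) - Suc k))"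

lemma seen_full: "v < n \<Longrightarrow> ptr v = off (Suc v) \<Longrightarrow> seen ptr v = neighbours G v"
  by (simp add: seen_def nb_image)

lemma seen_empty: "ptr v = off v \<Longrightarrow> seen ptr v = {}"
  by (simp add: seen_def)

lemma nb_in_neighbours:
  assumes "v < n" "off v \<le> j" "j < off (Suc v)"
  shows "nb j \<in> neighbours G v" "nb j < n" "j < off n"
proof -
  show 1: "nb j \<in> neighbours G v" using assms nb_image[OF assms(1)] by auto
  show "nb j < n" using neighbour_less[OF 1] .
  show "j < off n" using assms off_Suc_le[OF assms(1)] by simp
qed

lemma seen_step:
  assumes "v < n" "off v \<le> ptr v" "ptr v < off (Suc v)"
  shows "seen (ptr(v := Suc (ptr v))) y = (if y = v then insert (nb (ptr v)) (seen ptr v) else seen ptr y)"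
    "nb (ptr v) \<notin> seen ptr v"
proof -
  show "seen (ptr(v := Suc (ptr v))) y = (if y = v then insert (nb (ptr v)) (seen ptr v) else seen ptr y)"
    using assms by (auto simp: seen_def atLeastLessThanSuc)
  show "nb (ptr v) \<notin> seen ptr v"
  proof
    assume "nb (ptr v) \<in> seen ptr v"
    then obtain j where "off v \<le> j" "j < ptr v" "nb j = nb (ptr v)" by (auto simp: seen_def)
    then show False using inj_onD[OF nb_inj[OF assms(1)], of j "ptr v"] assms by auto
  qed
qed

text \<open>The scan removes \<open>v\<close> from the set counted by \<open>d x\<close>. If
  \<open>x\<close> is unmarked and its degree has fallen to \<open>k\<close> or below, it may be
  missing from the current part of the queue; this is why \<open>x\<close> becomes an exception,
  until it is marked in the same iteration.\<close>

lemma peel_scan: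
  assumes inv: "peel_inv {} (v # ws) ptr d A mk c nxt W qh bnd qt k"
    and v: "ptr v < off (Suc v)"
  defines "x \<equiv> nb (ptr v)" and "ptr' \<equiv> ptr(v := Suc (ptr v))"
  shows "peel_inv {x} (v # ws) ptr' (d(x := d x - 1)) A mk c nxt W qh bnd qt k"
    and "mk x \<noteq> 0 \<or> k < d x - 1 \<Longrightarrow>
      peel_inv {} (v # ws) ptr' (d(x := d x - 1)) A mk c nxt W qh bnd qt k"
    and "peel_pot (v # ws) ptr A mk qh bnd qt k = Suc (peel_pot (v # ws) ptr' A mk qh bnd qt k)"
    and "x < n"
proof -
  note D = peel_invD[OF inv]
  have vn: "v < n" "mk v \<noteq> 0" using D(5,6)[of v] by simp_all
  have pv: "off v \<le> ptr v" using D(1)[OF vn(1)] .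
  show "x < n" using nb_in_neighbours[OF vn(1) pv v] by (simp add: x_def)
  have xv: "x \<in> neighbours G v" using nb_in_neighbours[OF vn(1) pv v] by (simp add: x_def)
  note seen' = seen_step[where ptr = ptr and v = v, OF vn(1) pv v, folded x_def ptr'_def]
  have d': "(d(x := d x - 1)) u = card {y \<in> neighbours G u. u \<notin> seen ptr' y}" if u: "u < n" for u
  proof (cases "u = x")
    case True
    have "{y \<in> neighbours G x. x \<notin> seen ptr' y} = {y \<in> neighbours G x. x \<notin> seen ptr
      y} - {v}"
      by (auto simp: seen'(1))
    \<comment> \<open>Since \<open>v\<close> meets each neighbour only once, \<open>x\<close> has
      not been seen from \<open>v\<close> before and the degree really drops by one.\<close>
    moreover have "v \<in> {y \<in> neighbours G x. x \<notin> seen ptr y}"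
      using seen'(2) xv neighbours_sym[of v G x] by auto
    ultimately show ?thesis using D(9)[OF u] True finite_neighbours(1)[OF simple] by simp
  next
    case False
    then have "u \<notin> seen ptr' y \<longleftrightarrow> u \<notin> seen ptr y" for y
      by (simp add: seen'(1))
    then show ?thesis using D(9)[OF u] False by simp
  qed
  have ptr': "off u \<le> ptr' u" "ptr' u \<le> off (Suc u)" if "u < n" for u
    using D(1,2)[OF that] v pv by (auto simp: ptr'_def)
  have mk1: "ptr' u = off (Suc u)" if "u < n" "mk u \<noteq> 0" "u \<notin> set (v # ws)" for u
    using D(7)[OF that] that by (simp add: ptr'_def)
  have mk0: "ptr' u = off u" if "u < n" "mk u = 0" for u
    using D(8)[OF that] that vn by (auto simp: ptr'_def)
  have q: "u \<in> A ` {qh..<qt}" "(d(x := d x - 1)) u \<le> k \<Longrightarrow> u \<in> A ` {qh..<bnd}"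
    if "u < n" "mk u = 0" "u \<noteq> x \<or> k < d x - 1" for u
  proof -
    have "A ` {qh..<bnd} \<subseteq> A ` {qh..<qt}" using D(11) by auto
    then show "u \<in> A ` {qh..<qt}" using D(13,14)[OF that(1,2)] by (cases "k < d u") auto
    show "(d(x := d x - 1)) u \<le> k \<Longrightarrow> u \<in> A ` {qh..<bnd}"
      using that D(14)[OF that(1,2)] by (auto split: if_splits)
  qed
  show "peel_inv {x} (v # ws) ptr' (d(x := d x - 1)) A mk c nxt W qh bnd qt k"
  proof (rule peel_invI)
    fix u assume u: "u < n" "mk u = 0" "u \<notin> {x}"
    then have *: "u \<noteq> x \<or> k < d x - 1" by simp
    show "u \<in> A ` {qh..<qt}" using q(1)[OF u(1,2) *] .
    show "(d(x := d x - 1)) u \<le> k \<Longrightarrow> u \<in> A ` {qh..<bnd}" using q(2)[OF u(1,2) *] .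
  qed ((rule ptr' mk1 mk0 d' D; assumption)+)
  show "peel_inv {} (v # ws) ptr' (d(x := d x - 1)) A mk c nxt W qh bnd qt k"
    if "mk x \<noteq> 0 \<or> k < d x - 1"
  proof (rule peel_invI)
    fix u assume u: "u < n" "mk u = 0"
    have *: "u \<noteq> x \<or> k < d x - 1" using that u by auto
    show "u \<in> A ` {qh..<qt}" using q(1)[OF u *] .
    show "(d(x := d x - 1)) u \<le> k \<Longrightarrow> u \<in> A ` {qh..<bnd}" using q(2)[OF u *] .
  qed ((rule ptr' mk1 mk0 d' D; assumption)+)
  show "peel_pot (v # ws) ptr A mk qh bnd qt k = Suc (peel_pot (v # ws) ptr' A mk qh bnd qt k)"
    using unscanned_step[of v ptr] vn v by (simp add: peel_pot_def ptr'_def)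
qed

text \<open>The invariant gives \<open>k\<close> as a lower bound of the coreness. If
  \<open>x\<close> were in a core of level \<open>Suc k\<close>, its neighbours there would have
  coreness above \<open>k\<close> and hence be unmarked; they have scanned nothing, so they are all
  counted by \<open>d x\<close>, contradicting \<open>d x \<le> k\<close>.\<close>

lemma peel_mark:
  assumes inv: "peel_inv {x} ws ptr d A mk c nxt W qh bnd qt k"
    and x: "x < n" "mk x = 0" "d x \<le> k"
  shows "peel_inv {} (x # ws) ptr d A (mk(x := 1)) (c(x := k)) (nxt(x := W)) (Suc x) qh bnd qt k"
    "peel_pot ws ptr A mk qh bnd qt k = Suc (peel_pot (x # ws) ptr A (mk(x := 1)) qh bnd qt k)"
proof -
  note D = peel_invD[OF inv]
  have xws: "x \<notin> set ws" using D(6)[of x] x by auto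
  have cx: "coreness G x = k"
  proof (rule antisym)
    show "k \<le> coreness G x" using D(15) x by simp
    show "coreness G x \<le> k"
    proof (rule ccontr)
      assume "\<not> coreness G x \<le> k"
      then have xc: "x \<in> core_verts G (Suc k)" using le_coreness[OF x(1), of "Suc k"] by simp
      have "neighbours G x \<inter> core_verts G (Suc k) \<subseteq> {y \<in> neighbours G x. x \<notin>
        seen ptr y}"
      proof
        fix y assume y: "y \<in> neighbours G x \<inter> core_verts G (Suc k)"
        then have yn: "y < n" using core_verts_less by blast
        then have "Suc k \<le> coreness G y" using y le_coreness[of y "Suc k"] by simp
        then have "mk y = 0" using D(17)[OF yn] by (cases "mk y = 0") auto
        then have "ptr y = off y" using D(8) yn by simp
        then show "y \<in> {y \<in> neighbours G x. x \<notin> seen ptr y}" using y by (simp add: seen_empty)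
      qed
      then have "card (neighbours G x \<inter> core_verts G (Suc k)) \<le> d x"
        using D(9)[OF x(1)] finite_neighbours(1)[OF simple] by (simp add: card_mono)
      then show False using core_verts_degree[OF simple xc] x(3) by simp
    qed
  qed
  have mk: "(mk(x := 1)) u = 0 \<longleftrightarrow> mk u = 0 \<and> u \<noteq> x" for u by simp
  show "peel_inv {} (x # ws) ptr d A (mk(x := 1)) (c(x := k)) (nxt(x := W)) (Suc x) qh bnd qt k"
  proof (rule peel_invI, unfold mk)
    show "linked (nxt(x := W)) (Suc x) (x # ws)" using D(3) xws by (simp add: linked_update)
  qed (use xws x cx D in auto)
  have "{v. v < n \<and> mk v = 0} = insert x {v. v < n \<and> (mk(x := 1)) v = 0}"
    using x by auto
  moreover have "finite {v. v < n \<and> (mk(x := 1)) v = 0}" "x \<notin> {v. v < n \<and> (mk(x := 1)) v =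
    0}" by simp_all
  ultimately have "card {v. v < n \<and> mk v = 0} = Suc (card {v. v < n \<and> (mk(x := 1)) v = 0})"
    by (metis card_insert_disjoint)
  then show "peel_pot ws ptr A mk qh bnd qt k = Suc (peel_pot (x # ws) ptr A (mk(x := 1)) qh bnd qt k)"
    by (simp add: peel_pot_def)
qed

lemma peel_finish:
  assumes inv: "peel_inv {} (v # ws) ptr d A mk c nxt W qh bnd qt k"
    and v: "\<not> ptr v < off (Suc v)"
  shows "peel_inv {} ws ptr d A mk c nxt (nxt v) qh bnd qt k"
    "peel_pot (v # ws) ptr A mk qh bnd qt k = Suc (peel_pot ws ptr A mk qh bnd qt k)"
proof -
  note D = peel_invD[OF inv]
  have pv: "ptr v = off (Suc v)" using D(2)[OF D(5)[of v]] v by simp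
  show "peel_inv {} ws ptr d A mk c nxt (nxt v) qh bnd qt k"
  proof (rule peel_invI)
    fix u assume u: "u < n" "mk u \<noteq> 0" "u \<notin> set ws"
    show "ptr u = off (Suc u)" using D(7)[OF u(1,2)] u(3) pv by (cases "u = v") auto
  qed (use D(3-6) in \<open>auto intro: D dest: D(6)\<close>)
  show "peel_pot (v # ws) ptr A mk qh bnd qt k = Suc (peel_pot ws ptr A mk qh bnd qt k)"
    by (simp add: peel_pot_def)
qed

text \<open>With no stack and no current entries left, every unmarked vertex has current degree
  above \<open>k\<close>. Marked vertices have scanned all their neighbours, so this degree counts
  unmarked neighbours only. Thus the unmarked vertices induce minimum degree \<open>Suc k\<close>
  and belong to the cores of that level.\<close>

lemma peel_next_level:
  assumes inv: "peel_inv {} [] ptr d A mk c nxt W bnd bnd qt k"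
  shows "peel_inv {} [] ptr d A mk c nxt W bnd qt qt (Suc k)"
    "peel_pot [] ptr A mk bnd qt qt (Suc k) = peel_pot [] ptr A mk bnd bnd qt k"
proof -
  note D = peel_invD[OF inv]
  let ?U = "{v. v < n \<and> mk v = 0}"
  have big: "k < d v" if "v \<in> ?U" for v
    using D(14)[of v] that by (cases "k < d v") auto
  have "min_degree_ge G (Suc k) ?U"
    unfolding min_degree_ge_def
  proof (intro conjI ballI)
    show "?U \<subseteq> verts G" by (auto simp: verts_eq)
    fix v assume v: "v \<in> ?U"
    have "{y \<in> neighbours G v. v \<notin> seen ptr y} \<subseteq> neighbours G v \<inter> ?U"
    proof
      fix y assume y: "y \<in> {y \<in> neighbours G v. v \<notin> seen ptr y}"
      then have yn: "y < n" "v \<in> neighbours G y" using neighbour_less neighbours_sym[of v G y] by auto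
      have "mk y = 0"
      proof (rule ccontr)
        assume "mk y \<noteq> 0"
        then have "ptr y = off (Suc y)" using D(7) yn by simp
        then show False using seen_full[OF yn(1)] yn(2) y by auto
      qed
      then show "y \<in> neighbours G v \<inter> ?U" using y yn by simp
    qed
    then have "d v \<le> card (neighbours G v \<inter> ?U)"
      using D(9)[of v] v finite_neighbours(1)[OF simple] by (simp add: card_mono)
    then show "Suc k \<le> card (neighbours G v \<inter> ?U)" using big[OF v] by simp
  qed
  then have core: "Suc k \<le> coreness G v" if "v \<in> ?U" for v
    using core_verts_greatest[of G "Suc k" ?U] le_coreness[of v "Suc k"] that by blast
  show "peel_inv {} [] ptr d A mk c nxt W bnd qt qt (Suc k)"
  proof (rule peel_invI)
    fix v assume v: "v < n" "mk v = 0"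
    show "v \<in> A ` {bnd..<qt}" using D(13)[OF v _ big] v by simp
    then show "v \<in> A ` {bnd..<qt}" .
    show "Suc k \<le> coreness G v" using core v by simp
  next
    fix v assume v: "v < n" "mk v \<noteq> 0"
    show "coreness G v \<le> Suc k" using D(17)[OF v] by simp
  qed (use D(3,11) in \<open>auto intro: D dest: D(6)\<close>)
  show "peel_pot [] ptr A mk bnd qt qt (Suc k) = peel_pot [] ptr A mk bnd bnd qt k"
    by (simp add: peel_pot_def)
qed

lemma image_atLeastLessThan_Suc:
  fixes i j :: nat
  shows "i < j \<Longrightarrow> A ` {i..<j} = insert (A i) (A ` {Suc i..<j})"
  by (subst image_insert[symmetric], rule arg_cong[where f = "image A"]) auto

lemma peel_pop:
  assumes inv: "peel_inv {} ws ptr d A mk c nxt W qh bnd qt k" and "qh < bnd"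
  shows "peel_inv {A qh} ws ptr d A mk c nxt W (Suc qh) bnd qt k" "A qh < n"
    "peel_pot ws ptr A mk qh bnd qt k = Suc (deg (A qh) - k) + peel_pot ws ptr A mk (Suc qh) bnd qt k"
proof -
  note D = peel_invD[OF inv]
  have qt: "qh < qt" using D(11) assms(2) by simp
  show "A qh < n" using D(12) qt by simp
  show "peel_inv {A qh} ws ptr d A mk c nxt W (Suc qh) bnd qt k"
  proof (rule peel_invI)
    fix v assume v: "v < n" "mk v = 0" "v \<notin> {A qh}"
    show "k < d v \<Longrightarrow> v \<in> A ` {Suc qh..<qt}"
      using D(13)[OF v(1,2)] v(3) image_atLeastLessThan_Suc[OF qt, of A] by auto
    show "d v \<le> k \<Longrightarrow> v \<in> A ` {Suc qh..<bnd}"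
      using D(14)[OF v(1,2)] v(3) image_atLeastLessThan_Suc[OF assms(2), of A] by auto
  qed (use assms(2) in \<open>auto intro: D dest: D(6)\<close>)
  show "peel_pot ws ptr A mk qh bnd qt k = Suc (deg (A qh) - k) + peel_pot ws ptr A mk (Suc qh) bnd qt k"
    using assms(2) by (simp add: peel_pot_def sum.atLeast_Suc_lessThan)
qed

lemma peel_append:
  assumes inv: "peel_inv {v} ws ptr d A mk c nxt W qh bnd qt k" and v: "v < n" "k < d v"
  shows "peel_inv {} ws ptr d (A(qt := v)) mk c nxt W qh bnd (Suc qt) k"
    "peel_pot ws ptr (A(qt := v)) mk qh bnd (Suc qt) k < Suc (deg v - k) + peel_pot ws ptr A mk qh bnd qt k"
proof -
  note D = peel_invD[OF inv]
  note le = D(10,11)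
  have 1: "(A(qt := v)) ` {qh..<bnd} = A ` {qh..<bnd}" using le by (intro image_cong) auto
  have "(A(qt := v)) ` {qh..<qt} = A ` {qh..<qt}" by (intro image_cong) auto
  then have 2: "(A(qt := v)) ` {qh..<Suc qt} = insert v (A ` {qh..<qt})"
    using order_trans[OF le] by (simp only: atLeastLessThanSuc image_insert fun_upd_same if_True)
  show "peel_inv {} ws ptr d (A(qt := v)) mk c nxt W qh bnd (Suc qt) k"
  proof (rule peel_invI)
    fix u assume u: "u < n" "mk u = 0"
    show "k < d u \<Longrightarrow> u \<in> (A(qt := v)) ` {qh..<Suc qt}"
      unfolding 2 using D(13)[OF u] by (cases "u = v") auto
    show "d u \<le> k \<Longrightarrow> u \<in> (A(qt := v)) ` {qh..<bnd}"
      unfolding 1 using D(14)[OF u] v(2) by (cases "u = v") auto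
  next
    fix i assume "qh \<le> i" "i < Suc qt"
    then show "(A(qt := v)) i < n" using D(12)[of i] v(1) by auto
  qed (use le in \<open>auto intro: D dest: D(6)\<close>)
  \<comment> \<open>Together with \<open>k < d v\<close> this makes the truncated subtraction drop
    strictly when \<open>k\<close> is replaced by \<open>Suc k\<close>.\<close>
  have "d v \<le> deg v"
    unfolding D(9)[OF v(1)] using finite_neighbours(1)[OF simple, of v] by (intro card_mono) auto
  moreover have "(\<Sum>i=qh..<bnd. Suc (deg ((A(qt := v)) i) - k)) = (\<Sum>i=qh..<bnd. Suc (deg (A i) - k))"
    using le by (intro sum.cong) auto
  moreover have "(\<Sum>i=bnd..<Suc qt. Suc (deg ((A(qt := v)) i) - Suc k)) =
      (\<Sum>i=bnd..<qt. Suc (deg (A i) - Suc k)) + Suc (deg v - Suc k)"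
  proof -
    have "(\<Sum>i=bnd..<qt. Suc (deg ((A(qt := v)) i) - Suc k)) = (\<Sum>i=bnd..<qt. Suc (deg (A i) - Suc
      k))"
      by (intro sum.cong) auto
    then show ?thesis using le by (simp only: sum.atLeastLessThan_Suc) simp
  qed
  ultimately show "peel_pot ws ptr (A(qt := v)) mk qh bnd (Suc qt) k < Suc (deg v - k) + peel_pot ws ptr A
    mk qh bnd qt k"
    using v(2) unfolding peel_pot_def by linarith
qed

text \<open>A waiting vertex can be marked through one of its neighbours; its stale queue entry is
  dropped later.\<close>

lemma peel_discard:
  assumes "peel_inv {v} ws ptr d A mk c nxt W qh bnd qt k" "mk v \<noteq> 0"
  shows "peel_inv {} ws ptr d A mk c nxt W qh bnd qt k"
proof -
  note D = peel_invD[OF assms(1)]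
  show ?thesis
  proof (rule peel_invI)
    fix u assume u: "u < n" "mk u = 0"
    then have "u \<notin> {v}" using assms(2) by auto
    then show "k < d u \<Longrightarrow> u \<in> A ` {qh..<qt}" "d u \<le> k \<Longrightarrow> u \<in> A `
      {qh..<bnd}"
      using D(13,14)[OF u] by simp_all
  qed (auto intro: D dest: D(6))
qed


text \<open>The bound consists of \<open>2 m\<close> for scanning, \<open>2 n\<close> for unmarked
  vertices and \<open>n + 2 m\<close> for the queue, whose second part is empty.\<close>

lemma peel_init:
  assumes "\<And>v. v < n \<Longrightarrow> ptr v = off v" "\<And>v. v < n \<Longrightarrow> d v = deg v"
    "\<And>v. v < n \<Longrightarrow> A v = v"
  shows "peel_inv {} [] ptr d A (\<lambda>_. 0) c nxt 0 0 n n 0"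
    "peel_pot [] ptr A (\<lambda>_. 0) 0 n n 0 \<le> 4 * card (edges G) + 3 * n"
proof -
  have img: "A ` {0..<n} = {0..<n}" using assms(3) by (auto simp: image_iff)
  show "peel_inv {} [] ptr d A (\<lambda>_. 0) c nxt 0 0 n n 0"
  proof (rule peel_invI)
    fix v assume v: "v < n"
    have "{y \<in> neighbours G v. v \<notin> seen ptr y} = neighbours G v"
      using assms(1) neighbour_less seen_empty by auto
    then show "d v = card {y \<in> neighbours G v. v \<notin> seen ptr y}" using assms(2)[OF v] by simp
  qed (use assms in \<open>simp_all add: off_mono img\<close>)
  have "(\<Sum>i=0..<n. Suc (deg (A i))) = (\<Sum>i<n. Suc (deg i))"
    using assms(3) by (auto simp: lessThan_atLeast0 intro!: sum.cong)
  also have "\<dots> = n + (\<Sum>i<n. deg i)" by (simp add: sum_Suc)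
  also have "\<dots> \<le> n + 2 * card (edges G)" using sum_deg_le by simp
  finally show "peel_pot [] ptr A (\<lambda>_. 0) 0 n n 0 \<le> 4 * card (edges G) + 3 * n"
    using unscanned_init[of ptr] assms(1) by (simp add: peel_pot_def)
qed

section \<open>The peeling program and its running time\<close>

definition peel_state :: "nat \<Rightarrow> state \<Rightarrow> bool" where
  "peel_state p s \<longleftrightarrow> input_intact s \<and> (\<forall>v<n. arrs s 6 v = off v) \<and>
    zero_from 10 12 s \<and>
     (\<exists>ws. peel_inv {} ws (arrs s 5) (arrs s 7) (arrs s 8) (arrs s 9) (arrs s 10) (arrs s 11)
             (regs s 3) (regs s 4) (regs s 5) (regs s 6) (regs s 7) \<and>
           p = peel_pot ws (arrs s 5) (arrs s 8) (arrs s 9) (regs s 4) (regs s 5) (regs s 6) (regs s 7))"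

lemma peel_stateI:
  assumes "peel_inv {} ws (arrs s 5) (arrs s 7) (arrs s 8) (arrs s 9) (arrs s 10) (arrs s 11)
             (regs s 3) (regs s 4) (regs s 5) (regs s 6) (regs s 7)"
    "input_intact s" "\<forall>v<n. arrs s 6 v = off v" "zero_from 10 12 s"
    "peel_pot ws (arrs s 5) (arrs s 8) (arrs s 9) (regs s 4) (regs s 5) (regs s 6) (regs s 7) < p"
  shows "\<exists>q<p. peel_state q s"
  using assms unfolding peel_state_def by blast

lemma peel_step:
  assumes "peel_state p s" "bval peel_cond s"
  shows "\<exists>q<p. peel_state q (run peel_body s)"
proof -
  from assms(1) obtain ws where
    inv: "peel_inv {} ws (arrs s 5) (arrs s 7) (arrs s 8) (arrs s 9) (arrs s 10) (arrs s 11)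
             (regs s 3) (regs s 4) (regs s 5) (regs s 6) (regs s 7)"
    and p: "p = peel_pot ws (arrs s 5) (arrs s 8) (arrs s 9) (regs s 4) (regs s 5) (regs s 6) (regs s 7)"
    and frame: "input_intact s" "\<forall>v<n. arrs s 6 v = off v" "zero_from 10 12 s"
    unfolding peel_state_def by blast
  have in0: "arrs s 0 (Suc v) = off (Suc v)" if "v < n" for v
    using frame(1) that by (simp add: input_intact_def)
  have in1: "arrs s (Suc 0) j = nb j" if "j < off n" for j
    using frame(1) that by (simp add: input_intact_def)
  have frame': "input_intact s'" "\<forall>v<n. arrs s' 6 v = off v" "zero_from 10 12 s'"
    if "\<And>r. r \<notin> {3..9} \<Longrightarrow> regs s' r = regs s r" "\<And>a. a \<notin> {5, 7, 8,
      9, 10, 11} \<Longrightarrow> arrs s' a = arrs s a" for s'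
    using frame that by (auto simp: input_intact_def zero_from_def)
  note D = peel_invD[OF inv]
  show ?thesis
  proof (cases "regs s 3")
    case (Suc v)
    then obtain ws' where ws: "ws = v # ws'" using D(3) linked_Suc by metis
    have v: "v < n" using D(5) ws by simp
    show ?thesis
    proof (cases "arrs s 5 v < off (Suc v)")
      case True
      note scan = peel_scan[OF inv[unfolded ws] True]
      let ?x = "nb (arrs s 5 v)"
      have j: "arrs s 5 v < off n" using True off_Suc_le[OF v] by simp
      let ?s = "s\<lparr>regs := (regs s)(8 := v, 9 := ?x),
        arrs := (arrs s)(5 := (arrs s 5)(v := Suc (arrs s 5 v)), 7 := (arrs s 7)(?x := arrs s 7 ?x -
          1))\<rparr>"
      show ?thesis
      proof (cases "arrs s 9 ?x = 0 \<and> \<not> regs s 7 < arrs s 7 ?x - 1")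
        case mark: True
        have "run peel_body s = run (mark_com 9) ?s"
          using Suc v True mark by (simp add: peel_body_def in0 in1[OF j] fun_upd_twist)
        moreover have "peel_inv {} (?x # v # ws') (arrs ?s 5) (arrs ?s 7) (arrs ?s 8)
            ((arrs s 9)(?x := 1)) ((arrs s 10)(?x := regs s 7)) ((arrs s 11)(?x := regs s 3))
            (Suc ?x) (regs s 4) (regs s 5) (regs s 6) (regs s 7)"
          "peel_pot (?x # v # ws') (arrs ?s 5) (arrs ?s 8) ((arrs s 9)(?x := 1)) (regs s 4) (regs s 5)
            (regs s 6) (regs s 7) < p"
          using peel_mark[OF scan(1,4)] mark scan(3) unfolding p ws by simp_all
        ultimately show ?thesis
          by (intro peel_stateI[where ws = "?x # v # ws'"] frame') (simp_all add: mark_com_def, auto)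
      next
        case False
        have "run peel_body s = ?s"
          using Suc v True False by (auto simp: peel_body_def in0 in1[OF j] fun_upd_twist)
        moreover have "peel_inv {} (v # ws') (arrs ?s 5) (arrs ?s 7) (arrs s 8) (arrs s 9) (arrs s 10)
          (arrs s 11)
            (regs s 3) (regs s 4) (regs s 5) (regs s 6) (regs s 7)"
          using scan(2) False by simp
        moreover have "peel_pot (v # ws') (arrs ?s 5) (arrs s 8) (arrs s 9) (regs s 4) (regs s 5) (regs s
          6) (regs s 7) < p"
          using scan(3) unfolding p ws by simp
        ultimately show ?thesis
          by (intro peel_stateI[where ws = "v # ws'"] frame') (simp_all, auto)
      qed
    next
      case False
      have "run peel_body s = s\<lparr>regs := (regs s)(8 := v, 3 := arrs s 11 v)\<rparr>"
        using Suc v False by (simp add: peel_body_def in0)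
      then show ?thesis
        using peel_finish[OF inv[unfolded ws] False] unfolding p ws
        by (intro peel_stateI[where ws = ws'] frame') (simp_all, auto)
    qed
  next
    case 0
    then have ws: "ws = []" using D(3) linked_0 by simp
    have lt: "regs s 4 < regs s 6" using assms(2) 0 by (simp add: peel_cond_def)
    \<comment> \<open>The level advances only if the current part of the queue is used up. In either
      case \<open>s1\<close> has an entry to take, and only taking it lowers the potential.\<close>
    define s1 where "s1 = (if regs s 4 < regs s 5 then s
      else s\<lparr>regs := (regs s)(5 := regs s 6, 7 := Suc (regs s 7))\<rparr>)"
    have inv1: "peel_inv {} [] (arrs s1 5) (arrs s1 7) (arrs s1 8) (arrs s1 9) (arrs s1 10) (arrs s1 11)
             (regs s1 3) (regs s1 4) (regs s1 5) (regs s1 6) (regs s1 7)"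
      and p1: "p = peel_pot [] (arrs s1 5) (arrs s1 8) (arrs s1 9) (regs s1 4) (regs s1 5) (regs s1 6)
        (regs s1 7)"
      and lt1: "regs s1 4 < regs s1 5"
    proof -
      have "regs s 4 = regs s 5" if "\<not> regs s 4 < regs s 5" using that D(10) by simp
      then show "peel_inv {} [] (arrs s1 5) (arrs s1 7) (arrs s1 8) (arrs s1 9) (arrs s1 10) (arrs s1 11)
             (regs s1 3) (regs s1 4) (regs s1 5) (regs s1 6) (regs s1 7)"
        and "p = peel_pot [] (arrs s1 5) (arrs s1 8) (arrs s1 9) (regs s1 4) (regs s1 5) (regs s1 6) (regs
          s1 7)"
        using inv p ws peel_next_level by (auto simp: s1_def)
      show "regs s1 4 < regs s1 5" using lt by (simp add: s1_def)
    qed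
    have frame1: "\<And>r. r \<notin> {3..9} \<Longrightarrow> regs s1 r = regs s r" "\<And>a. a \<notin>
      {5, 7, 8, 9, 10, 11} \<Longrightarrow> arrs s1 a = arrs s a"
      by (auto simp: s1_def)
    define v where "v = arrs s1 8 (regs s1 4)"
    define s2 where "s2 = s1\<lparr>regs := (regs s1)(8 := v, 4 := Suc (regs s1 4))\<rparr>"
    note pop = peel_pop[OF inv1 lt1, folded v_def]
    have body: "run peel_body s = (if arrs s1 9 v = 0 then
        if regs s1 7 < arrs s1 7 v
        then s2\<lparr>regs := (regs s2)(6 := Suc (regs s1 6)), arrs := (arrs s1)(8 := (arrs s1 8)(regs s1
          6 := v))\<rparr>
        else run (mark_com 8) s2 else s2)"
      using 0 by (auto simp: peel_body_def s2_def v_def s1_def)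
    have r3: "regs s1 3 = 0" using peel_invD(3)[OF inv1] by simp
    show ?thesis
    proof (cases "arrs s1 9 v = 0")
      case unmarked: True
      show ?thesis
      proof (cases "regs s1 7 < arrs s1 7 v")
        case True
        then show ?thesis
          using peel_append[OF pop(1,2) True] unmarked frame1 unfolding p1 pop(3) body
          by (intro peel_stateI[where ws = "[]"] frame') (simp_all add: s2_def r3, (auto simp: frame1)?)
      next
        case False
        then show ?thesis
          using peel_mark[OF pop(1,2) unmarked] unmarked frame1 unfolding p1 pop(3) body
          by (intro peel_stateI[where ws = "[v]"] frame') (simp_all add: s2_def r3 mark_com_def, (auto
            simp: frame1)?)
      qed
    next
      case False
      then show ?thesis
        using peel_discard[OF pop(1)] frame1 unfolding p1 pop(3) body
        by (intro peel_stateI[where ws = "[]"] frame') (simp_all add: s2_def r3, (auto simp: frame1)?)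
    qed
  qed
qed


text \<open>An unmarked vertex would still have an entry in the queue, which is empty.\<close>

lemma peel_done:
  assumes "peel_state p s" "\<not> bval peel_cond s" "v < n"
  shows "arrs s 10 v = coreness G v"
proof -
  from assms(1) obtain ws where
    inv: "peel_inv {} ws (arrs s 5) (arrs s 7) (arrs s 8) (arrs s 9) (arrs s 10) (arrs s 11)
             (regs s 3) (regs s 4) (regs s 5) (regs s 6) (regs s 7)"
    unfolding peel_state_def by blast
  note D = peel_invD[OF inv]
  have "regs s 4 = regs s 5" "regs s 4 = regs s 6"
    using assms(2) D(10,11) by (auto simp: peel_cond_def)
  then have "arrs s 9 v \<noteq> 0"
    using D(13,14)[OF assms(3)] by (cases "regs s 7 < arrs s 7 v") auto
  then show ?thesis using D(16)[OF assms(3)] by simp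
qed

definition init_state :: "nat \<Rightarrow> state \<Rightarrow> bool" where
  "init_state p s \<longleftrightarrow> (\<exists>i\<le>n. p = n - i \<and> regs s = (\<lambda>_. 0)(0 :=
    n, 2 := i) \<and>
     (\<forall>a. a \<notin> {5..8} \<longrightarrow> arrs s a = arrs (input_state xss) a) \<and>
     (\<forall>v<i. arrs s 5 v = off v \<and> arrs s 6 v = off v \<and> arrs s 7 v = deg v \<and> arrs s 8
       v = v) \<and>
     arrs s 9 = (\<lambda>_. 0))"

lemma arrs_input:
  "i \<le> n \<Longrightarrow> arrs (input_state xss) 0 i = off i" "j < off n \<Longrightarrow> arrs
    (input_state xss) 1 j = nb j"
  "a \<ge> 2 \<Longrightarrow> arrs (input_state xss) a = (\<lambda>_. 0)"
  by (auto simp: input_state_def off_def nb_def n_def)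

lemma init_start: "init_state n (input_state xss)"
  unfolding init_state_def by (intro exI[of _ 0]) (auto simp: input_state_def n_def)

lemma init_step:
  assumes "init_state p s" "bval (Less (Reg 2) (Reg 0)) s"
  shows "\<exists>q<p. init_state q (run init_body s)"
proof -
  from assms(1) obtain i where i: "p = n - i" "regs s = (\<lambda>_. 0)(0 := n, 2 := i)"
    "\<forall>a. a \<notin> {5..8} \<longrightarrow> arrs s a = arrs (input_state xss) a"
    "\<forall>v<i. arrs s 5 v = off v \<and> arrs s 6 v = off v \<and> arrs s 7 v = deg v \<and> arrs s 8 v
      = v"
    "arrs s 9 = (\<lambda>_. 0)"
    unfolding init_state_def by blast
  have "i < n" using assms(2) i(2) by simp
  then have a0: "arrs s 0 i = off i" "arrs s 0 (Suc i) = off i + deg i"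
    using i(3) by (simp_all add: arrs_input off_Suc_deg)
  have "init_state (n - Suc i) (run init_body s)"
    unfolding init_state_def
  proof (intro exI[of _ "Suc i"] conjI allI impI)
    show "regs (run init_body s) = (\<lambda>_. 0)(0 := n, 2 := Suc i)"
      by (auto simp: init_body_def i(2))
    fix a :: nat assume "a \<notin> {5..8}"
    then show "arrs (run init_body s) a = arrs (input_state xss) a"
      using i(3) by (auto simp: init_body_def)
  qed (use \<open>i < n\<close> i(4,5) a0 in \<open>auto simp: init_body_def i(2) less_Suc_eq\<close>)
  then show ?thesis using \<open>i < n\<close> i(1) by (intro exI[of _ "n - Suc i"]) simp
qed

definition peel_post :: "state \<Rightarrow> bool" where
  "peel_post s \<longleftrightarrow> input_intact s \<and> (\<forall>v<n. arrs s 6 v = off v) \<and>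
    zero_from 10 12 s \<and>
     (\<forall>v<n. arrs s 10 v = coreness G v)"

lemma runs_init:
  "runs init_prog (input_state xss) (Suc n * (1 + bcost (Less (Reg 2) (Reg 0)) + cost init_body) + 4)
     (\<lambda>s. \<exists>p \<le> 4 * card (edges G) + 3 * n. peel_state p s)"
  unfolding init_prog_def
proof (rule runs_Seq)
  show "runs (While (Less (Reg 2) (Reg 0)) init_body) (input_state xss)
      (Suc n * (1 + bcost (Less (Reg 2) (Reg 0)) + cost init_body))
      (\<lambda>s. (\<exists>p. init_state p s) \<and> \<not> bval (Less (Reg 2) (Reg 0)) s)"
    by (rule runs_While[OF _ init_start init_step]) (simp_all add: init_body_def)
  fix s assume "(\<exists>p. init_state p s) \<and> \<not> bval (Less (Reg 2) (Reg 0)) s"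
  then obtain i where i: "i \<le> n" "regs s = (\<lambda>_. 0)(0 := n, 2 := i)"
    "\<forall>a. a \<notin> {5..8} \<longrightarrow> arrs s a = arrs (input_state xss) a" "\<not> i < n"
    "\<forall>v<i. arrs s 5 v = off v \<and> arrs s 6 v = off v \<and> arrs s 7 v = deg v \<and> arrs s 8 v
      = v"
    "arrs s 9 = (\<lambda>_. 0)"
    unfolding init_state_def by auto
  then have "i = n" by simp
  let ?c = "Seq (Assign 5 (Reg 0)) (Assign 6 (Reg 0))"
  let ?s = "run ?c s"
  have "peel_inv {} [] (arrs s 5) (arrs s 7) (arrs s 8) (\<lambda>_. 0) (arrs s 10) (arrs s 11) 0 0 n n 0"
    "peel_pot [] (arrs s 5) (arrs s 8) (\<lambda>_. 0) 0 n n 0 \<le> 4 * card (edges G) + 3 * n"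
    using i(5) \<open>i = n\<close> by (auto intro!: peel_init)
  moreover have "input_intact ?s" "zero_from 10 12 ?s"
    using i(1,2,3) arrs_input(2)[unfolded One_nat_def]
    by (auto simp: input_intact_def zero_from_def arrs_input)
  ultimately have "\<exists>p \<le> 4 * card (edges G) + 3 * n. peel_state p ?s"
    unfolding peel_state_def using i \<open>i = n\<close>
      by (intro exI[of _ "peel_pot [] (arrs s 5) (arrs s 8) (\<lambda>_. 0) 0 n n 0"]) auto
  from runs_loop_free[of ?c "\<lambda>s. \<exists>p \<le> 4 * card (edges G) + 3 * n. peel_state p s", OF _
    this]
  have "runs ?c s (cost ?c) (\<lambda>s. \<exists>p \<le> 4 * card (edges G) + 3 * n. peel_state p s)" by simp
  then show "runs ?c s 4 (\<lambda>s. \<exists>p \<le> 4 * card (edges G) + 3 * n. peel_state p s)"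
    by (rule runs_weaken) simp_all
qed

lemma runs_peel: "runs peel_prog (input_state xss) (peel_time * (n + card (edges G))) peel_post"
proof -
  let ?L = "1 + bcost (Less (Reg 2) (Reg 0)) + cost init_body"
  let ?K = "1 + bcost peel_cond + cost peel_body"
  let ?m = "card (edges G)"
  have distrib: "(2 * N) * a + 4 * N + (5 * N) * b = (2 * a + 4 + 5 * b) * N" for N a b :: nat
    by (simp add: algebra_simps)
  have "runs (While peel_cond peel_body) s (Suc (4 * ?m + 3 * n) * ?K) peel_post"
    if "\<exists>p \<le> 4 * ?m + 3 * n. peel_state p s" for s
  proof -
    from that obtain p where p: "p \<le> 4 * ?m + 3 * n" "peel_state p s" by blast
    show ?thesis
    proof (rule runs_weaken[OF runs_While[OF _ p(2) peel_step]])
      show "Suc p * ?K \<le> Suc (4 * ?m + 3 * n) * ?K" using p(1) by (intro mult_le_mono1) simp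
      fix s' assume "(\<exists>q. peel_state q s') \<and> \<not> bval peel_cond s'"
      then show "peel_post s'"
        using peel_done unfolding peel_post_def by (auto simp: peel_state_def)
    qed (simp_all add: peel_body_def mark_com_def)
  qed
  note * = runs_Seq[OF runs_init this]
  show ?thesis
    unfolding peel_prog_def
  proof (rule runs_weaken[OF *])
    have "Suc (4 * ?m + 3 * n) * ?K \<le> (5 * (n + ?m)) * ?K"
      by (rule mult_le_mono1) (use n_pos in simp)
    moreover have "Suc n * ?L \<le> (2 * (n + ?m)) * ?L"
      by (rule mult_le_mono1) (use n_pos in simp)
    moreover have "4 \<le> 4 * (n + ?m)" using n_pos by simp
    ultimately have "Suc n * ?L + 4 + Suc (4 * ?m + 3 * n) * ?K
        \<le> (2 * (n + ?m)) * ?L + 4 * (n + ?m) + (5 * (n + ?m)) * ?K"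
      by (intro add_mono)
    also have "\<dots> = peel_time * (n + ?m)"
      using distrib[of "n + ?m" ?L ?K] unfolding peel_time_def .
    finally show "Suc n * ?L + 4 + Suc (4 * ?m + 3 * n) * ?K \<le> peel_time * (n + ?m)" .
  qed
qed

end

section \<open>Building the uncontracted tree by flooding\<close>

text \<open>Array 6: position of the next neighbour to scan; array 12: marks of the discovered vertices;
  arrays 13 and 14: heads and links of the lists of discovered unfinished vertices of each coreness;
  array 15: the open core of each level; arrays 16 and 17: parents and levels of the tree nodes.
  Register 10 holds the current level, register 11 a pointer to a vertex that is about to be
  discovered, register 12 the next start vertex, and register 13 the number of tree nodes.\<close>

definition flood_init :: com where
  "flood_init =
     Seq (Write 15 (Const 0) (Reg 0))
    (Seq (Write 16 (Reg 0) (Reg 0))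
         (Assign 13 (Succ (Reg 0))))"

definition raise_com :: com where
  "raise_com =
     Seq (Write 16 (Reg 13) (Read 15 (Reg 10)))
    (Seq (Assign 10 (Succ (Reg 10)))
    (Seq (Write 15 (Reg 10) (Reg 13))
    (Seq (Write 17 (Reg 13) (Reg 10))
         (Assign 13 (Succ (Reg 13))))))"

definition discover_com :: com where
  "discover_com =
     Seq (Write 12 (Reg 15) (Const 1))
    (Seq (Assign 14 (Read 10 (Reg 15)))
    (Seq (Write 14 (Reg 15) (Read 13 (Reg 14)))
    (Seq (Write 13 (Reg 14) (Succ (Reg 15)))
    (Seq (Write 16 (Reg 15) (Read 15 (Reg 14)))
    (Seq (Write 17 (Reg 15) (Reg 14))
         (Assign 11 (Const 0)))))))"

definition scan_com :: com where
  "scan_com =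
     Seq (Assign 15 (Read 1 (Read 6 (Reg 14))))
    (Seq (Write 6 (Reg 14) (Succ (Read 6 (Reg 14))))
         (If (Less (Read 12 (Reg 15)) (Const 1)) (Assign 11 (Succ (Reg 15))) Skip))"

text \<open>The pending vertex in register 11 waits while one core per iteration is opened above the
  current level. Only when nothing is pending are scanning, descending and restarting considered, in
  this order.\<close>

definition flood_body :: com where
  "flood_body =
     If (Less (Const 0) (Reg 11))
       (Seq (Assign 15 (Minus (Reg 11) (Const 1)))
            (If (Less (Reg 10) (Read 10 (Reg 15))) raise_com discover_com))
    (If (Less (Const 0) (Read 13 (Reg 10)))
       (Seq (Assign 14 (Minus (Read 13 (Reg 10)) (Const 1)))
            (If (Less (Read 6 (Reg 14)) (Read 0 (Succ (Reg 14))))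
               scan_com (Write 13 (Reg 10) (Read 14 (Reg 14)))))
    (If (Less (Const 0) (Reg 10))
       (Assign 10 (Minus (Reg 10) (Const 1)))
    (If (Less (Read 12 (Reg 12)) (Const 1))
       (Assign 11 (Succ (Reg 12))) (Assign 12 (Succ (Reg 12))))))"

definition flood_prog :: com where
  "flood_prog = Seq flood_init (While (Less (Reg 12) (Reg 0)) flood_body)"

text \<open>The factor 7 covers the initial potential \<open>6 m + 4 n\<close> plus one, per unit of
  \<open>n + m\<close>.\<close>

definition flood_time :: nat where
  "flood_time = cost flood_init + 7 * (1 + bcost (Less (Reg 12) (Reg 0)) + cost flood_body)"

lemma sum_drop:
  fixes f g :: "'b \<Rightarrow> nat"
  assumes "finite A" "w \<in> A" "\<And>v. v \<in> A \<Longrightarrow> v \<noteq> w \<Longrightarrow> f v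
    \<le> g v" "f w + k \<le> g w"
  shows "sum f A + k \<le> sum g A"
proof -
  have "sum f A = f w + sum f (A - {w})" "sum g A = g w + sum g (A - {w})"
    using assms(1,2) by (simp_all add: sum.remove)
  moreover have "sum f (A - {w}) \<le> sum g (A - {w})" using assms(3) by (intro sum_mono) auto
  ultimately show ?thesis using assms(4) by simp
qed

section \<open>Invariant and potential of the flooding\<close>

context input_graph
begin

text \<open>\<open>\<psi>\<close> names the tree nodes allocated so far, \<open>bs\<close> are the contents of the
  lists, and \<open>z\<close> is a vertex of all open cores. A core that is allocated but not open has been
  discovered completely.\<close>

inductive flood_inv :: "(nat \<Rightarrow> nat list) \<Rightarrow> (nat \<Rightarrow> nat node)
  \<Rightarrow> nat \<Rightarrow> (nat \<Rightarrow> nat) \<Rightarrow> (nat \<Rightarrow> nat) \<Rightarrow>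
    (nat \<Rightarrow> nat) \<Rightarrow> (nat \<Rightarrow> nat) \<Rightarrow> (nat \<Rightarrow> nat)
      \<Rightarrow> (nat \<Rightarrow> nat) \<Rightarrow> (nat \<Rightarrow> nat) \<Rightarrow> nat
        \<Rightarrow> nat \<Rightarrow> nat \<Rightarrow> nat \<Rightarrow> bool"
  for bs \<psi> z ptr disc front nxt cur par lev h pend nxs cnt where
  flood_invI:
    "(\<And>v. v < n \<Longrightarrow> off v \<le> ptr v) \<Longrightarrow>
     (\<And>v. v < n \<Longrightarrow> ptr v \<le> off (Suc v)) \<Longrightarrow>
     (\<And>l. linked nxt (front l) (bs l)) \<Longrightarrow>
     (\<And>l. distinct (bs l)) \<Longrightarrow>
     (\<And>v l. v \<in> set (bs l) \<Longrightarrow> v < n) \<Longrightarrow>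
     (\<And>v l. v \<in> set (bs l) \<Longrightarrow> disc v \<noteq> 0) \<Longrightarrow>
     (\<And>v l. v \<in> set (bs l) \<Longrightarrow> coreness G v = l) \<Longrightarrow>
     (\<And>v l. v \<in> set (bs l) \<Longrightarrow> l \<le> h) \<Longrightarrow>
     (\<And>v. v < n \<Longrightarrow> disc v \<noteq> 0 \<Longrightarrow> v \<notin> set (bs (coreness G
       v)) \<Longrightarrow> ptr v = off (Suc v)) \<Longrightarrow>
     (\<And>v w. v < n \<Longrightarrow> w \<in> seen ptr v \<Longrightarrow> disc w \<noteq> 0 \<or> pend
       = Suc w) \<Longrightarrow>
     (n < cnt) \<Longrightarrow>
     (\<And>v. v < n \<Longrightarrow> \<psi> v = Leaf v) \<Longrightarrow>
     (\<psi> n = Core 0 (verts G)) \<Longrightarrow>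
     (\<And>i. n \<le> i \<Longrightarrow> i < cnt \<Longrightarrow> \<psi> i \<in> core_nodes G)
       \<Longrightarrow>
     (\<And>i. n \<le> i \<Longrightarrow> i < cnt \<Longrightarrow> level G (\<psi> i) = lev i)
       \<Longrightarrow>
     (inj_on \<psi> {n..<cnt}) \<Longrightarrow>
     (\<And>i. n < i \<Longrightarrow> i < cnt \<Longrightarrow> n \<le> par i) \<Longrightarrow>
     (\<And>i. n < i \<Longrightarrow> i < cnt \<Longrightarrow> par i < i) \<Longrightarrow>
     (\<And>i. n < i \<Longrightarrow> i < cnt \<Longrightarrow> (\<psi> i, \<psi> (par i)) \<in>
       unc_parent G) \<Longrightarrow>
     (\<And>v. v < n \<Longrightarrow> disc v \<noteq> 0 \<Longrightarrow> n \<le> par v) \<Longrightarrow>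
     (\<And>v. v < n \<Longrightarrow> disc v \<noteq> 0 \<Longrightarrow> par v < cnt) \<Longrightarrow>
     (\<And>v. v < n \<Longrightarrow> disc v \<noteq> 0 \<Longrightarrow> (Leaf v, \<psi> (par v)) \<in>
       unc_parent G) \<Longrightarrow>
     (\<And>v. v < n \<Longrightarrow> disc v \<noteq> 0 \<Longrightarrow> lev v = coreness G v)
       \<Longrightarrow>
     (z < n) \<Longrightarrow>
     (h \<le> coreness G z) \<Longrightarrow>
     (0 < h \<Longrightarrow> disc z \<noteq> 0 \<or> pend = Suc z) \<Longrightarrow>
     (\<And>l. l \<le> h \<Longrightarrow> n \<le> cur l) \<Longrightarrow>
     (\<And>l. l \<le> h \<Longrightarrow> cur l < cnt) \<Longrightarrow>
     (\<And>l. l \<le> h \<Longrightarrow> \<psi> (cur l) = Core l (core_of G l z)) \<Longrightarrow>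
     (\<And>v l. v \<in> set (bs l) \<Longrightarrow> core_of G l v = core_of G l z) \<Longrightarrow>
     (\<And>w. pend = Suc w \<Longrightarrow> w < n) \<Longrightarrow>
     (\<And>w. pend = Suc w \<Longrightarrow> disc w = 0) \<Longrightarrow>
     (\<And>w l. pend = Suc w \<Longrightarrow> l \<le> h \<Longrightarrow> l \<le> coreness G w
       \<Longrightarrow> core_of G l w = core_of G l z) \<Longrightarrow>
     (\<And>i l K. n \<le> i \<Longrightarrow> i < cnt \<Longrightarrow> \<psi> i = Core l K
       \<Longrightarrow> (l \<le> h \<and> i = cur l) \<or> (\<forall>x\<in>K. disc x \<noteq> 0))
         \<Longrightarrow>
     (\<And>v l. v < n \<Longrightarrow> disc v \<noteq> 0 \<Longrightarrow> l \<le> coreness G v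
       \<Longrightarrow> \<exists>i. n \<le> i \<and> i < cnt \<and> \<psi> i = Core l (core_of G l v))
         \<Longrightarrow>
     (nxs \<le> n) \<Longrightarrow>
     (\<And>u. u < nxs \<Longrightarrow> disc u \<noteq> 0) \<Longrightarrow>
     flood_inv bs \<psi> z ptr disc front nxt cur par lev h pend nxs cnt"

text \<open>The list index \<open>l\<close> does not occur in these conclusions, so they are
  extracted by hand for \<open>flood_invD\<close>, the second one in the simplified form
  \<open>0 < disc v\<close>.\<close>

lemma flood_inv_listed:
  assumes "flood_inv bs \<psi> z ptr disc front nxt cur par lev h pend nxs cnt"
  shows "\<And>v l. v \<in> set (bs l) \<Longrightarrow> v < n" "\<And>v l. v \<in> set (bs l)
    \<Longrightarrow> 0 < disc v"
proof -
  note F = assms[unfolded flood_inv.simps, THEN conjunct2, THEN conjunct2, THEN conjunct2, THEN conjunct2]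
  show "\<And>v l. v \<in> set (bs l) \<Longrightarrow> v < n" using F[THEN conjunct1] by blast
  show "\<And>v l. v \<in> set (bs l) \<Longrightarrow> 0 < disc v" using F[THEN conjunct2, THEN conjunct1]
    by blast
qed

lemma flood_invD:
  assumes "flood_inv bs \<psi> z ptr disc front nxt cur par lev h pend nxs cnt"
  shows "\<And>v. v < n \<Longrightarrow> off v \<le> ptr v"
    "\<And>v. v < n \<Longrightarrow> ptr v \<le> off (Suc v)"
    "\<And>l. linked nxt (front l) (bs l)"
    "\<And>l. distinct (bs l)"
    "\<And>v l. v \<in> set (bs l) \<Longrightarrow> v < n"
    "\<And>v l. v \<in> set (bs l) \<Longrightarrow> disc v \<noteq> 0"
    "\<And>v l. v \<in> set (bs l) \<Longrightarrow> coreness G v = l"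
    "\<And>v l. v \<in> set (bs l) \<Longrightarrow> l \<le> h"
    "\<And>v. v < n \<Longrightarrow> disc v \<noteq> 0 \<Longrightarrow> v \<notin> set (bs (coreness G
      v)) \<Longrightarrow> ptr v = off (Suc v)"
    "\<And>v w. v < n \<Longrightarrow> w \<in> seen ptr v \<Longrightarrow> disc w \<noteq> 0 \<or> pend =
      Suc w"
    "n < cnt"
    "\<And>v. v < n \<Longrightarrow> \<psi> v = Leaf v"
    "\<psi> n = Core 0 (verts G)"
    "\<And>i. n \<le> i \<Longrightarrow> i < cnt \<Longrightarrow> \<psi> i \<in> core_nodes G"
    "\<And>i. n \<le> i \<Longrightarrow> i < cnt \<Longrightarrow> level G (\<psi> i) = lev i"
    "inj_on \<psi> {n..<cnt}"
    "\<And>i. n < i \<Longrightarrow> i < cnt \<Longrightarrow> n \<le> par i"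
    "\<And>i. n < i \<Longrightarrow> i < cnt \<Longrightarrow> par i < i"
    "\<And>i. n < i \<Longrightarrow> i < cnt \<Longrightarrow> (\<psi> i, \<psi> (par i)) \<in> unc_parent G"
    "\<And>v. v < n \<Longrightarrow> disc v \<noteq> 0 \<Longrightarrow> n \<le> par v"
    "\<And>v. v < n \<Longrightarrow> disc v \<noteq> 0 \<Longrightarrow> par v < cnt"
    "\<And>v. v < n \<Longrightarrow> disc v \<noteq> 0 \<Longrightarrow> (Leaf v, \<psi> (par v)) \<in>
      unc_parent G"
    "\<And>v. v < n \<Longrightarrow> disc v \<noteq> 0 \<Longrightarrow> lev v = coreness G v"
    "z < n"
    "h \<le> coreness G z"
    "0 < h \<Longrightarrow> disc z \<noteq> 0 \<or> pend = Suc z"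
    "\<And>l. l \<le> h \<Longrightarrow> n \<le> cur l"
    "\<And>l. l \<le> h \<Longrightarrow> cur l < cnt"
    "\<And>l. l \<le> h \<Longrightarrow> \<psi> (cur l) = Core l (core_of G l z)"
    "\<And>v l. v \<in> set (bs l) \<Longrightarrow> core_of G l v = core_of G l z"
    "\<And>w. pend = Suc w \<Longrightarrow> w < n"
    "\<And>w. pend = Suc w \<Longrightarrow> disc w = 0"
    "\<And>w l. pend = Suc w \<Longrightarrow> l \<le> h \<Longrightarrow> l \<le> coreness G w
      \<Longrightarrow> core_of G l w = core_of G l z"
    "\<And>i l K. n \<le> i \<Longrightarrow> i < cnt \<Longrightarrow> \<psi> i = Core l K
      \<Longrightarrow> (l \<le> h \<and> i = cur l) \<or> (\<forall>x\<in>K. disc x \<noteq> 0)"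
    "\<And>v l. v < n \<Longrightarrow> disc v \<noteq> 0 \<Longrightarrow> l \<le> coreness G v
      \<Longrightarrow> \<exists>i. n \<le> i \<and> i < cnt \<and> \<psi> i = Core l (core_of G l v)"
    "nxs \<le> n"
    "\<And>u. u < nxs \<Longrightarrow> disc u \<noteq> 0"
  by (insert assms, unfold flood_inv.simps, simp_all, (erule flood_inv_listed[OF assms])+)

text \<open>Each level that a vertex makes the flood climb is prepaid with 2 units: raising the
  level by one costs a unit of \<open>h\<close> in \<open>flood_pot\<close> and must release
  another, and the later descent consumes that unit of \<open>h\<close>. The remaining 3 units are
  released when the vertex becomes pending, when it is discovered and when it leaves its
  list.\<close>

definition weight :: "(nat \<Rightarrow> nat list) \<Rightarrow> (nat \<Rightarrow> nat) \<Rightarrow> nat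
  \<Rightarrow> nat \<Rightarrow> nat \<Rightarrow> nat" where
  "weight bs disc h pend v =
     (if disc v = 0 then if pend = Suc v then 2 + 2 * (coreness G v - h) else 3 + 2 * coreness G v
      else if v \<in> set (bs (coreness G v)) then 1 else 0)"

definition flood_pot :: "(nat \<Rightarrow> nat list) \<Rightarrow> (nat \<Rightarrow> nat) \<Rightarrow>
  (nat \<Rightarrow> nat) \<Rightarrow> nat \<Rightarrow> nat \<Rightarrow> nat \<Rightarrow> nat" where
  "flood_pot bs ptr disc h pend nxs = unscanned ptr + (\<Sum>v<n. weight bs disc h pend v) + h + (n - nxs)"

lemma core_of_parent_Leaf:
  "v < n \<Longrightarrow> (Leaf v, Core (coreness G v) (core_of G (coreness G v) v)) \<in> unc_parent G"
  using parent_Leaf[OF simple] by (simp add: in_verts_iff)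

lemma core_of_lower: "core_of G k v = core_of G k w \<Longrightarrow> v \<in> core_verts G k
  \<Longrightarrow> j \<le> k \<Longrightarrow> core_of G j v = core_of G j w"
  using core_of_antimono[of j k G w] core_of_self[of v G k] core_of_eq[of v G j w] by auto

text \<open>The new core agrees with no allocated one: those of an open level are too low, and all
  others are discovered completely, whereas \<open>w\<close> is not. As \<open>w\<close> lies in all
  open cores, it replaces \<open>z\<close> as their common vertex.\<close>

lemma flood_raise:
  assumes inv: "flood_inv bs \<psi> z ptr disc front nxt cur par lev h (Suc w) nxs cnt" and w: "h <
    coreness G w"
  shows "flood_inv bs (\<psi>(cnt := Core (Suc h) (core_of G (Suc h) w))) w ptr disc front nxt (cur(Suc h
    := cnt))
      (par(cnt := cur h)) (lev(cnt := Suc h)) (Suc h) (Suc w) nxs (Suc cnt)"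
    "flood_pot bs ptr disc (Suc h) (Suc w) nxs < flood_pot bs ptr disc h (Suc w) nxs"
proof -
  note D = flood_invD[OF inv]
  let ?\<psi> = "\<psi>(cnt := Core (Suc h) (core_of G (Suc h) w))"
  have wn: "w < n" "disc w = 0" using D(31,32)[OF refl] by simp_all
  have wc: "w \<in> core_verts G (Suc h)" using le_coreness[OF wn(1), of "Suc h"] w by simp
  have cz: "core_of G l w = core_of G l z" if "l \<le> h" for l using D(33)[OF refl that] w that by simp
  have \<psi>: "?\<psi> i = \<psi> i" if "i < cnt" for i using that by simp
  have curh: "n \<le> cur h" "cur h < cnt" "\<psi> (cur h) = Core h (core_of G h w)"
    using D(27,28,29)[of h] cz by simp_all
  have new: "Core (Suc h) (core_of G (Suc h) w) \<notin> \<psi> ` {n..<cnt}"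
  proof
    assume "Core (Suc h) (core_of G (Suc h) w) \<in> \<psi> ` {n..<cnt}"
    then obtain i where i: "n \<le> i" "i < cnt" "\<psi> i = Core (Suc h) (core_of G (Suc h) w)" by auto
    show False using D(34)[OF i] core_of_self[OF wc] wn(2) by auto
  qed
  show "flood_inv bs ?\<psi> w ptr disc front nxt (cur(Suc h := cnt))
      (par(cnt := cur h)) (lev(cnt := Suc h)) (Suc h) (Suc w) nxs (Suc cnt)"
  proof (rule flood_invI)
    show "inj_on ?\<psi> {n..<Suc cnt}"
    proof -
      have "inj_on ?\<psi> {n..<cnt}" using D(16) by (rule inj_on_cong[THEN iffD1, rotated]) simp
      moreover have "?\<psi> ` {n..<cnt} = \<psi> ` {n..<cnt}" by (intro image_cong) simp_all
      ultimately show ?thesis using D(11) new by (simp add: atLeastLessThanSuc)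
    qed
    fix i assume i: "n \<le> i" "i < Suc cnt"
    show "?\<psi> i \<in> core_nodes G" using D(14)[OF i(1)] i Core_in_core_nodes[OF simple wc]
      by (cases "i = cnt") auto
    show "level G (?\<psi> i) = (lev(cnt := Suc h)) i" using D(15)[OF i(1)] i by (cases "i = cnt") auto
    show "(l \<le> Suc h \<and> i = (cur(Suc h := cnt)) l) \<or> (\<forall>x\<in>K. disc x \<noteq> 0)"
      if "?\<psi> i = Core l K" for l K
    proof (cases "i = cnt")
      case False
      then show ?thesis using D(34)[of i l K] i that by auto
    qed (use that in auto)
  next
    fix i assume i: "n < i" "i < Suc cnt"
    show "n \<le> (par(cnt := cur h)) i" using D(17) i curh by simp
    show "(par(cnt := cur h)) i < i" using D(18) i curh by simp
    show "(?\<psi> i, ?\<psi> ((par(cnt := cur h)) i)) \<in> unc_parent G"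
    proof (cases "i = cnt")
      case True
      then show ?thesis using curh parent_Core[OF simple wc] by simp
    next
      case False
      then show ?thesis using D(19)[of i] D(18)[of i] i by simp
    qed
  next
    fix v assume v: "v < n" "disc v \<noteq> 0"
    have "v \<noteq> cnt" using v D(11) by simp
    then show "n \<le> (par(cnt := cur h)) v" "(par(cnt := cur h)) v < Suc cnt"
      "(Leaf v, ?\<psi> ((par(cnt := cur h)) v)) \<in> unc_parent G" "(lev(cnt := Suc h)) v = coreness G v"
      using D(20,21,22,23)[OF v] by simp_all
    show "\<exists>i. n \<le> i \<and> i < Suc cnt \<and> ?\<psi> i = Core l (core_of G l v)"
      if l: "l \<le> coreness G v" for l
    proof -
      obtain i where "n \<le> i" "i < cnt" "\<psi> i = Core l (core_of G l v)" using D(35)[OF v l] by auto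
      then show ?thesis by (intro exI[of _ i]) simp
    qed
  next
    fix l assume l: "l \<le> Suc h"
    show "n \<le> (cur(Suc h := cnt)) l" "(cur(Suc h := cnt)) l < Suc cnt"
      "?\<psi> ((cur(Suc h := cnt)) l) = Core l (core_of G l w)"
      using D(11) D(27,28,29)[of l] cz[of l] l by (cases "l = Suc h"; simp)+
  next
    fix v l assume v: "v \<in> set (bs l)"
    show "core_of G l v = core_of G l w" using D(30)[OF v] cz[OF D(8)[OF v]] by simp
    show "l \<le> Suc h" using D(8)[OF v] by simp
  qed (use D wn w in auto)
  have "weight bs disc (Suc h) (Suc w) v = weight bs disc h (Suc w) v" if "v \<noteq> w" for v
    using that by (simp add: weight_def)
  moreover have "weight bs disc (Suc h) (Suc w) w + 2 \<le> weight bs disc h (Suc w) w"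
    using wn w by (simp add: weight_def)
  ultimately have "(\<Sum>v<n. weight bs disc (Suc h) (Suc w) v) + 2 \<le> (\<Sum>v<n. weight bs disc h
    (Suc w) v)"
    using wn by (intro sum_drop[of _ w]) simp_all
  then show "flood_pot bs ptr disc (Suc h) (Suc w) nxs < flood_pot bs ptr disc h (Suc w) nxs"
    by (simp add: flood_pot_def)
qed

text \<open>The open core of level \<open>coreness G w\<close> is the core of \<open>w\<close>
  itself, hence the parent of its leaf.\<close>

lemma flood_discover:
  assumes inv: "flood_inv bs \<psi> z ptr disc front nxt cur par lev h (Suc w) nxs cnt" and w: "coreness G
    w \<le> h"
  defines "k \<equiv> coreness G w"
  shows "flood_inv (bs(k := w # bs k)) \<psi> z ptr (disc(w := 1)) (front(k := Suc w)) (nxt(w := front k)) cur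
      (par(w := cur k)) (lev(w := k)) h 0 nxs cnt"
    "flood_pot (bs(k := w # bs k)) ptr (disc(w := 1)) h 0 nxs < flood_pot bs ptr disc h (Suc w) nxs"
proof -
  note D = flood_invD[OF inv]
  let ?bs = "bs(k := w # bs k)"
  have wn: "w < n" "disc w = 0" using D(31,32)[OF refl] by simp_all
  have wbs: "w \<notin> set (bs l)" for l using D(6)[of w l] wn(2) by auto
  have cz: "core_of G l w = core_of G l z" if "l \<le> k" for l using D(33)[OF refl] w that
    by (simp add: k_def)
  have bs: "v \<in> set (?bs l) \<longleftrightarrow> v \<in> set (bs l) \<or> (v = w \<and> l = k)" for v l
    by auto
  have disc: "(disc(w := 1)) v \<noteq> 0 \<longleftrightarrow> disc v \<noteq> 0 \<or> v = w" for v by simp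
  show "flood_inv ?bs \<psi> z ptr (disc(w := 1)) (front(k := Suc w)) (nxt(w := front k)) cur
      (par(w := cur k)) (lev(w := k)) h 0 nxs cnt"
  proof (rule flood_invI)
    fix l show "linked (nxt(w := front k)) ((front(k := Suc w)) l) (?bs l)"
      using D(3)[of l] wbs[of l] by (cases "l = k") (auto simp: linked_update)
    show "distinct (?bs l)" using D(4)[of l] wbs[of l] by (cases "l = k") simp_all
  next
    fix v l assume "v \<in> set (?bs l)"
    then have v: "v \<in> set (bs l) \<or> (v = w \<and> l = k)" using bs by blast
    show "v < n" "(disc(w := 1)) v \<noteq> 0" "coreness G v = l" "l \<le> h" "core_of G l v = core_of G l z"
      using v D(5-8,30)[of v l] wn w cz[of k] by (auto simp: k_def)
  next
    fix v assume "v < n" "(disc(w := 1)) v \<noteq> 0"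
    then have v: "v < n" "disc v \<noteq> 0 \<or> v = w" using disc by simp_all
    show "ptr v = off (Suc v)" if "v \<notin> set (?bs (coreness G v))"
    proof -
      have "v \<noteq> w" "v \<notin> set (bs (coreness G v))" using that bs k_def by auto
      then show ?thesis using D(9) v by simp
    qed
    have "coreness G w \<le> h" "\<psi> (cur k) = Core k (core_of G k w)" using w D(29)[of k] cz[of k]
      by (simp_all add: k_def)
    then show "n \<le> (par(w := cur k)) v" "(par(w := cur k)) v < cnt"
      "(Leaf v, \<psi> ((par(w := cur k)) v)) \<in> unc_parent G" "(lev(w := k)) v = coreness G v"
      using D(20-23)[of v] v D(27,28)[of k] core_of_parent_Leaf[OF wn(1)] by (cases "v = w"; simp add: k_def)+
    show "\<exists>i. n \<le> i \<and> i < cnt \<and> \<psi> i = Core l (core_of G l v)"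
      if l: "l \<le> coreness G v" for l
    proof (cases "v = w")
      case True
      then have "l \<le> h" using l w by simp
      then show ?thesis using D(27-29)[of l] cz[of l] True l k_def by (intro exI[of _ "cur l"]) simp
    next
      case False
      then show ?thesis using D(35)[of v l] v l by simp
    qed
  next
    fix i l K assume "n \<le> i" "i < cnt" "\<psi> i = Core l K"
    then show "(l \<le> h \<and> i = cur l) \<or> (\<forall>x\<in>K. (disc(w := 1)) x \<noteq> 0)"
      unfolding disc using D(34) by blast
  next
    fix i assume i: "n \<le> i" "i < cnt"
    then show "level G (\<psi> i) = (lev(w := k)) i" using D(15) wn(1) by simp
  next
    fix i assume i: "n < i" "i < cnt"
    then show "n \<le> (par(w := cur k)) i" "(par(w := cur k)) i < i" "(\<psi> i, \<psi> ((par(w := cur k))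
      i)) \<in> unc_parent G"
      using D(17-19) wn(1) by simp_all
  next
    fix v u assume "v < n" "u \<in> seen ptr v"
    then show "(disc(w := 1)) u \<noteq> 0 \<or> 0 = Suc u" using D(10)[of v u] by auto
  next
    assume "0 < h"
    then show "(disc(w := 1)) z \<noteq> 0 \<or> 0 = Suc z" using D(26) by auto
  next
    fix u assume "u < nxs"
    then show "(disc(w := 1)) u \<noteq> 0" unfolding disc using D(37) by blast
  qed (use D(1,2,11-14,16,24,25,27-29,36) in simp_all)
  have "weight ?bs (disc(w := 1)) h 0 v = weight bs disc h (Suc w) v" if "v \<noteq> w" for v
    using that by (auto simp: weight_def)
  moreover have "weight ?bs (disc(w := 1)) h 0 w + 1 \<le> weight bs disc h (Suc w) w"
    using wn by (simp add: weight_def)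
  ultimately have "(\<Sum>v<n. weight ?bs (disc(w := 1)) h 0 v) + 1 \<le> (\<Sum>v<n. weight bs disc h (Suc
    w) v)"
    using wn by (intro sum_drop[of _ w]) simp_all
  then show "flood_pot ?bs ptr (disc(w := 1)) h 0 nxs < flood_pot bs ptr disc h (Suc w) nxs"
    by (simp add: flood_pot_def)
qed

text \<open>Being adjacent, \<open>v\<close> and \<open>x\<close> share a core at every level at
  which both have one. Up to level \<open>h\<close> the cores of \<open>v\<close> are open, so a
  newly found \<open>x\<close> fits into the open cores.\<close>

lemma flood_scan:
  assumes inv: "flood_inv bs \<psi> z ptr disc front nxt cur par lev h 0 nxs cnt"
    and v: "v \<in> set (bs h)" "ptr v < off (Suc v)"
  defines "x \<equiv> nb (ptr v)"
  defines "pend \<equiv> if disc x = 0 then Suc x else 0"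
  shows "flood_inv bs \<psi> z (ptr(v := Suc (ptr v))) disc front nxt cur par lev h pend nxs cnt"
    "flood_pot bs (ptr(v := Suc (ptr v))) disc h pend nxs < flood_pot bs ptr disc h 0 nxs"
proof -
  note D = flood_invD[OF inv]
  have vn: "v < n" "coreness G v = h" "core_of G h v = core_of G h z" using D(5,7,30)[OF v(1)] by simp_all
  have pv: "off v \<le> ptr v" using D(1)[OF vn(1)] .
  note x = nb_in_neighbours[OF vn(1) pv v(2), folded x_def]
  have pend: "pend = Suc u \<longleftrightarrow> disc u = 0 \<and> u = x" for u by (auto simp: pend_def)
  have pend': "disc u \<noteq> 0 \<or> (disc u = 0 \<and> u = x)"
    if "disc u \<noteq> 0 \<or> 0 = Suc u \<or> u = x" for u using that by auto
  show "flood_inv bs \<psi> z (ptr(v := Suc (ptr v))) disc front nxt cur par lev h pend nxs cnt"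
  proof (rule flood_invI)
    fix u assume "u < n"
    then show "off u \<le> (ptr(v := Suc (ptr v))) u" "(ptr(v := Suc (ptr v))) u \<le> off (Suc u)"
      using D(1,2)[of u] v(2) by auto
  next
    fix u assume "u < n" "disc u \<noteq> 0" "u \<notin> set (bs (coreness G u))"
    then show "(ptr(v := Suc (ptr v))) u = off (Suc u)" using D(9)[of u] v vn by auto
  next
    fix u w assume "u < n" "w \<in> seen (ptr(v := Suc (ptr v))) u"
    then show "disc w \<noteq> 0 \<or> pend = Suc w" unfolding pend
      using D(10)[of u w] seen_step(1)[where ptr = ptr and v = v, OF vn(1) pv v(2), of u]
      by (intro pend') (auto simp: x_def split: if_splits)
  next
    fix u l assume "pend = Suc u" and l: "l \<le> h" "l \<le> coreness G u"
    then have u: "u = x" using pend by simp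
    have vl: "v \<in> core_verts G l" "v \<in> core_verts G h" using le_coreness[OF vn(1)] vn l by auto
    have "core_of G l x = core_of G l v"
      using core_of_edge[OF x(1) vl(1)] le_coreness[OF x(2), of l] l u by simp
    also have "\<dots> = core_of G l z" by (rule core_of_lower[OF vn(3) vl(2) l(1)])
    finally show "core_of G l u = core_of G l z" by (simp add: u)
  next
    assume "0 < h"
    then show "disc z \<noteq> 0 \<or> pend = Suc z" using D(26) by simp
  qed (use D(3-8,11-25,27-30,34-37) x(2) pend in simp_all)
  have "weight bs disc h pend u \<le> weight bs disc h 0 u" for u
    by (auto simp: weight_def pend)
  then have "(\<Sum>u<n. weight bs disc h pend u) \<le> (\<Sum>u<n. weight bs disc h 0 u)" by (intro sum_mono)
  then show "flood_pot bs (ptr(v := Suc (ptr v))) disc h pend nxs < flood_pot bs ptr disc h 0 nxs"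
    using unscanned_step[of v ptr, OF vn(1) v(2)] by (simp add: flood_pot_def)
qed

lemma flood_pop:
  assumes inv: "flood_inv bs \<psi> z ptr disc front nxt cur par lev h 0 nxs cnt"
    and v: "bs h = v # vs" "\<not> ptr v < off (Suc v)"
  shows "flood_inv (bs(h := vs)) \<psi> z ptr disc (front(h := nxt v)) nxt cur par lev h 0 nxs cnt"
    "flood_pot (bs(h := vs)) ptr disc h 0 nxs < flood_pot bs ptr disc h 0 nxs"
proof -
  note D = flood_invD[OF inv]
  have vh: "v \<in> set (bs h)" "v \<notin> set vs" using v D(4)[of h] by simp_all
  have vn: "v < n" "coreness G v = h" "disc v \<noteq> 0" using D(5-7)[OF vh(1)] by simp_all
  have pv: "ptr v = off (Suc v)" using D(2)[OF vn(1)] v by simp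
  have bs: "u \<in> set ((bs(h := vs)) l) \<Longrightarrow> u \<in> set (bs l)" for u l using v
    by (cases "l = h") auto
  have bs': "u \<in> set (bs l) \<Longrightarrow> u \<noteq> v \<Longrightarrow> u \<in> set ((bs(h := vs))
    l)" for u l using v by (cases "l = h") auto
  show "flood_inv (bs(h := vs)) \<psi> z ptr disc (front(h := nxt v)) nxt cur par lev h 0 nxs cnt"
  proof (rule flood_invI)
    fix l show "linked nxt ((front(h := nxt v)) l) ((bs(h := vs)) l)" using D(3)[of l] v
      by (cases "l = h") auto
    show "distinct ((bs(h := vs)) l)" using D(4)[of l] v by (cases "l = h") auto
  next
    fix u l assume "u \<in> set ((bs(h := vs)) l)"
    note u = bs[OF this]
    show "u < n" "disc u \<noteq> 0" "coreness G u = l" "l \<le> h" "core_of G l u = core_of G l z"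
      using D(5-8,30)[OF u] by simp_all
  next
    fix u assume "u < n" "disc u \<noteq> 0" "u \<notin> set ((bs(h := vs)) (coreness G u))"
    then show "ptr u = off (Suc u)" using D(9)[of u] pv bs'[of u "coreness G u"] by (cases "u = v") auto
  qed ((rule D; assumption)+)
  have "weight (bs(h := vs)) disc h 0 u \<le> weight bs disc h 0 u" for u
    using bs[of u "coreness G u"] by (auto simp: weight_def)
  moreover have "weight (bs(h := vs)) disc h 0 v + 1 \<le> weight bs disc h 0 v"
    using vh vn by (simp add: weight_def)
  ultimately have "(\<Sum>u<n. weight (bs(h := vs)) disc h 0 u) + 1 \<le> (\<Sum>u<n. weight bs disc h 0 u)"
    using vn(1) by (intro sum_drop[of _ v]) simp_all
  then show "flood_pot (bs(h := vs)) ptr disc h 0 nxs < flood_pot bs ptr disc h 0 nxs"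
    by (simp add: flood_pot_def)
qed

text \<open>All lists of level above \<open>h\<close> are empty, so every discovered vertex of the
  core being closed has been scanned completely. With nothing pending, its neighbours are discovered
  too, and by connectedness so is the whole core. It may therefore stop being open.\<close>

lemma flood_lower:
  assumes inv: "flood_inv bs \<psi> z ptr disc front nxt cur par lev (Suc h) 0 nxs cnt" and empty: "bs (Suc
    h) = []"
  shows "flood_inv bs \<psi> z ptr disc front nxt cur par lev h 0 nxs cnt"
    "flood_pot bs ptr disc h 0 nxs < flood_pot bs ptr disc (Suc h) 0 nxs"
proof -
  note D = flood_invD[OF inv]
  have nil: "set (bs l) = {}" if "h < l" for l
  proof (cases "l = Suc h")
    case False
    then have "v \<notin> set (bs l)" for v using D(8)[of v l] that by auto
    then show ?thesis by (intro equals0I, blast)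
  qed (simp add: empty)
  have zc: "z \<in> core_verts G (Suc h)" using D(25) le_coreness[OF D(24), of "Suc h"] by simp
  have closed: "core_of G (Suc h) z \<subseteq> {x. disc x \<noteq> 0}"
  proof (rule core_of_closed[OF _ core_of_self[OF zc]])
    show "z \<in> {x. disc x \<noteq> 0}" using D(26) by auto
    fix y u assume y: "y \<in> {x. disc x \<noteq> 0}" "y \<in> core_of G (Suc h) z" "u \<in> neighbours G y"
    have yn: "y < n" using neighbour_less'[OF y(3)] .
    have "Suc h \<le> coreness G y" using y(2) core_of_subset[of G "Suc h" z] le_coreness[OF yn, of "Suc h"]
      by auto
    then have "ptr y = off (Suc y)" using D(9)[OF yn] y(1) nil by simp
    then have "u \<in> seen ptr y" using seen_full[OF yn] y(3) by simp
    then show "u \<in> {x. disc x \<noteq> 0}" using D(10)[OF yn] by auto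
  qed simp
  show "flood_inv bs \<psi> z ptr disc front nxt cur par lev h 0 nxs cnt"
  proof (rule flood_invI)
    fix v l assume v: "v \<in> set (bs l)"
    show "l \<le> h" using nil[of l] v by (cases "l \<le> h") auto
  next
    fix i l K assume i: "n \<le> i" "i < cnt" "\<psi> i = Core l K"
    show "(l \<le> h \<and> i = cur l) \<or> (\<forall>x\<in>K. disc x \<noteq> 0)"
    proof (cases "l = Suc h \<and> i = cur l")
      case True
      then have "K = core_of G (Suc h) z" using D(29)[of l] i(3) by simp
      then show ?thesis using closed by auto
    next
      case False
      then show ?thesis using D(34)[OF i] by (auto simp: le_Suc_eq)
    qed
  next
    show "h \<le> coreness G z" using D(25) by simp
  qed (use D(1-7,9-24,26-30,35-37) in \<open>simp_all\<close>)
  have "weight bs disc h 0 = weight bs disc (Suc h) 0" by (simp add: weight_def fun_eq_iff)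
  then show "flood_pot bs ptr disc h 0 nxs < flood_pot bs ptr disc (Suc h) 0 nxs"
    by (simp add: flood_pot_def)
qed

text \<open>At level 0 only the root is open, and it contains every vertex; this also handles
  further connected components.\<close>

lemma flood_start:
  assumes inv: "flood_inv bs \<psi> z ptr disc front nxt cur par lev 0 0 nxs cnt" and s: "nxs < n" "disc
    nxs = 0"
  shows "flood_inv bs \<psi> z ptr disc front nxt cur par lev 0 (Suc nxs) nxs cnt"
    "flood_pot bs ptr disc 0 (Suc nxs) nxs < flood_pot bs ptr disc 0 0 nxs"
proof -
  note D = flood_invD[OF inv]
  show "flood_inv bs \<psi> z ptr disc front nxt cur par lev 0 (Suc nxs) nxs cnt"
  proof (rule flood_invI)
    fix v w assume "v < n" "w \<in> seen ptr v"
    then show "disc w \<noteq> 0 \<or> Suc nxs = Suc w" using D(10)[of v w] by simp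
  qed (use D(1-9,11-25,27-30,34-37) s in \<open>simp_all add: core_of_def\<close>)
  have "weight bs disc 0 (Suc nxs) u \<le> weight bs disc 0 0 u" for u
    by (simp add: weight_def)
  moreover have "weight bs disc 0 (Suc nxs) nxs + 1 \<le> weight bs disc 0 0 nxs"
    using s by (simp add: weight_def)
  ultimately have "(\<Sum>u<n. weight bs disc 0 (Suc nxs) u) + 1 \<le> (\<Sum>u<n. weight bs disc 0 0 u)"
    using s(1) by (intro sum_drop[of _ nxs]) simp_all
  then show "flood_pot bs ptr disc 0 (Suc nxs) nxs < flood_pot bs ptr disc 0 0 nxs"
    by (simp add: flood_pot_def)
qed

lemma flood_advance:
  assumes inv: "flood_inv bs \<psi> z ptr disc front nxt cur par lev 0 0 nxs cnt" and s: "nxs < n" "disc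
    nxs \<noteq> 0"
  shows "flood_inv bs \<psi> z ptr disc front nxt cur par lev 0 0 (Suc nxs) cnt"
    "flood_pot bs ptr disc 0 0 (Suc nxs) < flood_pot bs ptr disc 0 0 nxs"
proof -
  note D = flood_invD[OF inv]
  show "flood_inv bs \<psi> z ptr disc front nxt cur par lev 0 0 (Suc nxs) cnt"
  proof (rule flood_invI)
    show "Suc nxs \<le> n" using s by simp
    fix u assume "u < Suc nxs"
    then show "disc u \<noteq> 0" using D(37) s(2) by (cases "u = nxs") auto
  qed ((rule D; assumption)+)
  show "flood_pot bs ptr disc 0 0 (Suc nxs) < flood_pot bs ptr disc 0 0 nxs"
    using s by (simp add: flood_pot_def)
qed


definition flood_state :: "nat \<Rightarrow> state \<Rightarrow> bool" where
  "flood_state p s \<longleftrightarrow> input_intact s \<and> (\<forall>v<n. arrs s 10 v = coreness G v)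
    \<and> zero_from 20 18 s \<and>
     (\<exists>bs \<psi> z. flood_inv bs \<psi> z (arrs s 6) (arrs s 12) (arrs s 13) (arrs s 14) (arrs s
       15) (arrs s 16)
        (arrs s 17) (regs s 10) (regs s 11) (regs s 12) (regs s 13) \<and>
      p = flood_pot bs (arrs s 6) (arrs s 12) (regs s 10) (regs s 11) (regs s 12))"

lemma flood_stateI:
  assumes "flood_inv bs \<psi> z (arrs s 6) (arrs s 12) (arrs s 13) (arrs s 14) (arrs s 15) (arrs s 16)
        (arrs s 17) (regs s 10) (regs s 11) (regs s 12) (regs s 13) \<and>
      flood_pot bs (arrs s 6) (arrs s 12) (regs s 10) (regs s 11) (regs s 12) < p"
    "input_intact s" "\<forall>v<n. arrs s 10 v = coreness G v" "zero_from 20 18 s"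
  shows "\<exists>q<p. flood_state q s"
  using assms unfolding flood_state_def by blast

lemma flood_step:
  assumes "flood_state p s" "bval (Less (Reg 12) (Reg 0)) s"
  shows "\<exists>q<p. flood_state q (run flood_body s)"
proof -
  from assms(1) obtain bs \<psi> z where
    inv: "flood_inv bs \<psi> z (arrs s 6) (arrs s 12) (arrs s 13) (arrs s 14) (arrs s 15) (arrs s 16)
        (arrs s 17) (regs s 10) (regs s 11) (regs s 12) (regs s 13)"
    and p: "p = flood_pot bs (arrs s 6) (arrs s 12) (regs s 10) (regs s 11) (regs s 12)"
    and frame: "input_intact s" "\<forall>v<n. arrs s 10 v = coreness G v" "zero_from 20 18 s"
    unfolding flood_state_def by blast
  have in0: "arrs s 0 (Suc v) = off (Suc v)" if "v < n" for v
    using frame(1) that by (simp add: input_intact_def)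
  have in1: "arrs s (Suc 0) j = nb j" if "j < off n" for j
    using frame(1) that by (simp add: input_intact_def)
  have cor: "arrs s 10 v = coreness G v" if "v < n" for v using frame(2) that by simp
  have frame': "input_intact s'" "\<forall>v<n. arrs s' 10 v = coreness G v" "zero_from 20 18 s'"
    if "\<And>r. r \<notin> {10..15} \<Longrightarrow> regs s' r = regs s r" "\<And>a. a \<notin> {6, 12,
      13, 14, 15, 16, 17} \<Longrightarrow> arrs s' a = arrs s a" for s'
    using frame that by (auto simp: input_intact_def zero_from_def)
  note D = flood_invD[OF inv]
  show ?thesis
  proof (cases "regs s 11")
    case (Suc w)
    note inv' = inv[unfolded Suc] and wn = D(31)[OF Suc]
    show ?thesis
    proof (cases "regs s 10 < coreness G w")
      case True
      have "run flood_body s = run raise_com (s\<lparr>regs := (regs s)(15 := w)\<rparr>)"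
        using Suc True by (simp add: flood_body_def cor[OF wn])
      then show ?thesis
        using flood_raise[OF inv' True] unfolding p
        by (intro flood_stateI[OF conjI] frame') (simp_all add: raise_com_def Suc, auto)
    next
      case False
      then have "coreness G w \<le> regs s 10" by simp
      have "run flood_body s = run discover_com (s\<lparr>regs := (regs s)(15 := w)\<rparr>)"
        using Suc False by (simp add: flood_body_def cor[OF wn])
      then show ?thesis
        using flood_discover[OF inv' \<open>coreness G w \<le> regs s 10\<close>] unfolding p
        by (intro flood_stateI[OF conjI] frame') (simp_all add: discover_com_def Suc cor[OF wn], auto)
    qed
  next
    case 0
    note inv' = inv[unfolded 0]
    show ?thesis
    proof (cases "arrs s 13 (regs s 10)")
      case (Suc v)
      then obtain vs where vs: "bs (regs s 10) = v # vs"
        using D(3)[of "regs s 10"] linked_Suc by metis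
      then have v: "v \<in> set (bs (regs s 10))" by simp
      have vn: "v < n" using D(5)[OF v] .
      show ?thesis
      proof (cases "arrs s 6 v < off (Suc v)")
        case True
        have j: "arrs s 6 v < off n" using True off_Suc_le[OF vn] by simp
        have "run flood_body s = run scan_com (s\<lparr>regs := (regs s)(14 := v)\<rparr>)"
          using 0 Suc True by (simp add: flood_body_def in0[OF vn])
        then show ?thesis
          using flood_scan[OF inv' v True] unfolding p
          by (intro flood_stateI[OF conjI] frame') (simp_all add: scan_com_def 0 in1[OF j] split:
            if_splits, auto)
      next
        case False
        have "run flood_body s = s\<lparr>regs := (regs s)(14 := v),
            arrs := (arrs s)(13 := (arrs s 13)(regs s 10 := arrs s 14 v))\<rparr>"
          using 0 Suc False by (simp add: flood_body_def in0[OF vn])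
        then show ?thesis
          using flood_pop[OF inv' vs False] unfolding p
          by (intro flood_stateI[OF conjI] frame') (simp_all add: 0, auto)
      qed
    next
      case empty: 0
      then have nil: "bs (regs s 10) = []" using D(3)[of "regs s 10"] linked_0 by simp
      show ?thesis
      proof (cases "regs s 10")
        case (Suc h)
        have "run flood_body s = s\<lparr>regs := (regs s)(10 := h)\<rparr>"
          using 0 empty Suc by (simp add: flood_body_def)
        then show ?thesis
          using flood_lower[OF inv'[unfolded Suc] nil[unfolded Suc]] unfolding p
          by (intro flood_stateI[OF conjI] frame') (simp_all add: 0 Suc, auto)
      next
        case h: 0
        have lt: "regs s 12 < n" using assms(2) frame(1) by (simp add: input_intact_def)
        show ?thesis
        proof (cases "arrs s 12 (regs s 12) = 0")
          case True
          have "run flood_body s = s\<lparr>regs := (regs s)(11 := Suc (regs s 12))\<rparr>"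
            using 0 empty h True by (simp add: flood_body_def)
          then show ?thesis
            using flood_start[OF inv'[unfolded h] lt True] unfolding p
            by (intro flood_stateI[OF conjI] frame') (simp_all add: 0 h, auto)
        next
          case False
          have "run flood_body s = s\<lparr>regs := (regs s)(12 := Suc (regs s 12))\<rparr>"
            using 0 empty h False by (simp add: flood_body_def)
          then show ?thesis
            using flood_advance[OF inv'[unfolded h] lt False] unfolding p
            by (intro flood_stateI[OF conjI] frame') (simp_all add: 0 h, auto)
        qed
      qed
    qed
  qed
qed

text \<open>The vertex 0 serves as an arbitrary \<open>z\<close>. The bound adds \<open>2 m\<close>
  for scanning, \<open>3 n + 4 m\<close> for the weights, as the corenesses sum up to at most
  \<open>2 m\<close>, and \<open>n\<close> for the start vertices.\<close>

lemma flood_start_inv: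
  assumes "\<And>v. v < n \<Longrightarrow> ptr v = off v" "lev n = 0"
  shows "flood_inv (\<lambda>_. []) (\<lambda>i.
    if i < n then Leaf i else Core 0 (verts G)) 0 ptr (\<lambda>_. 0) (\<lambda>_. 0) nxt
      (cur(0 := n)) (par(n := n)) lev 0 0 0 (Suc n)"
    "flood_pot (\<lambda>_. []) ptr (\<lambda>_. 0) 0 0 0 \<le> 6 * card (edges G) + 4 * n"
proof -
  show "flood_inv (\<lambda>_. []) (\<lambda>i.
    if i < n then Leaf i else Core 0 (verts G)) 0 ptr (\<lambda>_. 0) (\<lambda>_. 0) nxt
      (cur(0 := n)) (par(n := n)) lev 0 0 0 (Suc n)"
  proof (rule flood_invI)
    fix i assume "n \<le> i" "i < Suc n"
    then have "i = n" by simp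
    then show "(if i < n then Leaf i else Core 0 (verts G)) \<in> core_nodes G"
      "level G (if i < n then Leaf i else Core 0 (verts G)) = lev i"
      using root_in_core_nodes[OF simple nonempty] assms(2) by simp_all
    show "(l \<le> 0 \<and> i = (cur(0 := n)) l) \<or> (\<forall>x\<in>K. (0::nat) \<noteq> 0)"
      if "(if i < n then Leaf i else Core 0 (verts G)) = Core l K" for l K
      using that \<open>i = n\<close> by simp
  qed (use assms n_pos in \<open>simp_all add: off_mono seen_def core_of_def\<close>)
  have "(\<Sum>v<n. 3 + 2 * coreness G v) \<le> (\<Sum>v<n. 3 + 2 * deg v)"
    by (intro sum_mono) (simp add: coreness_le_deg)
  also have "\<dots> = 3 * n + 2 * (\<Sum>v<n. deg v)" by (simp add: sum.distrib sum_distrib_left)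
  finally show "flood_pot (\<lambda>_. []) ptr (\<lambda>_. 0) 0 0 0 \<le> 6 * card (edges G) + 4 * n"
    using unscanned_init[of ptr] assms(1) sum_deg_le by (simp add: flood_pot_def weight_def)
qed

text \<open>What the contraction knows about the flooding. That the parent of a core has a smaller
  number allows processing the cores in a single increasing pass.\<close>

definition tree_rep :: "(nat \<Rightarrow> nat node) \<Rightarrow> nat \<Rightarrow> (nat \<Rightarrow>
  nat) \<Rightarrow> (nat \<Rightarrow> nat) \<Rightarrow> bool" where
  "tree_rep \<psi> cnt par lev \<longleftrightarrow> n < cnt \<and> (\<forall>v<n. \<psi> v = Leaf v)
    \<and> \<psi> n = Core 0 (verts G) \<and>
     bij_betw \<psi> {n..<cnt} (core_nodes G) \<and>
     (\<forall>i. n < i \<longrightarrow> i < cnt \<longrightarrow> n \<le> par i \<and> par i < i) \<and>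
     (\<forall>i. n \<le> i \<longrightarrow> i < cnt \<longrightarrow> lev i = level G (\<psi> i)) \<and>
     (\<forall>v<n. n \<le> par v \<and> par v < cnt \<and> lev v = coreness G v) \<and>
     (\<forall>i<cnt. i \<noteq> n \<longrightarrow> (\<psi> i, \<psi> (par i)) \<in> unc_parent G)"

definition flood_post :: "state \<Rightarrow> bool" where
  "flood_post s \<longleftrightarrow> regs s 0 = n \<and> zero_from 20 18 s \<and>
     (\<exists>\<psi>. tree_rep \<psi> (regs s 13) (arrs s 16) (arrs s 17))"

text \<open>All vertices are discovered, and every core in the tree is the core of one of its
  vertices; so no core is missing from the numbering.\<close>

lemma flood_done:
  assumes "flood_state p s" "\<not> bval (Less (Reg 12) (Reg 0)) s"
  shows "flood_post s"
proof -
  from assms(1) obtain bs \<psi> z where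
    inv: "flood_inv bs \<psi> z (arrs s 6) (arrs s 12) (arrs s 13) (arrs s 14) (arrs s 15) (arrs s 16)
        (arrs s 17) (regs s 10) (regs s 11) (regs s 12) (regs s 13)"
    and frame: "input_intact s" "zero_from 20 18 s"
    unfolding flood_state_def by blast
  note D = flood_invD[OF inv]
  have n: "regs s 0 = n" using frame by (simp add: input_intact_def)
  then have disc: "arrs s 12 v \<noteq> 0" if "v < n" for v using D(37) that assms(2) by simp
  have "core_nodes G \<subseteq> \<psi> ` {n..<regs s 13}"
  proof
    fix x assume "x \<in> core_nodes G"
    then obtain k v where x: "x = Core k (core_of G k v)" "v \<in> core_verts G k"
      by (auto simp: core_nodes_eq[OF simple nonempty])
    have v: "v < n" using core_verts_less[OF x(2)] .
    obtain i where "n \<le> i" "i < regs s 13" "\<psi> i = x"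
      using D(35)[OF v disc[OF v], of k] x le_coreness[OF v, of k] by auto
    then show "x \<in> \<psi> ` {n..<regs s 13}" by auto
  qed
  moreover have "\<psi> ` {n..<regs s 13} \<subseteq> core_nodes G" using D(14) by auto
  ultimately have "bij_betw \<psi> {n..<regs s 13} (core_nodes G)"
    using D(16) by (simp add: bij_betw_def)
  moreover have "(\<psi> i, \<psi> (arrs s 16 i)) \<in> unc_parent G" if "i < regs s 13" "i \<noteq> n" for i
    using D(12)[of i] D(19)[of i] D(22)[of i] disc[of i] that by (cases "i < n") simp_all
  ultimately have "tree_rep \<psi> (regs s 13) (arrs s 16) (arrs s 17)"
    unfolding tree_rep_def using D(11-13,15,17,18,20,21,23) disc by simp
  then show ?thesis using n frame unfolding flood_post_def by blast
qed

lemma runs_flood: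
  assumes "peel_post s"
  shows "runs flood_prog s (flood_time * (n + card (edges G))) flood_post"
proof -
  let ?m = "card (edges G)"
  let ?P = "6 * ?m + 4 * n"
  let ?K = "1 + bcost (Less (Reg 12) (Reg 0)) + cost flood_body"
  let ?Q = "\<lambda>s. \<exists>p \<le> ?P. flood_state p s"
  have post: "input_intact s" "\<forall>v<n. arrs s 6 v = off v" "zero_from 10 12 s" "\<forall>v<n. arrs s
    10 v = coreness G v"
    using assms by (simp_all add: peel_post_def)
  let ?s = "run flood_init s"
  have z: "regs s r = 0" if "r \<ge> 10" for r using post(3) that by (simp add: zero_from_def)
  have za: "arrs s a = (\<lambda>_. 0)" if "a \<ge> 12" for a using post(3) that by (auto simp: zero_from_def)
  have "flood_inv (\<lambda>_. []) (\<lambda>i.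
    if i < n then Leaf i else Core 0 (verts G)) 0 (arrs s 6) (\<lambda>_. 0) (\<lambda>_. 0)
      (arrs s 14) ((arrs s 15)(0 := n)) ((arrs s 16)(n := n)) (arrs s 17) 0 0 0 (Suc n)"
    by (rule flood_start_inv) (use post za in simp_all)
  moreover have "input_intact ?s" "\<forall>v<n. arrs ?s 10 v = coreness G v" "zero_from 20 18 ?s"
    using post by (auto simp: input_intact_def zero_from_def flood_init_def)
  ultimately have "?Q ?s"
    using flood_start_inv(2)[of "arrs s 6" "arrs s 17"] post z za unfolding flood_state_def
    by (intro exI[of _ "flood_pot (\<lambda>_. []) (arrs s 6) (\<lambda>_. 0) 0 0 0"] conjI exI[of _
      "\<lambda>_. []"]
        exI[of _ "\<lambda>i. if i < n then Leaf i else Core 0 (verts G)"] exI[of _ 0])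
      (simp_all add: flood_init_def input_intact_def)
  then have init: "runs flood_init s (cost flood_init) ?Q"
    by (intro runs_loop_free) (simp_all add: flood_init_def)
  have loop: "runs (While (Less (Reg 12) (Reg 0)) flood_body) s (Suc ?P * ?K) flood_post"
    if "?Q s" for s
  proof -
    from that obtain p where p: "p \<le> ?P" "flood_state p s" by blast
    show ?thesis
    proof (rule runs_weaken[OF runs_While[OF _ p(2) flood_step]])
      show "Suc p * ?K \<le> Suc ?P * ?K" using p(1) by (intro mult_le_mono1) simp
      fix s' assume "(\<exists>q. flood_state q s') \<and> \<not> bval (Less (Reg 12) (Reg 0)) s'"
      then show "flood_post s'" using flood_done by blast
    qed (simp_all add: flood_body_def raise_com_def discover_com_def scan_com_def)
  qed
  note * = runs_Seq[OF init loop]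
  show ?thesis
    unfolding flood_prog_def
  proof (rule runs_weaken[OF *])
    have "Suc ?P * ?K \<le> (7 * (n + ?m)) * ?K"
      by (rule mult_le_mono1) (use n_pos in simp)
    moreover have "cost flood_init \<le> cost flood_init * (n + ?m)" using n_pos by simp
    ultimately have "cost flood_init + Suc ?P * ?K \<le> cost flood_init * (n + ?m) + (7 * (n + ?m)) * ?K"
      by (intro add_mono)
    also have "\<dots> = flood_time * (n + ?m)"
    proof -
      have "a * N + (7 * N) * b = (a + 7 * b) * N" for N a b :: nat by (simp add: algebra_simps)
      then show ?thesis unfolding flood_time_def .
    qed
    finally show "cost flood_init + Suc ?P * ?K \<le> flood_time * (n + ?m)" .
  qed
qed

end

section \<open>Contracting the chains\<close>

text \<open>Array 18: numbers of children; array 19: number of the contracted node that contains a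
  core.\<close>

definition count_body :: com where
  "count_body =
     Seq (If (Not (And (Not (Less (Reg 20) (Reg 0))) (Not (Less (Reg 0) (Reg 20)))))
           (Write 18 (Read 16 (Reg 20)) (Succ (Read 18 (Read 16 (Reg 20))))) Skip)
         (Assign 20 (Succ (Reg 20)))"

definition contract_init :: com where
  "contract_init =
     Seq (Write 19 (Reg 0) (Reg 0))
    (Seq (Write 2 (Reg 0) (Reg 0))
    (Seq (Write 3 (Reg 0) (Const 0))
    (Seq (Write 4 (Reg 0) (Const 0))
    (Seq (Assign 1 (Succ (Reg 0)))
         (Assign 21 (Succ (Reg 0)))))))"

text \<open>Children are counted including leaves, so a core merges with its parent only if it is
  the sole child of any kind. Only the upper label can change in a merge, as levels grow
  downwards.\<close>

definition contract_body :: com where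
  "contract_body =
     Seq (Assign 22 (Read 19 (Read 16 (Reg 21))))
    (Seq (If (Less (Read 18 (Read 16 (Reg 21))) (Const 2))
           (Seq (Write 19 (Reg 21) (Reg 22))
             (If (Less (Read 4 (Reg 22)) (Read 17 (Reg 21)))
               (Write 4 (Reg 22) (Read 17 (Reg 21))) Skip))
           (Seq (Write 19 (Reg 21) (Reg 1))
           (Seq (Write 2 (Reg 1) (Reg 22))
           (Seq (Write 3 (Reg 1) (Read 17 (Reg 21)))
           (Seq (Write 4 (Reg 1) (Read 17 (Reg 21)))
                (Assign 1 (Succ (Reg 1))))))))
         (Assign 21 (Succ (Reg 21))))"

definition leaf_body :: com where
  "leaf_body =
     Seq (Write 2 (Reg 23) (Read 19 (Read 16 (Reg 23))))
    (Seq (Write 3 (Reg 23) (Read 17 (Reg 23)))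
    (Seq (Write 4 (Reg 23) (Read 17 (Reg 23)))
         (Assign 23 (Succ (Reg 23)))))"

section \<open>Assigning contracted nodes to the cores\<close>

locale uncontracted_tree = input_graph +
  fixes \<psi> :: "nat \<Rightarrow> nat node" and cnt :: nat and par lev :: "nat \<Rightarrow> nat"
  assumes tree_rep: "tree_rep \<psi> cnt par lev"
begin

lemma n_less_cnt: "n < cnt"
  and \<psi>_leaf: "v < n \<Longrightarrow> \<psi> v = Leaf v"
  and \<psi>_root: "\<psi> n = Core 0 (verts G)"
  and \<psi>_bij: "bij_betw \<psi> {n..<cnt} (core_nodes G)"
  and par_core: "n < i \<Longrightarrow> i < cnt \<Longrightarrow> n \<le> par i" "n < i \<Longrightarrow>
    i < cnt \<Longrightarrow> par i < i"
  and lev_core: "n \<le> i \<Longrightarrow> i < cnt \<Longrightarrow> lev i = level G (\<psi> i)"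
  and par_leaf: "v < n \<Longrightarrow> n \<le> par v" "v < n \<Longrightarrow> par v < cnt"
  and lev_leaf: "v < n \<Longrightarrow> lev v = coreness G v"
  and par_parent: "i < cnt \<Longrightarrow> i \<noteq> n \<Longrightarrow> (\<psi> i, \<psi> (par i))
    \<in> unc_parent G"
  using tree_rep unfolding tree_rep_def by simp_all

lemma \<psi>_core: "n \<le> i \<Longrightarrow> i < cnt \<Longrightarrow> \<psi> i \<in> core_nodes G"
  using \<psi>_bij by (auto simp: bij_betw_def)

lemma core_nodesE:
  assumes "x \<in> core_nodes G" obtains i where "n \<le> i" "i < cnt" "x = \<psi> i"
proof -
  have "x \<in> \<psi> ` {n..<cnt}" using assms \<psi>_bij by (simp add: bij_betw_def)
  then show thesis using that by auto
qed

lemma par_range: "i < cnt \<Longrightarrow> i \<noteq> n \<Longrightarrow> n \<le> par i \<and> par i < cnt"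
  using par_core[of i] par_leaf[of i] by (cases "i < n") auto

lemma \<psi>_inj: "i < cnt \<Longrightarrow> j < cnt \<Longrightarrow> \<psi> i = \<psi> j
  \<Longrightarrow> i = j"
proof (cases "i < n"; cases "j < n")
  assume ij: "i < cnt" "j < cnt" "\<psi> i = \<psi> j"
  show ?thesis if "i < n" "j < n" using ij that by (simp add: \<psi>_leaf)
  show ?thesis if "i < n" "\<not> j < n" using ij that \<psi>_core[of j] \<psi>_leaf[of i]
    by (auto simp: core_nodes_def)
  show ?thesis if "\<not> i < n" "j < n" using ij that \<psi>_core[of i] \<psi>_leaf[of j]
    by (auto simp: core_nodes_def)
  show ?thesis if "\<not> i < n" "\<not> j < n"
    using ij that \<psi>_bij inj_onD[of \<psi> "{n..<cnt}" i j] by (simp add: bij_betw_def)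
qed

lemma \<psi>_surj:
  assumes "(x, y) \<in> unc_parent G" obtains j where "j < cnt" "j \<noteq> n" "x = \<psi> j"
proof -
  from simple assms have "\<exists>j<cnt. x = \<psi> j"
  proof (cases rule: unc_parent_cases)
    case (Leaf u)
    then show ?thesis using \<psi>_leaf[of u] n_less_cnt by (intro exI[of _ u]) (simp add: in_verts_iff)
  next
    case (Core k v)
    then have "x \<in> core_nodes G" using Core_in_core_nodes[OF simple] by simp
    then show ?thesis by (rule core_nodesE) auto
  qed
  moreover have "x \<noteq> \<psi> n" using assms root_no_parent \<psi>_root by auto
  ultimately show thesis using that by auto
qed

lemma parent_iff: "j < cnt \<Longrightarrow> j \<noteq> n \<Longrightarrow> (\<psi> j, y) \<in> unc_parent
  G \<longleftrightarrow> y = \<psi> (par j)"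
  using par_parent[of j] unc_parent_unique[OF simple] by blast

definition kids :: "nat \<Rightarrow> nat set" where
  "kids p = {j. j < cnt \<and> j \<noteq> n \<and> par j = p}"

lemma finite_kids: "finite (kids p)"
  unfolding kids_def by (rule finite_subset[of _ "{..<cnt}"]) auto

lemma unc_children_\<psi>:
  assumes "n \<le> p" "p < cnt"
  shows "unc_children G (\<psi> p) = \<psi> ` kids p"
proof
  show "unc_children G (\<psi> p) \<subseteq> \<psi> ` kids p"
  proof
    fix x assume "x \<in> unc_children G (\<psi> p)"
    then have x: "(x, \<psi> p) \<in> unc_parent G" by (simp add: unc_children_def)
    then obtain j where j: "j < cnt" "j \<noteq> n" "x = \<psi> j" by (rule \<psi>_surj)
    then have "\<psi> p = \<psi> (par j)" using x parent_iff by simp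
    then have "p = par j" using \<psi>_inj[OF assms(2)] par_range[OF j(1,2)] by simp
    then show "x \<in> \<psi> ` kids p" using j by (simp add: kids_def)
  qed
  show "\<psi> ` kids p \<subseteq> unc_children G (\<psi> p)"
    using par_parent by (auto simp: kids_def unc_children_def)
qed

lemma kids_single:
  assumes "j < cnt" "j \<noteq> n" "card (kids (par j)) < 2"
  shows "kids (par j) = {j}"
proof -
  have "j \<in> kids (par j)" using assms by (simp add: kids_def)
  then show ?thesis
    using assms(3) finite_kids[of "par j"]
      by (metis One_nat_def card_1_singletonE card_gt_0_iff emptyE less_2_cases less_not_refl singletonD)
qed

text \<open>The cores that begin a maximal chain; each of them opens a contracted node of its
  own.\<close>

definition topmost :: "nat \<Rightarrow> bool" where
  "topmost i \<longleftrightarrow> i = n \<or> 2 \<le> card (kids (par i))"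

text \<open>Translates the link condition of chains into the test on child counts made by the
  program.\<close>

lemma unc_children_single_iff:
  assumes "n \<le> p" "p < cnt" "n \<le> j" "j < cnt"
  shows "unc_children G (\<psi> p) = {\<psi> j} \<longleftrightarrow> j \<noteq> n \<and> par j = p \<and>
    \<not> topmost j"
proof
  assume *: "unc_children G (\<psi> p) = {\<psi> j}"
  then have k: "\<psi> ` kids p = {\<psi> j}" using unc_children_\<psi>[OF assms(1,2)] by simp
  have "kids p \<subseteq> {j}"
  proof
    fix i assume i: "i \<in> kids p"
    then have "\<psi> i = \<psi> j" using k by blast
    then show "i \<in> {j}" using \<psi>_inj[of i j] assms(4) i by (simp add: kids_def)
  qed
  moreover have "kids p \<noteq> {}" using k by auto
  ultimately have "kids p = {j}" by blast
  then have "j \<in> kids p" "card (kids p) = 1" by simp_all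
  then show "j \<noteq> n \<and> par j = p \<and> \<not> topmost j" by (auto simp: kids_def topmost_def)
next
  assume "j \<noteq> n \<and> par j = p \<and> \<not> topmost j"
  then have "kids p = {j}" using kids_single[OF assms(4)] by (auto simp: topmost_def)
  then show "unc_children G (\<psi> p) = {\<psi> j}" using unc_children_\<psi>[OF assms(1,2)] by simp
qed

text \<open>The state after the cores numbered below \<open>I\<close>: \<open>rep\<close> assigns
  contracted nodes to cores, while \<open>up\<close>, \<open>lo\<close> and \<open>hi\<close> are
  the output arrays of parents and labels. Topmost cores correspond to the contracted nodes created
  so far; \<open>hi\<close> has to be both an upper bound and attained.\<close>

definition contracted :: "nat \<Rightarrow> nat \<Rightarrow> (nat \<Rightarrow> nat) \<Rightarrow> (nat
  \<Rightarrow> nat) \<Rightarrow> (nat \<Rightarrow> nat) \<Rightarrow> (nat \<Rightarrow> nat)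
    \<Rightarrow> bool" where
  "contracted I N rep up lo hi \<longleftrightarrow>
     n < I \<and> I \<le> cnt \<and> n < N \<and> rep n = n \<and> up n = n \<and> lo n = 0 \<and>
     (\<forall>i. n \<le> i \<longrightarrow> i < I \<longrightarrow> n \<le> rep i \<and> rep i < N) \<and>
     (\<forall>i. n < i \<longrightarrow> i < I \<longrightarrow> \<not> topmost i \<longrightarrow> rep i
       = rep (par i)) \<and>
     (\<forall>i. n < i \<longrightarrow> i < I \<longrightarrow> topmost i \<longrightarrow> up (rep i) =
       rep (par i) \<and> lo (rep i) = lev i) \<and>
     bij_betw rep {i. n \<le> i \<and> i < I \<and> topmost i} {n..<N} \<and>
     (\<forall>i. n \<le> i \<longrightarrow> i < I \<longrightarrow> lo (rep i) \<le> lev i \<and> lev i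
       \<le> hi (rep i)) \<and>
     (\<forall>c. n \<le> c \<longrightarrow> c < N \<longrightarrow> (\<exists>i. n \<le> i \<and> i < I
       \<and> rep i = c \<and> lev i = hi c))"

lemma contractedD:
  assumes "contracted I N rep up lo hi"
  shows "n < I" "I \<le> cnt" "n < N" "rep n = n" "up n = n" "lo n = 0"
    "\<And>i. n \<le> i \<Longrightarrow> i < I \<Longrightarrow> n \<le> rep i" "\<And>i. n \<le> i
      \<Longrightarrow> i < I \<Longrightarrow> rep i < N"
    "\<And>i. n < i \<Longrightarrow> i < I \<Longrightarrow> \<not> topmost i \<Longrightarrow> rep i =
      rep (par i)"
    "\<And>i. n < i \<Longrightarrow> i < I \<Longrightarrow> topmost i \<Longrightarrow> up (rep i) = rep
      (par i)"
    "\<And>i. n < i \<Longrightarrow> i < I \<Longrightarrow> topmost i \<Longrightarrow> lo (rep i) = lev i"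
    "bij_betw rep {i. n \<le> i \<and> i < I \<and> topmost i} {n..<N}"
    "\<And>i. n \<le> i \<Longrightarrow> i < I \<Longrightarrow> lo (rep i) \<le> lev i" "\<And>i. n \<le>
      i \<Longrightarrow> i < I \<Longrightarrow> lev i \<le> hi (rep i)"
    "\<And>c. n \<le> c \<Longrightarrow> c < N \<Longrightarrow> \<exists>i. n \<le> i \<and> i < I \<and>
      rep i = c \<and> lev i = hi c"
  using assms unfolding contracted_def by simp_all

lemma contractedI:
  assumes "n < I" "I \<le> cnt" "n < N" "rep n = n" "up n = n" "lo n = 0"
    "\<And>i. n \<le> i \<Longrightarrow> i < I \<Longrightarrow> n \<le> rep i" "\<And>i. n \<le> i
      \<Longrightarrow> i < I \<Longrightarrow> rep i < N"
    "\<And>i. n < i \<Longrightarrow> i < I \<Longrightarrow> \<not> topmost i \<Longrightarrow> rep i =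
      rep (par i)"
    "\<And>i. n < i \<Longrightarrow> i < I \<Longrightarrow> topmost i \<Longrightarrow> up (rep i) = rep
      (par i)"
    "\<And>i. n < i \<Longrightarrow> i < I \<Longrightarrow> topmost i \<Longrightarrow> lo (rep i) = lev i"
    "bij_betw rep {i. n \<le> i \<and> i < I \<and> topmost i} {n..<N}"
    "\<And>i. n \<le> i \<Longrightarrow> i < I \<Longrightarrow> lo (rep i) \<le> lev i" "\<And>i. n \<le>
      i \<Longrightarrow> i < I \<Longrightarrow> lev i \<le> hi (rep i)"
    "\<And>c. n \<le> c \<Longrightarrow> c < N \<Longrightarrow> \<exists>i. n \<le> i \<and> i < I \<and>
      rep i = c \<and> lev i = hi c"
  shows "contracted I N rep up lo hi"
  using assms unfolding contracted_def by simp

lemma contracted_start: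
  assumes "rep n = n" "up n = n" "lo n = 0" "hi n = 0"
  shows "contracted (Suc n) (Suc n) rep up lo hi"
proof -
  have lev: "lev n = 0" using lev_core[of n] n_less_cnt by (simp add: \<psi>_root)
  have tops: "{i. n \<le> i \<and> i < Suc n \<and> topmost i} = {n}" "{n..<Suc n} = {n}"
    by (auto simp: topmost_def)
  show ?thesis
  proof (rule contractedI)
    show "bij_betw rep {i. n \<le> i \<and> i < Suc n \<and> topmost i} {n..<Suc n}"
      unfolding tops using assms(1) by (simp add: bij_betw_def)
    fix i assume "n \<le> i" "i < Suc n"
    then have "i = n" by simp
    then show "n \<le> rep i" "rep i < Suc n" "lo (rep i) \<le> lev i" "lev i \<le> hi (rep i)"
      using assms lev by simp_all
  next
    fix c assume "n \<le> c" "c < Suc n"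
    then have "c = n" by simp
    then show "\<exists>i. n \<le> i \<and> i < Suc n \<and> rep i = c \<and> lev i = hi c"
      using assms lev by (intro exI[of _ n]) simp
  qed (use assms n_less_cnt in simp_all)
qed

lemma lev_par: "n < i \<Longrightarrow> i < cnt \<Longrightarrow> lev (par i) \<le> lev i"
proof -
  assume i: "n < i" "i < cnt"
  have "(\<psi> i, \<psi> (par i)) \<in> unc_parent G" using par_parent i by simp
  with simple have "level G (\<psi> (par i)) \<le> level G (\<psi> i)"
    by (cases rule: unc_parent_cases) simp_all
  then show ?thesis using lev_core[of i] lev_core[of "par i"] par_core[of i] i by simp
qed

text \<open>The core \<open>I\<close> is not topmost and joins the class of its parent. Its level is
  at least that of the parent, so the lower label stays valid.\<close>

lemma contracted_merge:
  assumes C: "contracted I N rep up lo hi" and I: "I < cnt" "card (kids (par I)) < 2"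
  shows "contracted (Suc I) N (rep(I := rep (par I))) up lo (hi(rep (par I) := max (hi (rep (par I))) (lev
    I)))"
    (is "contracted _ _ ?rep _ _ ?hi")
proof -
  note D = contractedD[OF C]
  have p: "n \<le> par I" "par I < I" using par_core D(1) I by simp_all
  have nt: "\<not> topmost I" using I D(1) by (simp add: topmost_def)
  \<comment> \<open>Parents precede their children, so assigning a class to \<open>I\<close> affects
    no parent of the cores treated so far.\<close>
  have par: "par i \<noteq> I" if "n < i" "i < Suc I" for i using par_core(2)[of i] that I by auto
  have tops: "{i. n \<le> i \<and> i < Suc I \<and> topmost i} = {i. n \<le> i \<and> i < I \<and> topmost i}"
    using nt by (auto simp: less_Suc_eq)
  show ?thesis
  proof (rule contractedI)
    show "bij_betw ?rep {i. n \<le> i \<and> i < Suc I \<and> topmost i} {n..<N}"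
      unfolding tops using D(12) by (rule bij_betw_cong[THEN iffD1, rotated]) auto
    fix i assume i: "n < i" "i < Suc I"
    show "?rep i = ?rep (par i)" if "\<not> topmost i" using D(9)[of i] that i par[OF i]
      by (cases "i = I") auto
    show "up (?rep i) = ?rep (par i)" "lo (?rep i) = lev i" if "topmost i"
      using D(10,11)[of i] that i par[OF i] nt by (cases "i = I"; simp)+
  next
    fix i assume i: "n \<le> i" "i < Suc I"
    show "n \<le> ?rep i" "?rep i < N" "lo (?rep i) \<le> lev i" "lev i \<le> ?hi (?rep i)"
      using D(7,8,13,14)[of i] D(7,8,13)[OF p] lev_par[OF D(1) I(1)] i
      by (cases "i = I"; auto simp: le_max_iff_disj)+
  next
    fix c assume c: "n \<le> c" "c < N"
    obtain i where i: "n \<le> i" "i < I" "rep i = c" "lev i = hi c" using D(15)[OF c] by auto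
    show "\<exists>i. n \<le> i \<and> i < Suc I \<and> ?rep i = c \<and> lev i = ?hi c"
    proof (cases "c = rep (par I) \<and> hi c < lev I")
      case True
      then show ?thesis using D(1) by (intro exI[of _ I]) auto
    next
      case False
      then show ?thesis using i by (intro exI[of _ i]) auto
    qed
  qed (use D(1-6) I in auto)
qed

lemma contracted_new:
  assumes C: "contracted I N rep up lo hi" and I: "I < cnt" "2 \<le> card (kids (par I))"
  shows "contracted (Suc I) (Suc N) (rep(I := N)) (up(N := rep (par I))) (lo(N := lev I)) (hi(N := lev I))"
    (is "contracted _ _ ?rep ?up ?lo ?hi")
proof -
  note D = contractedD[OF C]
  have p: "n \<le> par I" "par I < I" using par_core D(1) I by simp_all
  have t: "topmost I" using I by (simp add: topmost_def)
  have par: "par i \<noteq> I" if "n < i" "i < Suc I" for i using par_core(2)[of i] that I by auto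
  have rep: "rep i \<noteq> N" if "n \<le> i" "i < I" for i using D(8)[OF that] by simp
  have tops: "{i. n \<le> i \<and> i < Suc I \<and> topmost i} = insert I {i. n \<le> i \<and> i < I \<and>
    topmost i}"
    using t D(1) by (auto simp: less_Suc_eq)
  show ?thesis
  proof (rule contractedI)
    have "bij_betw ?rep {i. n \<le> i \<and> i < I \<and> topmost i} {n..<N}"
      using D(12) by (rule bij_betw_cong[THEN iffD1, rotated]) auto
    then have "bij_betw ?rep ({i. n \<le> i \<and> i < I \<and> topmost i} \<union> {I}) ({n..<N} \<union>
      {N})"
      by (rule bij_betw_combine) (auto simp: bij_betw_def)
    then show "bij_betw ?rep {i. n \<le> i \<and> i < Suc I \<and> topmost i} {n..<Suc N}"
      unfolding tops using D(3) by (simp add: atLeastLessThanSuc)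
    fix i assume i: "n < i" "i < Suc I"
    have pi: "n \<le> par i" "par i < i" using par_core[of i] i I by simp_all
    show "?rep i = ?rep (par i)" if "\<not> topmost i" using D(9)[of i] that i par[OF i] t
      by (cases "i = I") auto
    show "?up (?rep i) = ?rep (par i)" "?lo (?rep i) = lev i" if "topmost i"
      using D(10,11)[of i] that i par[OF i] rep[of i] by (cases "i = I"; simp)+
  next
    fix i assume i: "n \<le> i" "i < Suc I"
    show "n \<le> ?rep i" "?rep i < Suc N" "?lo (?rep i) \<le> lev i" "lev i \<le> ?hi (?rep i)"
      using D(7,8,13,14)[of i] D(3) i rep[of i] by (cases "i = I"; auto)+
  next
    fix c assume c: "n \<le> c" "c < Suc N"
    show "\<exists>i. n \<le> i \<and> i < Suc I \<and> ?rep i = c \<and> lev i = ?hi c"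
    proof (cases "c = N")
      case True
      then show ?thesis using D(1) by (intro exI[of _ I]) simp
    next
      case False
      then obtain i where "n \<le> i" "i < I" "rep i = c" "lev i = hi c" using D(15)[of c] c by auto
      then show ?thesis using False by (intro exI[of _ i]) auto
    qed
  qed (use D(1-6) I in auto)
qed

text \<open>Classes of cores have numbers from \<open>n\<close> on, so filling in the entry of a
  leaf does not disturb them.\<close>

lemma contracted_leaf:
  assumes C: "contracted I N rep up lo hi" and v: "v < n"
  shows "contracted I N rep (up(v := a)) (lo(v := b)) (hi(v := d))"
proof -
  note D = contractedD[OF C]
  have rep: "rep i \<noteq> v" if "n \<le> i" "i < I" for i using D(7)[OF that] v by simp
  show ?thesis
  proof (rule contractedI)
    fix c assume "n \<le> c" "c < N"
    then show "\<exists>i. n \<le> i \<and> i < I \<and> rep i = c \<and> lev i = (hi(v := d)) c"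
      using D(15)[of c] v by auto
  next
    fix i assume i: "n < i" "i < I"
    show "topmost i \<Longrightarrow> (up(v := a)) (rep i) = rep (par i)" "topmost i \<Longrightarrow>
      (lo(v := b)) (rep i) = lev i"
      using D(10,11)[OF i] rep[of i] i by simp_all
    show "\<not> topmost i \<Longrightarrow> rep i = rep (par i)" using D(9)[OF i] .
  next
    fix i assume i: "n \<le> i" "i < I"
    show "(lo(v := b)) (rep i) \<le> lev i" "lev i \<le> (hi(v := d)) (rep i)"
      using D(13,14)[OF i] rep[OF i] by simp_all
  qed (use D(1-8,12) v in auto)
qed

end

section \<open>The computed arrays represent the core-connectivity tree\<close>

locale contracted_tree = uncontracted_tree +
  fixes N :: nat and rep up lo hi :: "nat \<Rightarrow> nat"
  assumes contracted: "contracted cnt N rep up lo hi"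
    and leaves: "v < n \<Longrightarrow> up v = rep (par v) \<and> lo v = lev v \<and> hi v = lev v"
begin

lemmas C = contractedD[OF contracted]

text \<open>The numbering of contracted nodes whose existence \<open>represents_cct\<close> asks
  for.\<close>

definition cls :: "nat \<Rightarrow> nat node set" where
  "cls c = (if c < n then {Leaf c} else \<psi> ` {i. n \<le> i \<and> i < cnt \<and> rep i = c})"

text \<open>Inverse to \<open>cls\<close>: the contracted node of an uncontracted one, treating
  leaves and cores uniformly.\<close>

definition home :: "nat \<Rightarrow> nat" where
  "home i = (if i < n then i else rep i)"

lemma home_less: "i < cnt \<Longrightarrow> home i < N"
  using C(3) C(8)[of i] by (simp add: home_def)

lemma in_cls_iff:
  assumes "i < cnt"
  shows "\<psi> i \<in> cls c \<longleftrightarrow> home i = c"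
proof (cases "c < n")
  case True
  then have "\<psi> i \<in> cls c \<longleftrightarrow> \<psi> i = \<psi> c"
    by (simp add: cls_def \<psi>_leaf)
  also have "\<dots> \<longleftrightarrow> i = c" using \<psi>_inj[OF assms, of c] True n_less_cnt by auto
  also have "\<dots> \<longleftrightarrow> home i = c" using True C(7)[of i] assms by (auto simp: home_def)
  finally show ?thesis .
next
  case False
  have "\<psi> i \<in> cls c \<longleftrightarrow> n \<le> i \<and> rep i = c"
    using False \<psi>_inj[OF assms] assms by (auto simp: cls_def)
  then show ?thesis using False by (auto simp: home_def)
qed

lemma cls_elem:
  assumes "x \<in> cls c" "c < N" obtains i where "i < cnt" "x = \<psi> i" "home i = c"
proof (cases "c < n")
  case True
  then show ?thesis using that[of c] assms n_less_cnt by (simp add: cls_def \<psi>_leaf home_def)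
next
  case False
  then show ?thesis using that assms by (auto simp: cls_def home_def)
qed

lemma top_exists: "n \<le> i \<Longrightarrow> i < cnt \<Longrightarrow> \<exists>t. n \<le> t \<and> t
  \<le> i \<and> topmost t \<and> rep t = rep i"
proof (induction i rule: less_induct)
  case (less i)
  show ?case
  proof (cases "topmost i")
    case False
    then have i: "n < i" using less.prems by (auto simp: topmost_def le_less)
    then have p: "n \<le> par i" "par i < i" using par_core less.prems by auto
    obtain t where "n \<le> t" "t \<le> par i" "topmost t" "rep t = rep (par i)"
      using less.IH[OF p(2,1)] p less.prems by auto
    then show ?thesis using p C(9)[OF i less.prems(2) False] by (intro exI[of _ t]) simp
  qed (use less.prems in blast)
qed

lemma top_unique:
  "topmost t \<Longrightarrow> topmost u \<Longrightarrow> n \<le> t \<Longrightarrow> t < cnt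
    \<Longrightarrow> n \<le> u \<Longrightarrow> u < cnt \<Longrightarrow> rep t = rep u \<Longrightarrow>
      t = u"
  using C(12) inj_onD[of rep "{i. n \<le> i \<and> i < cnt \<and> topmost i}" t u] by (simp add: bij_betw_def)

lemma top_of:
  assumes "n \<le> c" "c < N" obtains t where "n \<le> t" "t < cnt" "topmost t" "rep t = c"
proof -
  have "c \<in> rep ` {i. n \<le> i \<and> i < cnt \<and> topmost i}" using C(12) assms
    by (simp add: bij_betw_def)
  then show thesis using that by auto
qed

lemma rep_child:
  assumes "x \<in> core_nodes G" "y \<in> core_nodes G" "unc_children G x = {y}"
  obtains p j where "n \<le> p" "p < cnt" "n < j" "j < cnt" "x = \<psi> p" "y = \<psi> j" "p = par j"
    "\<not> topmost j"
    "rep j = rep p"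
proof -
  obtain p where p: "n \<le> p" "p < cnt" "x = \<psi> p" using assms(1) by (rule core_nodesE)
  obtain j where j: "n \<le> j" "j < cnt" "y = \<psi> j" using assms(2) by (rule core_nodesE)
  have *: "j \<noteq> n \<and> par j = p \<and> \<not> topmost j"
    using unc_children_single_iff[OF p(1,2) j(1,2)] assms(3) p j by simp
  then have "n < j" using j(1) by simp
  have "rep j = rep p" using C(9)[OF \<open>n < j\<close> j(2)] * by simp
  then show thesis using that[OF p(1,2) \<open>n < j\<close> j(2) p(3) j(3)] * by blast
qed

text \<open>Classes are closed under only-child links in both directions, so a chain cannot leave
  the class in which it has a node.\<close>

lemma chain_subset_cls:
  assumes "chain G xs" "n \<le> i" "i < cnt" "\<psi> i \<in> set xs"
  shows "set xs \<subseteq> cls (rep i)"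
  using assms(1,4)
proof (rule chain_within)
  show "\<psi> i \<in> cls (rep i)" using in_cls_iff[OF assms(3)] assms(2) by (simp add: home_def)
next
  fix x y assume *: "x \<in> cls (rep i)" "x \<in> core_nodes G" "unc_children G x = {y}" "y \<in>
    core_nodes G"
  obtain p j where "n \<le> p" "p < cnt" "n < j" "j < cnt" "x = \<psi> p" "y = \<psi> j" "rep j = rep p"
    using rep_child[OF *(2,4,3)] by metis
  then show "y \<in> cls (rep i)" using in_cls_iff[of p] in_cls_iff[of j] *(1) by (simp add: home_def)
next
  fix x y assume *: "y \<in> cls (rep i)" "x \<in> core_nodes G" "unc_children G x = {y}" "y \<in>
    core_nodes G"
  obtain p j where "n \<le> p" "p < cnt" "n < j" "j < cnt" "x = \<psi> p" "y = \<psi> j" "rep j = rep p"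
    using rep_child[OF *(2,4,3)] by metis
  then show "x \<in> cls (rep i)" using in_cls_iff[of p] in_cls_iff[of j] *(1) by (simp add: home_def)
qed

text \<open>Climb from \<open>i\<close> to \<open>t\<close>: every core on the way is an only child,
  and a maximal chain contains both ends of such a link or neither.\<close>

lemma maximal_chain_top:
  assumes "maximal_chain G xs" "topmost t" "n \<le> t" "t < cnt" "n \<le> i" "i < cnt" "rep i = rep t"
  shows "\<psi> i \<in> set xs \<longleftrightarrow> \<psi> t \<in> set xs"
  using assms(5-7)
proof (induction i rule: less_induct)
  case (less i)
  show ?case
  proof (cases "topmost i")
    case True
    then show ?thesis using top_unique[OF True assms(2)] less.prems assms(3,4) by simp
  next
    case False
    then have i: "n < i" using less.prems by (auto simp: topmost_def le_less)
    then have p: "n \<le> par i" "par i < i" using par_core less.prems by auto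
    have ch: "unc_children G (\<psi> (par i)) = {\<psi> i}"
      using unc_children_single_iff[of "par i" i] p less.prems i False by simp
    have core: "\<psi> (par i) \<in> core_nodes G" "\<psi> i \<in> core_nodes G"
      using \<psi>_core[of i] \<psi>_core[of "par i"] p less.prems by simp_all
    have "\<psi> i \<in> set xs \<longleftrightarrow> \<psi> (par i) \<in> set xs"
      using maximal_chain_down[OF assms(1) _ ch core(2)] maximal_chain_up[OF simple assms(1) _ ch core(1)]
        by blast
    also have "\<dots> \<longleftrightarrow> \<psi> t \<in> set xs"
      using less.IH[OF p(2,1)] p less.prems C(9)[OF i less.prems(2) False] by simp
    finally show ?thesis .
  qed
qed

lemma maximal_chain_eq_cls:
  assumes "maximal_chain G xs" "n \<le> i" "i < cnt" "\<psi> i \<in> set xs"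
  shows "set xs = cls (rep i)"
proof
  show "set xs \<subseteq> cls (rep i)"
    using chain_subset_cls maximal_chain_is_chain assms by blast
  obtain t where t: "n \<le> t" "t < cnt" "topmost t" "rep t = rep i"
    using top_of[OF C(7,8)[OF assms(2,3)]] by metis
  have "\<psi> t \<in> set xs" using maximal_chain_top[OF assms(1) t(3,1,2) assms(2,3)] t(4) assms(4) by simp
  then show "cls (rep i) \<subseteq> set xs"
    using maximal_chain_top[OF assms(1) t(3,1,2)] t(4) C(7)[OF assms(2,3)] by (auto simp: cls_def)
qed

lemma maximal_chains_eq: "{set xs | xs. maximal_chain G xs} = cls ` {n..<N}"
proof
  show "{set xs | xs. maximal_chain G xs} \<subseteq> cls ` {n..<N}"
  proof
    fix X assume "X \<in> {set xs | xs. maximal_chain G xs}"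
    then obtain xs where xs: "maximal_chain G xs" "X = set xs" by auto
    note ch = maximal_chain_is_chain[OF xs(1)]
    have "last xs \<in> set xs" using chain_nonempty[OF ch] by simp
    then have "last xs \<in> core_nodes G" using chain_subset[OF ch] by blast
    then obtain i where i: "n \<le> i" "i < cnt" "last xs = \<psi> i" by (rule core_nodesE)
    then have "X = cls (rep i)"
      using maximal_chain_eq_cls[OF xs(1) i(1,2)] xs(2) \<open>last xs \<in> set xs\<close> by simp
    then show "X \<in> cls ` {n..<N}" using C(7,8)[OF i(1,2)] by simp
  qed
  show "cls ` {n..<N} \<subseteq> {set xs | xs. maximal_chain G xs}"
  proof
    fix X assume "X \<in> cls ` {n..<N}"
    then obtain c where c: "n \<le> c" "c < N" "X = cls c" by auto
    obtain t where t: "n \<le> t" "t < cnt" "rep t = c" using top_of[OF c(1,2)] by metis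
    obtain xs where xs: "maximal_chain G xs" "\<psi> t \<in> set xs"
      using maximal_chain_exists[OF simple nonempty \<psi>_core[OF t(1,2)]] by metis
    then show "X \<in> {set xs | xs. maximal_chain G xs}"
      using maximal_chain_eq_cls[OF xs(1) t(1,2) xs(2)] t c by auto
  qed
qed

lemma cct_nodes_eq: "cct_nodes G = cls ` {..<N}"
proof -
  have "(\<lambda>x. {x}) ` leaf_nodes G = cls ` {..<n}"
    by (auto simp: leaf_nodes_def verts_eq cls_def image_image intro!: image_eqI)
  moreover have "{..<N} = {..<n} \<union> {n..<N}" using C(3) by auto
  ultimately show ?thesis unfolding cct_nodes_def maximal_chains_eq by (simp add: image_Un)
qed

lemma cls_nonempty:
  assumes "c < N" obtains i where "i < cnt" "home i = c"
proof (cases "c < n")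
  case True
  then show ?thesis using that[of c] n_less_cnt by (simp add: home_def)
next
  case False
  then obtain t where "n \<le> t" "t < cnt" "rep t = c" using top_of[of c] assms by (metis not_less)
  then show ?thesis using that[of t] by (simp add: home_def)
qed

lemma cls_inj: "inj_on cls {..<N}"
proof (rule inj_onI)
  fix c d assume cd: "c \<in> {..<N}" "d \<in> {..<N}" "cls c = cls d"
  obtain i where i: "i < cnt" "home i = c" using cls_nonempty[of c] cd by auto
  then have "\<psi> i \<in> cls d" using in_cls_iff[OF i(1), of c] cd(3) by simp
  then show "c = d" using in_cls_iff[OF i(1), of d] i by simp
qed

lemma root_iff: "c < N \<Longrightarrow> cct_is_root G (cls c) \<longleftrightarrow> c = n"
  using in_cls_iff[OF n_less_cnt, of c] C(4) unfolding cct_is_root_def cct_nodes_eq \<psi>_root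
  by (auto simp: home_def)

text \<open>Every contracted node except the root has one member whose parent lies outside; it
  determines the parent and the lower label. For a leaf it is the leaf itself, for a chain its
  topmost core.\<close>

lemma highest_member:
  assumes "c < N" "c \<noteq> n"
  obtains t where "t < cnt" "t \<noteq> n" "home t = c" "up c = rep (par t)" "rep (par t) \<noteq> c" "lo c
    = lev t"
    "\<And>i. i < cnt \<Longrightarrow> home i = c \<Longrightarrow> i \<noteq> t \<Longrightarrow> i
      \<noteq> n \<Longrightarrow> rep (par i) = c"
proof (cases "c < n")
  case True
  show ?thesis
  proof (rule that[of c])
    show "rep (par c) \<noteq> c" using C(7)[of "par c"] par_leaf[OF True] True by auto
    fix i assume "i < cnt" "home i = c" "i \<noteq> c"
    then show "rep (par i) = c" using True C(7)[of i] by (auto simp: home_def split: if_splits)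
  qed (use True leaves[OF True] n_less_cnt in \<open>auto simp: home_def\<close>)
next
  case False
  then have c: "n < c" using assms by simp
  obtain t where t: "n \<le> t" "t < cnt" "topmost t" "rep t = c" using top_of[of c] c assms
    by (metis less_imp_le)
  have nt: "n < t" using t C(4) c by (cases "t = n") auto
  note p = par_core[OF nt t(2)]
  show ?thesis
  proof (rule that[of t])
    show "rep (par t) \<noteq> c"
    proof
      assume "rep (par t) = c"
      then obtain u where "n \<le> u" "u \<le> par t" "topmost u" "rep u = c"
        using top_exists[of "par t"] p t by auto
      then show False using top_unique[of u t] t p by simp
    qed
    fix i assume i: "i < cnt" "home i = c" "i \<noteq> t" "i \<noteq> n"
    then have ni: "n < i" "rep i = c" using c by (auto simp: home_def split: if_splits)
    then have "\<not> topmost i" using top_unique[of i t] t i by auto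
    then show "rep (par i) = c" using C(9)[OF ni(1) i(1)] ni by simp
  qed (use t nt C(10,11)[OF nt t(2,3)] in \<open>auto simp: home_def\<close>)
qed

lemma parent_cls:
  assumes "c < N" "c \<noteq> n"
  shows "up c < N" "{Y. (cls c, Y) \<in> cct_parent G} = {cls (up c)}"
proof -
  obtain t where t: "t < cnt" "t \<noteq> n" "home t = c" "up c = rep (par t)" "rep (par t) \<noteq> c"
    "\<And>i. i < cnt \<Longrightarrow> home i = c \<Longrightarrow> i \<noteq> t \<Longrightarrow> i
      \<noteq> n \<Longrightarrow> rep (par i) = c"
    using highest_member[OF assms] by metis
  have home_par: "home (par i) = rep (par i)" "par i < cnt" if "i < cnt" "i \<noteq> n" for i
    using par_range[OF that] by (simp_all add: home_def)
  show up: "up c < N" using home_less[OF home_par(2)[OF t(1,2)]] home_par(1)[OF t(1,2)] t(4) by simp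
  show "{Y. (cls c, Y) \<in> cct_parent G} = {cls (up c)}"
  proof
    show "{cls (up c)} \<subseteq> {Y. (cls c, Y) \<in> cct_parent G}"
    proof -
      have "cls c \<noteq> cls (up c)" using inj_onD[OF cls_inj, of c "up c"] assms up t(4,5) by auto
      moreover have "\<psi> t \<in> cls c" using in_cls_iff[OF t(1)] t(3) by simp
      moreover have "\<psi> (par t) \<in> cls (up c)"
        using in_cls_iff[OF home_par(2)[OF t(1,2)]] home_par(1)[OF t(1,2)] t(4) by simp
      ultimately show ?thesis
        using par_parent[OF t(1,2)] assms up unfolding cct_parent_def cct_nodes_eq by auto
    qed
    show "{Y. (cls c, Y) \<in> cct_parent G} \<subseteq> {cls (up c)}"
    proof
      fix Y assume "Y \<in> {Y. (cls c, Y) \<in> cct_parent G}"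
      then obtain d x y where d: "d < N" "Y = cls d" "cls c \<noteq> Y" "x \<in> cls c" "y \<in> Y" "(x, y)
        \<in> unc_parent G"
        unfolding cct_parent_def cct_nodes_eq by auto
      obtain i where i: "i < cnt" "i \<noteq> n" "x = \<psi> i" using d(6) by (rule \<psi>_surj)
      have hi: "home i = c" using in_cls_iff[OF i(1)] d(4) i(3) by simp
      have "y = \<psi> (par i)" using parent_iff[OF i(1,2)] d(6) i(3) by simp
      then have dd: "d = rep (par i)"
        using in_cls_iff[OF home_par(2)[OF i(1,2)], of d] home_par(1)[OF i(1,2)] d(2,5) by simp
      \<comment> \<open>An edge leaving the class can only start at its highest member, which makes
        the contracted parent unique.\<close>
      have "i = t" using t(6)[OF i(1) hi _ i(2)] dd d(2,3) by auto
      then show "Y \<in> {cls (up c)}" using dd d(2) t(4) by simp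
    qed
  qed
qed

lemma level_\<psi>: "i < cnt \<Longrightarrow> level G (\<psi> i) = lev i"
  using lev_core[of i] lev_leaf[of i] \<psi>_leaf[of i] by (cases "i < n") auto

lemma labels_cls:
  assumes "c < N"
  shows "lo c = min_c G (cls c)" "hi c = max_c G (cls c)"
proof -
  have cls: "cls c = \<psi> ` {i. i < cnt \<and> home i = c}"
    using cls_elem[OF _ assms] in_cls_iff by blast
  have lev: "level G ` cls c = lev ` {i. i < cnt \<and> home i = c}"
    unfolding cls image_image using level_\<psi> by (intro image_cong) auto
  have fin: "finite (level G ` cls c)"
    unfolding lev by (rule finite_imageI, rule finite_subset[of _ "{..<cnt}"]) auto
  have bound: "lo c \<le> lev i \<and> lev i \<le> hi c" if i: "i < cnt" "home i = c" for i
  proof (cases "i < n")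
    case True
    then show ?thesis using leaves[OF True] i by (simp add: home_def)
  next
    case False
    then show ?thesis using C(13,14)[of i] i by (auto simp: home_def)
  qed
  have "lo c \<in> level G ` cls c"
  proof (cases "c = n")
    case True
    have "lev n = 0" using level_\<psi>[OF n_less_cnt] by (simp add: \<psi>_root)
    then show ?thesis unfolding lev using True C(4,6) n_less_cnt
      by (intro image_eqI[of _ _ n]) (simp_all add: home_def)
  next
    case False
    obtain t where "t < cnt" "home t = c" "lo c = lev t" using highest_member[OF assms False] by metis
    then show ?thesis unfolding lev by auto
  qed
  then show "lo c = min_c G (cls c)"
    unfolding min_c_def using fin bound by (intro Min_eqI[symmetric]) (auto simp: lev)
  have "hi c \<in> level G ` cls c"
  proof (cases "c < n")
    case True
    then show ?thesis unfolding lev using leaves[OF True] n_less_cnt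
      by (intro image_eqI[of _ _ c]) (simp_all add: home_def)
  next
    case False
    then obtain i where "n \<le> i" "i < cnt" "rep i = c" "lev i = hi c" using C(15)[of c] assms by auto
    then show ?thesis unfolding lev by (intro image_eqI[of _ _ i]) (simp_all add: home_def)
  qed
  then show "hi c = max_c G (cls c)"
    unfolding max_c_def using fin bound by (intro Max_eqI[symmetric]) (auto simp: lev)
qed

lemma represents:
  assumes "regs s 1 = N" "arrs s 2 = up" "arrs s 3 = lo" "arrs s 4 = hi"
  shows "represents_cct s G"
  unfolding represents_cct_def assms
proof (intro exI[of _ cls] conjI ballI allI impI)
  show "bij_betw cls {..<N} (cct_nodes G)" using cls_inj cct_nodes_eq by (simp add: bij_betw_def)
  fix v assume "v \<in> verts G"
  then show "v < N" "cls v = {Leaf v}" using C(3) by (simp_all add: in_verts_iff cls_def)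
next
  fix c assume c: "c < N"
  show "if cct_is_root G (cls c) then up c = c
      else up c < N \<and> {Y. (cls c, Y) \<in> cct_parent G} = {cls (up c)}"
    using root_iff[OF c] parent_cls[OF c] C(5) by auto
  show "lo c = min_c G (cls c)" "hi c = max_c G (cls c)" using labels_cls[OF c] by simp_all
qed

end

section \<open>The contraction program and its running time\<close>

context uncontracted_tree
begin

definition tree_state :: "state \<Rightarrow> bool" where
  "tree_state s \<longleftrightarrow> regs s 0 = n \<and> regs s 13 = cnt \<and> arrs s 16 = par \<and>
    arrs s 17 = lev \<and> regs s 23 = 0"

definition count_state :: "nat \<Rightarrow> state \<Rightarrow> bool" where
  "count_state p s \<longleftrightarrow> tree_state s \<and> regs s 20 \<le> cnt \<and> p = cnt - regs s 20
    \<and>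
     (\<forall>i. arrs s 18 i = card {j. j < regs s 20 \<and> j \<noteq> n \<and> par j = i})"

lemma count_step:
  assumes "count_state p s" "bval (Less (Reg 20) (Reg 13)) s"
  shows "\<exists>q<p. count_state q (run count_body s)"
proof -
  let ?j = "regs s 20"
  have s: "tree_state s" "?j < cnt" "p = cnt - ?j"
    "\<forall>i. arrs s 18 i = card {j. j < ?j \<and> j \<noteq> n \<and> par j = i}"
    using assms by (auto simp: count_state_def tree_state_def)
  have "card {j. j < Suc ?j \<and> j \<noteq> n \<and> par j = i} =
      (if ?j \<noteq> n \<and> par ?j = i then Suc (arrs s 18 i) else arrs s 18 i)" for i
  proof (cases "?j \<noteq> n \<and> par ?j = i")
    case True
    then have "{j. j < Suc ?j \<and> j \<noteq> n \<and> par j = i} = insert ?j {j. j < ?j \<and> j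
      \<noteq> n \<and> par j = i}"
      by (auto simp: less_Suc_eq)
    then show ?thesis using True s(4) by simp
  next
    case False
    then have "{j. j < Suc ?j \<and> j \<noteq> n \<and> par j = i} = {j. j < ?j \<and> j \<noteq> n \<and>
      par j = i}"
      by (auto simp: less_Suc_eq)
    then show ?thesis using False s(4) by auto
  qed
  then have "count_state (cnt - Suc ?j) (run count_body s)"
    using s(1,2) unfolding count_state_def tree_state_def
    by (auto simp: count_body_def linorder_neq_iff)
  then show ?thesis using s by (intro exI[of _ "cnt - Suc ?j"]) simp
qed

definition contract_state :: "nat \<Rightarrow> state \<Rightarrow> bool" where
  "contract_state p s \<longleftrightarrow> tree_state s \<and> (\<forall>i. arrs s 18 i = card (kids i))
    \<and> p = cnt - regs s 21 \<and>
     contracted (regs s 21) (regs s 1) (arrs s 19) (arrs s 2) (arrs s 3) (arrs s 4)"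

lemma contract_step:
  assumes "contract_state p s" "bval (Less (Reg 21) (Reg 13)) s"
  shows "\<exists>q<p. contract_state q (run contract_body s)"
proof -
  let ?I = "regs s 21"
  let ?q = "arrs s 19 (par ?I)"
  have s: "tree_state s" "?I < cnt" "p = cnt - ?I" "\<forall>i. arrs s 18 i = card (kids i)"
    "contracted ?I (regs s 1) (arrs s 19) (arrs s 2) (arrs s 3) (arrs s 4)"
    using assms by (auto simp: contract_state_def tree_state_def)
  have par: "arrs s 16 = par" "arrs s 17 = lev" using s(1) by (simp_all add: tree_state_def)
  have "contract_state (cnt - Suc ?I) (run contract_body s)"
  proof (cases "card (kids (par ?I)) < 2")
    case True
    have "(arrs s 4)(?q := max (arrs s 4 ?q) (lev ?I)) =
        (if arrs s 4 ?q < lev ?I then (arrs s 4)(?q := lev ?I) else arrs s 4)"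
      by (auto simp: max_def)
    then show ?thesis
      using contracted_merge[OF s(5,2) True] s True par
      by (auto simp: contract_state_def tree_state_def contract_body_def)
  next
    case False
    then have two: "2 \<le> card (kids (par ?I))" by simp
    show ?thesis
      using contracted_new[OF s(5,2) two] s False par
      by (auto simp: contract_state_def tree_state_def contract_body_def)
  qed
  then show ?thesis using s by (intro exI[of _ "cnt - Suc ?I"]) simp
qed

definition leaf_state :: "nat \<Rightarrow> state \<Rightarrow> bool" where
  "leaf_state p s \<longleftrightarrow> regs s 0 = n \<and> arrs s 16 = par \<and> arrs s 17 = lev \<and>
    regs s 23 \<le> n \<and> p = n - regs s 23 \<and>
     contracted cnt (regs s 1) (arrs s 19) (arrs s 2) (arrs s 3) (arrs s 4) \<and>
     (\<forall>v<regs s 23. arrs s 2 v = arrs s 19 (par v) \<and> arrs s 3 v = lev v \<and> arrs s 4 v =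
       lev v)"

lemma leaf_step:
  assumes "leaf_state p s" "bval (Less (Reg 23) (Reg 0)) s"
  shows "\<exists>q<p. leaf_state q (run leaf_body s)"
proof -
  let ?v = "regs s 23"
  have s: "regs s 0 = n" "arrs s 16 = par" "arrs s 17 = lev" "?v < n" "p = n - ?v"
    "contracted cnt (regs s 1) (arrs s 19) (arrs s 2) (arrs s 3) (arrs s 4)"
    "\<forall>v<?v. arrs s 2 v = arrs s 19 (par v) \<and> arrs s 3 v = lev v \<and> arrs s 4 v = lev v"
    using assms by (auto simp: leaf_state_def)
  have "leaf_state (n - Suc ?v) (run leaf_body s)"
    using contracted_leaf[OF s(6,4)] s by (auto simp: leaf_state_def leaf_body_def less_Suc_eq)
  then show ?thesis using s by (intro exI[of _ "n - Suc ?v"]) simp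
qed

lemma leaf_done:
  assumes "leaf_state p s" "\<not> bval (Less (Reg 23) (Reg 0)) s"
  shows "represents_cct s G"
proof -
  have "regs s 23 = n" using assms by (simp add: leaf_state_def)
  then interpret contracted_tree G xss \<psi> cnt par lev "regs s 1" "arrs s 19" "arrs s 2" "arrs s 3"
    "arrs s 4"
    using assms(1) by unfold_locales (simp_all add: leaf_state_def)
  show ?thesis by (rule represents) simp_all
qed

text \<open>A core is named by a vertex \<open>v\<close> and a level at most
  \<open>coreness G v\<close>, hence at most the degree of \<open>v\<close>; this gives at most
  \<open>n + 2 m\<close> cores, besides the \<open>n\<close> leaves.\<close>

lemma cnt_le: "cnt \<le> 2 * n + 2 * card (edges G)"
proof -
  have "core_nodes G \<subseteq> (\<lambda>(v, k). Core k (core_of G k v)) ` (SIGMA v:{..<n}. {..coreness G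
    v})"
  proof
    fix x assume "x \<in> core_nodes G"
    then obtain k v where x: "x = Core k (core_of G k v)" "v \<in> core_verts G k"
      by (auto simp: core_nodes_eq[OF simple nonempty])
    then have "v < n" "k \<le> coreness G v" using core_verts_less le_coreness by auto
    then show "x \<in> (\<lambda>(v, k). Core k (core_of G k v)) ` (SIGMA v:{..<n}. {..coreness G v})"
      using x by (intro image_eqI[of _ _ "(v, k)"]) simp_all
  qed
  then have "card (core_nodes G) \<le> card (SIGMA v:{..<n}. {..coreness G v})"
    by (intro surj_card_le) simp_all
  also have "\<dots> = (\<Sum>v<n. Suc (coreness G v))" by simp
  also have "\<dots> \<le> (\<Sum>v<n. Suc (deg v))" by (intro sum_mono) (simp add: coreness_le_deg)
  also have "\<dots> = (\<Sum>v<n. deg v) + n" by (simp add: sum_Suc)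
  finally have "card (core_nodes G) \<le> n + 2 * card (edges G)" using sum_deg_le by simp
  moreover have "card (core_nodes G) = cnt - n" using bij_betw_same_card[OF \<psi>_bij] by simp
  ultimately show ?thesis by simp
qed

end

definition tree_prog :: com where
  "tree_prog =
     Seq (While (Less (Reg 20) (Reg 13)) count_body)
    (Seq contract_init
    (Seq (While (Less (Reg 21) (Reg 13)) contract_body)
         (While (Less (Reg 23) (Reg 0)) leaf_body)))"

text \<open>Each loop makes at most \<open>2 (n + m)\<close> iterations; the factor 3 absorbs the
  final test.\<close>

definition tree_time :: nat where
  "tree_time = 3 * (1 + bcost (Less (Reg 20) (Reg 13)) + cost count_body) + cost contract_init +
     3 * (1 + bcost (Less (Reg 21) (Reg 13)) + cost contract_body) +
     3 * (1 + bcost (Less (Reg 23) (Reg 0)) + cost leaf_body)"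

lemma runs_While_le:
  assumes "loop_free c" "\<exists>p\<le>P. I p s"
    and "\<And>p s. I p s \<Longrightarrow> bval b s \<Longrightarrow> \<exists>q<p. I q (run c s)"
    and "\<And>p s. I p s \<Longrightarrow> \<not> bval b s \<Longrightarrow> Q s"
  shows "runs (While b c) s (Suc P * (1 + bcost b + cost c)) Q"
proof -
  obtain p where p: "p \<le> P" "I p s" using assms(2) by blast
  show ?thesis
  proof (rule runs_weaken[OF runs_While[where I = I, OF assms(1) p(2) assms(3)]])
    show "Suc p * (1 + bcost b + cost c) \<le> Suc P * (1 + bcost b + cost c)"
      using p(1) by (intro mult_le_mono1) simp
  qed (use assms(4) in blast)+
qed

context input_graph
begin

lemma runs_tree:
  assumes "flood_post s"
  shows "runs tree_prog s (tree_time * (n + card (edges G))) (\<lambda>s. represents_cct s G)"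
proof -
  from assms obtain \<psi> where tr: "tree_rep \<psi> (regs s 13) (arrs s 16) (arrs s 17)"
    and s: "regs s 0 = n" "zero_from 20 18 s" unfolding flood_post_def by blast
  define cnt par lev where "cnt = regs s 13" and "par = arrs s 16" and "lev = arrs s 17"
  interpret uncontracted_tree G xss \<psi> cnt par lev
    using tr by unfold_locales (simp add: cnt_def par_def lev_def)
  let ?P = "2 * (n + card (edges G))"
  have le: "cnt \<le> ?P" "n \<le> ?P" using cnt_le by simp_all
  let ?Q1 = "\<lambda>s. tree_state s \<and> (\<forall>i. arrs s 18 i = card (kids i))"
  let ?Q2 = "\<lambda>s. \<exists>p\<le>?P. contract_state p s"
  let ?Q3 = "\<lambda>s. \<exists>p\<le>?P. leaf_state p s"
  have 1: "runs (While (Less (Reg 20) (Reg 13)) count_body) s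
      (Suc ?P * (1 + bcost (Less (Reg 20) (Reg 13)) + cost count_body)) ?Q1"
  proof (rule runs_While_le[where I = count_state, OF _ _ count_step])
    have "count_state cnt s"
      using s unfolding count_state_def tree_state_def
      by (simp add: cnt_def par_def lev_def zero_from_def)
    then show "\<exists>p\<le>?P. count_state p s" using le by blast
  qed (auto simp: count_body_def count_state_def tree_state_def kids_def)
  have 2: "runs contract_init s (cost contract_init) ?Q2" if "?Q1 s" for s
  proof (rule runs_loop_free)
    have "contract_state (cnt - Suc n) (run contract_init s)"
    proof -
      have "contracted (Suc n) (Suc n) ((arrs s 19)(n := n)) ((arrs s 2)(n := n)) ((arrs s 3)(n := 0))
          ((arrs s 4)(n := 0))" by (rule contracted_start) simp_all
      then show ?thesis using that by (simp add: contract_state_def tree_state_def contract_init_def)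
    qed
    moreover have "cnt - Suc n \<le> ?P" using le by simp
    ultimately show "?Q2 (run contract_init s)" by blast
  qed (simp add: contract_init_def)
  have 3: "runs (While (Less (Reg 21) (Reg 13)) contract_body) s
      (Suc ?P * (1 + bcost (Less (Reg 21) (Reg 13)) + cost contract_body)) ?Q3" if "?Q2 s" for s
  proof (rule runs_While_le[where I = contract_state, OF _ that contract_step])
    fix p s assume *: "contract_state p s" "\<not> bval (Less (Reg 21) (Reg 13)) s"
    then have "regs s 21 = cnt"
      using contractedD(2) by (fastforce simp: contract_state_def tree_state_def)
    then have "leaf_state n s" using * by (simp add: contract_state_def tree_state_def leaf_state_def)
    then show "?Q3 s" using le by blast
  qed (simp_all add: contract_body_def)
  have 4: "runs (While (Less (Reg 23) (Reg 0)) leaf_body) s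
      (Suc ?P * (1 + bcost (Less (Reg 23) (Reg 0)) + cost leaf_body)) (\<lambda>s. represents_cct s G)"
    if "?Q3 s" for s
    by (rule runs_While_le[where I = leaf_state, OF _ that leaf_step leaf_done])
      (simp_all add: leaf_body_def)
  note * = runs_Seq[OF 1 runs_Seq[OF 2 runs_Seq[OF 3 4]]]
  let ?N = "n + card (edges G)"
  have arith: "Suc (2 * N) * a + (b + (Suc (2 * N) * c + Suc (2 * N) * d)) \<le> (3 * a + b + 3 * c + 3 *
    d) * N"
    if "1 \<le> N" for N a b c d :: nat
  proof -
    have "Suc (2 * N) * x \<le> 3 * x * N" for x
      using mult_le_mono1[of "Suc (2 * N)" "3 * N" x] that by (simp add: algebra_simps)
    moreover have "b \<le> b * N" using that by simp
    ultimately have "Suc (2 * N) * a + (b + (Suc (2 * N) * c + Suc (2 * N) * d)) \<le>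
        3 * a * N + (b * N + (3 * c * N + 3 * d * N))" by (intro add_mono)
    then show ?thesis by (simp add: algebra_simps)
  qed
  show ?thesis
    unfolding tree_prog_def
  proof (rule runs_weaken[OF *])
    have "1 \<le> ?N" using n_pos by simp
    from arith[OF this] show "Suc ?P * (1 + bcost (Less (Reg 20) (Reg 13)) + cost count_body) +
      (cost contract_init + (Suc ?P * (1 + bcost (Less (Reg 21) (Reg 13)) + cost contract_body) +
       Suc ?P * (1 + bcost (Less (Reg 23) (Reg 0)) + cost leaf_body))) \<le> tree_time * ?N"
      unfolding tree_time_def .
  qed simp
qed

end

section \<open>The inverse Ackermann factor and the final bound\<close>

lemma less_ack: "k < ack m k"
proof (induction m k rule: ack.induct)
  case (3 m k)
  then show ?case by simp
qed simp_all

lemma one_le_alpha: "2 \<le> k \<Longrightarrow> 1 \<le> alpha k"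
proof (rule ccontr)
  assume k: "2 \<le> k" "\<not> 1 \<le> alpha k"
  \<comment> \<open>This shows that the least number in the definition of \<open>alpha\<close>
    exists. The value 0 is impossible, since \<open>ack 0 0\<close> is 1.\<close>
  have "k \<le> ack k k" using less_ack[of k k] by simp
  then have "k \<le> ack (alpha k) (alpha k)" unfolding alpha_def by (rule LeastI)
  moreover have "alpha k = 0" using k(2) by simp
  ultimately show False using k(1) by simp
qed

context input_graph
begin

text \<open>An edge requires two vertices, where \<open>alpha\<close> is already positive; without
  edges both sides are 0.\<close>

lemma edges_le_alpha: "card (edges G) \<le> card (edges G) * alpha (card (verts G))"
proof (cases "edges G = {}")
  case False
  then obtain e where "e \<subseteq> verts G" "card e = 2" using simple by (auto simp: simple_graph_def)
  then have "2 \<le> card (verts G)" using simple card_mono[of "verts G" e] by (simp add: simple_graph_def)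
  then show ?thesis using one_le_alpha[of "card (verts G)"] by simp
qed simp

lemma runs_all:
  "runs (Seq peel_prog (Seq flood_prog tree_prog)) (input_state xss)
     ((peel_time + flood_time + tree_time) * (card (verts G) + card (edges G) * alpha (card (verts G))))
     (\<lambda>s. represents_cct s G)"
proof (rule runs_weaken[OF runs_Seq[OF runs_peel runs_Seq[OF runs_flood runs_tree]]])
  let ?N = "n + card (edges G)"
  have "?N \<le> card (verts G) + card (edges G) * alpha (card (verts G))"
    using edges_le_alpha by (simp add: verts_eq)
  then have "(peel_time + flood_time + tree_time) * ?N \<le> (peel_time + flood_time + tree_time) *
      (card (verts G) + card (edges G) * alpha (card (verts G)))"
    by (rule mult_le_mono2)
  then show "peel_time * ?N + (flood_time * ?N + tree_time * ?N) \<le> (peel_time + flood_time + tree_time) *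
      (card (verts G) + card (edges G) * alpha (card (verts G)))"
    by (simp only: distrib_right add.assoc)
qed

end

theorem theorem1:
  "(\<exists>C. \<forall>G :: 'a ugraph. simple_graph G \<and> verts G \<noteq> {} \<and> no_isolated G
    \<longrightarrow>
      finite (cct_nodes G) \<and> card (cct_nodes G) \<le> C * card (verts G)) \<and>
   (\<exists>prog C. \<forall>(G :: nat ugraph) xss.
      simple_graph G \<and> verts G \<noteq> {} \<and> no_isolated G \<and> adjacency_lists G xss
        \<longrightarrow>
      (\<exists>t s. exec prog (input_state xss) t s \<and> represents_cct s G \<and>
         t \<le> C * (card (verts G) + card (edges G) * alpha (card (verts G)))))"
proof (rule conjI)
  show "\<exists>C. \<forall>G :: 'a ugraph. simple_graph G \<and> verts G \<noteq> {} \<and> no_isolated G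
    \<longrightarrow>
      finite (cct_nodes G) \<and> card (cct_nodes G) \<le> C * card (verts G)"
    using card_cct_nodes by (intro exI[of _ 3]) blast
  \<comment> \<open>The program and the constant are fixed before the graph, so the locale can be
    interpreted for each input separately.\<close>
  have "\<exists>t s. exec (Seq peel_prog (Seq flood_prog tree_prog)) (input_state xss) t s \<and>
    represents_cct s G \<and>
      t \<le> (peel_time + flood_time + tree_time) * (card (verts G) + card (edges G) * alpha (card (verts
        G)))"
    if "simple_graph G" "verts G \<noteq> {}" "adjacency_lists G xss" for G :: "nat ugraph" and xss
  proof -
    interpret input_graph G xss using that by unfold_locales
    show ?thesis using runs_all unfolding runs_def by blast
  qed
  then show "\<exists>prog C. \<forall>(G :: nat ugraph) xss.
      simple_graph G \<and> verts G \<noteq> {} \<and> no_isolated G \<and> adjacency_lists G xss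
        \<longrightarrow>
      (\<exists>t s. exec prog (input_state xss) t s \<and> represents_cct s G \<and>
         t \<le> C * (card (verts G) + card (edges G) * alpha (card (verts G))))"
    by blast
qed

end
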